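(* $(X_\infty,\hat d_\infty,\mu_\infty)$ has analytic dimension $1$, and $(X_\infty,x_\infty)$ is a differentiability chart: for every Lipschitz $f:X_\infty\to\mathbb R$ there is a bounded measurable function $a:X_\infty\to\mathbb R$ (in fact $a=D_\infty f$) such that for $\mu_\infty$-a.e. $p\in X_\infty$, $$f(q)=f(p)+a(p)\,(x_\infty(q)-x_\infty(p))+o(\hat d_\infty(p,q))\quad\text{as }q\to p.$$ Moreover, the pushforward under $\hat\pi^\infty$ of the family of horizontal lines $\{\mathbb R\times\{y\}\}_{y\in\mathbb R}$ of $\mathbb R^2$, with the measure $\mathcal L^1$ on the parameter $y$, is a universal Alberti representation (in the sense of Bate) for $(X_\infty,\mu_\infty)$.
   Context: Standing construction ($n=2$). Fix an integer $L\ge100$, $m=4$, $m_v=3L$. For $j\in\mathbb Z$, $Y_j$ is the cell complex on $\mathbb R^2$ given by the tiling by rectangles $[am^{-j},(a+1)m^{-j}]\times[bm_v^{-j},(b+1)m_v^{-j}]$, $a,b\in\mathbb Z$. Let $\Phi(x,y)=(m^{-1}x,m_v^{-1}y)$. For $k,\ell\in\mathbb Z$, $i\in\{1,2,3\}$, $a_{k,\ell,i}=\{k+\tfrac i4\}\times[(3\ell+i-1)m_v^{-1},(3\ell+i)m_v^{-1}]$. $\mathcal R$ is the equivalence relation on $\mathbb R^2$ generated by $p\sim p+(0,m_v^{-1})$ for $p\in a_{k,\ell,i}$. $\Phi^j_*\mathcal R=\{(\Phi^jp,\Phi^jq):(p,q)\in\mathcal R\}$; $\mathcal R_\infty$ is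 generated by all $\Phi^j_*\mathcal R$. $X_\infty=\mathbb R^2/\mathcal R_\infty$, $\hat\pi^\infty$ the quotient map, $\hat d_\infty$ the largest pseudodistance on $X_\infty$ such that for every $i\in\mathbb Z$ and every $2$-cell $\hat\sigma$ of $Y_i$, $\hat\pi^\infty(\hat\sigma)$ has diameter $\le m^{-i}$; $\mu_\infty=\hat\pi^\infty_\#\mathcal L^2$. The first coordinate $x$ descends to a $1$-Lipschitz $x_\infty:X_\infty\to\mathbb R$. $D_\infty f\in L^\infty(\mu_\infty)$ is defined by $\int g\,D_\infty f\,d\mu_\infty=\int (g\circ\hat\pi^\infty)\,\partial_x(f\circ\hat\pi^\infty)\,d\mathcal L^2$ for all $g\in L^1(\mu_\infty)$. Analytic dimension means the dimension of Cheeger's measurable differentiable structure. *)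

theory Defs
  imports "HOL-Analysis.Analysis"
begin

section \<open>Generic notions for a (pseudo)metric measure space given by a carrier X,
  a distance function d on X and a measure mu with space mu = X\<close>

definition lipschitz_X :: "'a set \<Rightarrow> ('a \<Rightarrow> 'a \<Rightarrow> real) \<Rightarrow> ('a \<Rightarrow> real) \<Rightarrow> bool" where
  "lipschitz_X X d f \<longleftrightarrow> (\<exists>C. \<forall>p\<in>X. \<forall>q\<in>X. \<bar>f p - f q\<bar> \<le> C * d p q)"

text \<open>f(q) = f(p) + sum_i df_i (phi_i(q) - phi_i(p)) + o(d(p,q)) as q tends to p
  (phi : X -> R^n, vectors in R^n represented by their first n components)\<close>
definition has_differential_at ::
  "'a set \<Rightarrow> ('a \<Rightarrow> 'a \<Rightarrow> real) \<Rightarrow> ('a \<Rightarrow> nat \<Rightarrow> real) \<Rightarrow> nat \<Rightarrow> ('a \<Rightarrow> real)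
     \<Rightarrow> (nat \<Rightarrow> real) \<Rightarrow> 'a \<Rightarrow> bool" where
  "has_differential_at X d \<phi> n f df p \<longleftrightarrow>
     (\<forall>\<epsilon>>0. \<exists>\<delta>>0. \<forall>q\<in>X. d p q < \<delta> \<longrightarrow>
        \<bar>f q - f p - (\<Sum>i<n. df i * (\<phi> q i - \<phi> p i))\<bar> \<le> \<epsilon> * d p q)"

definition cheeger_chart ::
  "'a set \<Rightarrow> ('a \<Rightarrow> 'a \<Rightarrow> real) \<Rightarrow> 'a measure \<Rightarrow> 'a set \<Rightarrow> ('a \<Rightarrow> nat \<Rightarrow> real) \<Rightarrow> nat \<Rightarrow> bool" where
  "cheeger_chart X d \<mu> U \<phi> n \<longleftrightarrow>
     U \<in> sets \<mu> \<and> emeasure \<mu> U > 0 \<and>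
     (\<forall>i<n. lipschitz_X X d (\<lambda>p. \<phi> p i)) \<and>
     (\<forall>f. lipschitz_X X d f \<longrightarrow>
        (AE p in \<mu>. p \<in> U \<longrightarrow>
           (\<exists>df. has_differential_at X d \<phi> n f df p \<and>
              (\<forall>df'. has_differential_at X d \<phi> n f df' p \<longrightarrow> (\<forall>i<n. df' i = df i)))))"

definition analytic_dimension ::
  "'a set \<Rightarrow> ('a \<Rightarrow> 'a \<Rightarrow> real) \<Rightarrow> 'a measure \<Rightarrow> nat \<Rightarrow> bool" where
  "analytic_dimension X d \<mu> N \<longleftrightarrow>
     (\<exists>(I::nat set) U \<phi> n.
        (\<forall>i\<in>I. cheeger_chart X d \<mu> (U i) (\<phi> i) (n i)) \<and>
        (AE p in \<mu>. \<exists>i\<in>I. p \<in> U i) \<and>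
        (\<forall>i\<in>I. n i \<le> N) \<and> (\<exists>i\<in>I. n i = N))"

definition lip_at :: "'a set \<Rightarrow> ('a \<Rightarrow> 'a \<Rightarrow> real) \<Rightarrow> ('a \<Rightarrow> real) \<Rightarrow> 'a \<Rightarrow> real" where
  "lip_at X d f p = real_of_ereal (Limsup (at_right 0)
      (\<lambda>r::real. ereal ((SUP q\<in>{q\<in>X. d p q \<le> r}. \<bar>f q - f p\<bar>) / r)))"

definition has_metric_speed :: "('a \<Rightarrow> 'a \<Rightarrow> real) \<Rightarrow> (real \<Rightarrow> 'a) \<Rightarrow> real \<Rightarrow> real \<Rightarrow> bool" where
  "has_metric_speed d \<gamma> t v \<longleftrightarrow> ((\<lambda>h. d (\<gamma> (t + h)) (\<gamma> t) / \<bar>h\<bar>) \<longlongrightarrow> v) (at 0)"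

text \<open>The family of curves gamma_y (y real), parametrised by y with Lebesgue measure and
  with measures nu_y = pushforward of L^1 by gamma_y, is an Alberti representation of mu
  (each gamma_y is bi-Lipschitz, and mu = integral of nu_y dy), and it is universal
  (Bate): for every Lipschitz f, for a.e. y and a.e. t, |(f o gamma_y)'(t)| = Lip f(gamma_y t) |gamma_y'|(t).\<close>
definition universal_alberti_rep_lines ::
  "'a set \<Rightarrow> ('a \<Rightarrow> 'a \<Rightarrow> real) \<Rightarrow> 'a measure \<Rightarrow> (real \<Rightarrow> real \<Rightarrow> 'a) \<Rightarrow> bool" where
  "universal_alberti_rep_lines X d \<mu> \<gamma> \<longleftrightarrow>
     (\<forall>y. \<gamma> y \<in> lborel \<rightarrow>\<^sub>M \<mu>) \<and>
     (\<forall>y. \<exists>C\<ge>1. \<forall>s t. \<gamma> y s \<in> X \<and> \<bar>s - t\<bar> / C \<le> d (\<gamma> y s) (\<gamma> y t)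
                           \<and> d (\<gamma> y s) (\<gamma> y t) \<le> C * \<bar>s - t\<bar>) \<and>
     (\<forall>A\<in>sets \<mu>. (\<lambda>y. emeasure (distr lborel \<mu> (\<gamma> y)) A) \<in> borel_measurable lborel \<and>
                 emeasure \<mu> A = (\<integral>\<^sup>+ y. emeasure (distr lborel \<mu> (\<gamma> y)) A \<partial>lborel)) \<and>
     (\<forall>f. lipschitz_X X d f \<longrightarrow>
        (AE y in lborel. AE t in lborel. \<exists>D v.
            ((\<lambda>s. f (\<gamma> y s)) has_real_derivative D) (at t) \<and>
            has_metric_speed d (\<gamma> y) t v \<and>
            \<bar>D\<bar> = lip_at X d f (\<gamma> y t) * v))"

section \<open>The standing construction (n = 2, m = 4, m_v = 3L)\<close>

definition mv :: "nat \<Rightarrow> real" where "mv L = 3 * real L"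

definition eq_closure :: "('a \<times> 'a) set \<Rightarrow> ('a \<times> 'a) set" where
  "eq_closure S = (S \<union> S\<inverse>)\<^sup>*"

definition aseg :: "nat \<Rightarrow> int \<Rightarrow> int \<Rightarrow> nat \<Rightarrow> (real \<times> real) set" where
  "aseg L k l i = {(real_of_int k + real i / 4, y) | y.
        (3 * real_of_int l + real i - 1) / mv L \<le> y \<and> y \<le> (3 * real_of_int l + real i) / mv L}"

definition gen_rel :: "nat \<Rightarrow> ((real \<times> real) \<times> (real \<times> real)) set" where
  "gen_rel L = {(p, (fst p, snd p + 1 / mv L)) | p. \<exists>k l i. i \<in> {1,2,3} \<and> p \<in> aseg L k l i}"

definition R0 :: "nat \<Rightarrow> ((real \<times> real) \<times> (real \<times> real)) set" where
  "R0 L = eq_closure (gen_rel L)"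

definition Phi_pow :: "nat \<Rightarrow> int \<Rightarrow> real \<times> real \<Rightarrow> real \<times> real" where
  "Phi_pow L j p = ((4::real) powi (- j) * fst p, mv L powi (- j) * snd p)"

definition Rinf :: "nat \<Rightarrow> ((real \<times> real) \<times> (real \<times> real)) set" where
  "Rinf L = eq_closure (\<Union>j::int. (\<lambda>(p, q). (Phi_pow L j p, Phi_pow L j q)) ` R0 L)"

definition Xinf :: "nat \<Rightarrow> (real \<times> real) set set" where
  "Xinf L = UNIV // Rinf L"

definition pi_inf :: "nat \<Rightarrow> real \<times> real \<Rightarrow> (real \<times> real) set" where
  "pi_inf L p = Rinf L `` {p}"

definition cell :: "nat \<Rightarrow> int \<Rightarrow> int \<Rightarrow> int \<Rightarrow> (real \<times> real) set" where
  "cell L i a b =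
     {real_of_int a * 4 powi (- i) .. (real_of_int a + 1) * 4 powi (- i)} \<times>
     {real_of_int b * mv L powi (- i) .. (real_of_int b + 1) * mv L powi (- i)}"

definition pseudodist_on :: "'a set \<Rightarrow> ('a \<Rightarrow> 'a \<Rightarrow> real) \<Rightarrow> bool" where
  "pseudodist_on X d \<longleftrightarrow> (\<forall>p\<in>X. \<forall>q\<in>X. \<forall>r\<in>X.
      0 \<le> d p q \<and> d p p = 0 \<and> d p q = d q p \<and> d p r \<le> d p q + d q r)"

definition admissible_dist :: "nat \<Rightarrow> ((real \<times> real) set \<Rightarrow> (real \<times> real) set \<Rightarrow> real) \<Rightarrow> bool" where
  "admissible_dist L d \<longleftrightarrow> pseudodist_on (Xinf L) d \<and>
     (\<forall>i a b. \<forall>z\<in>cell L i a b. \<forall>w\<in>cell L i a b. d (pi_inf L z) (pi_inf L w) \<le> 4 powi (- i))"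

definition dinf :: "nat \<Rightarrow> (real \<times> real) set \<Rightarrow> (real \<times> real) set \<Rightarrow> real" where
  "dinf L P Q = real_of_ereal (SUP d\<in>{d. admissible_dist L d}. ereal (d P Q))"

definition d_open :: "nat \<Rightarrow> (real \<times> real) set set \<Rightarrow> bool" where
  "d_open L U \<longleftrightarrow> U \<subseteq> Xinf L \<and> (\<forall>P\<in>U. \<exists>e>0. \<forall>Q\<in>Xinf L. dinf L P Q < e \<longrightarrow> Q \<in> U)"

definition borel_Xinf :: "nat \<Rightarrow> (real \<times> real) set measure" where
  "borel_Xinf L = sigma (Xinf L) {U. d_open L U}"

definition mu_inf :: "nat \<Rightarrow> (real \<times> real) set measure" where
  "mu_inf L = distr lborel (borel_Xinf L) (pi_inf L)"

definition x_inf :: "(real \<times> real) set \<Rightarrow> real" where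
  "x_inf P = fst (SOME z. z \<in> P)"

text \<open>partial derivative in x of f o pi (exists a.e. since f o pi is Lipschitz)\<close>
definition dx_lift :: "nat \<Rightarrow> ((real \<times> real) set \<Rightarrow> real) \<Rightarrow> real \<times> real \<Rightarrow> real" where
  "dx_lift L f z = deriv (\<lambda>t. f (pi_inf L (t, snd z))) (fst z)"

definition is_D_inf :: "nat \<Rightarrow> ((real \<times> real) set \<Rightarrow> real) \<Rightarrow> ((real \<times> real) set \<Rightarrow> real) \<Rightarrow> bool" where
  "is_D_inf L f a \<longleftrightarrow>
     (\<forall>g. integrable (mu_inf L) g \<longrightarrow>
        (\<integral>p. g p * a p \<partial>mu_inf L) = (\<integral>z. g (pi_inf L z) * dx_lift L f z \<partial>lborel))"

end

(*
  A function f on the quotient lifts to F on the plane, which is Lipschitz in x along horizontal lines,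
  so it has a bounded horizontal derivative h. Fix a point p where h is approximately constant, equal
  to a, on every cell adjacent (in the quotient) to the small cells around p, and put G = F - a x.
  On such a cell G hardly changes along most horizontal segments; the gluings join each thin horizontal
  strip of the cell to the next one, so G hardly changes on the whole cell. As a small ball around the
  image of p is covered by the adjacent cells, f - a x_inf = const + o(d) there. Almost every p has
  this property by a maximal inequality for adjacent cells, and horizontal lines are isometric, so that
  everything else follows from this differentiability by Fubini.
*)
theory Submission
  imports Defs
begin

text \<open>\<open>dinf\<close> is a supremum, so upper bounds follow from chains of cells, but a
  lower bound needs an admissible distance to be exhibited. The hard half of the covering claim is
  therefore a function on the plane that respects the gluings of all levels, separates cells without
  equivalent corners, and oscillates on a cell of level \<open>j\<close> by at most a constant times
  \<open>4 powi (- j)\<close>. It has to be flat on glued strips and make up for this elsewhere;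
  \<open>L \<ge> 100\<close> keeps the resulting jumps small against the horizontal scale.

  In the oscillation estimate the choices come in the order \<open>\<epsilon>\<close>,
  \<open>k\<close>, \<open>\<delta>\<close>: with strips of relative height \<open>1 / M ^ k\<close>
  the fine cells cost a multiple of \<open>1 / 4 ^ k\<close>, and the chain through
  \<open>M ^ k\<close> strips costs a multiple of \<open>\<delta> * M ^ k\<close>. Only the mean
  deviation of \<open>h\<close> from \<open>a\<close> over cells enters.

  All gluings lie on the 4-adic vertical lines, a null set. Off them the projection is injective and
  small quotient balls are small in the plane, which carries Borel sets and null sets to the
  quotient.\<close>

section \<open>Subintervals, small covers and null sets on horizontal lines\<close>

lemma unit_subinterval:
  assumes "of_int p \<le> (u::real)" "u \<le> of_int p + real m" "m \<ge> 1"
  shows "\<exists>j<m. of_int p + real j \<le> u \<and> u \<le> of_int p + real j + 1"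
proof (cases "u = of_int p + real m")
  case True
  \<comment> \<open>At the right end point the floor would give the index \<open>m\<close>; the
    point belongs to the last closed subinterval.\<close>
  thus ?thesis using assms(3) by (intro exI[of _ "m - 1"]) (auto simp: of_nat_diff)
next
  case False
  define j where "j = nat \<lfloor>u - of_int p\<rfloor>"
  have "0 \<le> \<lfloor>u - of_int p\<rfloor>" using assms(1) by (simp add: le_floor_iff)
  hence j: "real j = of_int \<lfloor>u - of_int p\<rfloor>" unfolding j_def by (rule of_nat_nat)
  have "real j \<le> u - of_int p" "u - of_int p < real j + 1" unfolding j by linarith+
  moreover have "real j < real m" using calculation(1) False assms(2) by linarith
  ultimately show ?thesis by (intro exI[of _ j]) auto
qed

text \<open>The exceptional set need not be measurable: it lies in a countable intersection of Borel
  sets of measure tending to 0.\<close>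

lemma AE_if_small_covers:
  assumes "\<And>e. e > 0 \<Longrightarrow> \<exists>T\<in>sets borel. emeasure lborel T \<le> ennreal e \<and> {z. \<not> P z} \<subseteq> T"
  shows "AE z in (lborel :: 'a::euclidean_space measure). P z"
proof -
  have "\<forall>k. \<exists>T\<in>sets borel. emeasure lborel T \<le> ennreal (1 / Suc k) \<and> {z. \<not> P z} \<subseteq> T"
    by (intro allI assms) simp
  then obtain T where T: "\<And>k. T k \<in> sets borel" "\<And>k. emeasure lborel (T k) \<le> ennreal (1 / Suc k)" "\<And>k. {z. \<not> P z} \<subseteq> T k"
    unfolding Bex_def by (metis (no_types, lifting))
  have small: "emeasure lborel (\<Inter>k. T k) \<le> ennreal (1 / Suc k)" for k
    by (rule order_trans[OF emeasure_mono T(2)]) (use T(1) in auto)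
  have "emeasure lborel (\<Inter>k. T k) \<le> 0"
  proof (rule ennreal_le_epsilon)
    fix e :: real assume "e > 0"
    then obtain k where "1 / real (Suc k) < e" by (rule nat_approx_posE)
    hence "ennreal (1 / Suc k) \<le> ennreal e" by (intro ennreal_leI) simp
    with small[of k] show "emeasure lborel (\<Inter>k. T k) \<le> 0 + ennreal e" by simp
  qed
  hence "(\<Inter>k. T k) \<in> null_sets lborel" using T(1) by (auto simp: null_sets_def)
  thus ?thesis by (rule AE_I') (use T(3) in auto)
qed

text \<open>Exchanging the variables requires a measurable set, and \<open>P\<close> may fail to
  define one. The exchange is therefore made for the complement of a null set \<open>N\<close>
  outside which \<open>P\<close> holds.\<close>

lemma AE_lborel_horizontal:
  assumes "AE z in (lborel :: (real \<times> real) measure). P z"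
  shows "AE y in lborel. AE x in lborel. P (x, y)"
proof -
  obtain N where N: "\<And>z. z \<in> space lborel - N \<Longrightarrow> P z" "N \<in> null_sets (lborel :: (real \<times> real) measure)"
    by (rule AE_E3[OF assms]) blast
  have "AE z in lborel \<Otimes>\<^sub>M lborel. z \<notin> N" unfolding lborel_prod by (rule AE_not_in[OF N(2)])
  hence "AE x in lborel. AE y in lborel. (x, y) \<notin> N" by (rule lborel_pair.AE_pair)
  moreover have "{z \<in> space (lborel \<Otimes>\<^sub>M lborel). (fst z, snd z) \<notin> N} \<in> sets (lborel \<Otimes>\<^sub>M lborel)"
  proof -
    have "{z \<in> space (lborel \<Otimes>\<^sub>M lborel). (fst z, snd z) \<notin> N} = - N" by (auto simp: space_pair_measure)
    moreover have "- N \<in> sets (lborel :: (real \<times> real) measure)" using N(2) by (auto simp: null_sets_def)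
    ultimately show ?thesis unfolding lborel_prod by simp
  qed
  ultimately have "AE y in lborel. AE x in lborel. (x, y) \<notin> N"
    using lborel_pair.AE_commute[of "\<lambda>x y. (x, y) \<notin> N"] by simp
  moreover have Pz: "P z" if "z \<notin> N" for z using N(1)[of z] that by simp
  have "AE x in lborel. P (x, y)" if "AE x in lborel. (x, y) \<notin> N" for y
    using that by (rule eventually_mono) (rule Pz)
  ultimately show ?thesis by (auto elim: eventually_mono)
qed

section \<open>Horizontal derivatives\<close>

text \<open>For a continuous \<open>F\<close> that is \<open>C\<close>-Lipschitz in \<open>x\<close>, the map \<open>(x, y) \<mapsto> (F (x, y) + 2 C x, y)\<close> is a
  homeomorphism of the plane. The area of images under it is a measure whose density, minus \<open>2 C\<close>, is
  \<open>\<partial>\<^sub>x F\<close>; since the measures for \<open>F\<close> and \<open>- F\<close> add up to \<open>4 C\<close> times the area, Radon-Nikodym applies and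
  the density is bounded.\<close>

locale sheared =
  fixes F :: "real \<times> real \<Rightarrow> real" and C :: real
  assumes cont: "continuous_on UNIV F" and C_pos: "C > 0"
    and lip: "\<bar>F (s, y) - F (t, y)\<bar> \<le> C * \<bar>s - t\<bar>"
begin

text \<open>The tilt \<open>2 * C\<close> exceeds the Lipschitz constant, so each row becomes
  strictly increasing, with slopes between \<open>C\<close> and \<open>3 * C\<close>.\<close>

definition shear :: "real \<Rightarrow> real \<Rightarrow> real" where
  "shear y x = F (x, y) + 2 * C * x"

lemma shear_less_iff: "shear y s < shear y t \<longleftrightarrow> s < t"
proof -
  have *: "shear y s < shear y t" if "s < t" for s t
  proof -
    have "F (s, y) - F (t, y) \<le> C * (t - s)" using lip[of s y t] that by simp
    moreover have "C * (t - s) < 2 * (C * (t - s))" using C_pos that by simp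
    moreover have "2 * (C * (t - s)) = 2 * C * t - 2 * C * s" by (simp add: algebra_simps)
    ultimately show ?thesis unfolding shear_def by linarith
  qed
  from *[of s t] *[of t s] show ?thesis by (metis less_irrefl linorder_less_linear order_less_trans)
qed

lemma shear_le_iff: "shear y s \<le> shear y t \<longleftrightarrow> s \<le> t"
  using shear_less_iff[of y t s] by (simp add: not_less[symmetric])

lemma shear_surj: "\<exists>x. shear y x = \<tau>"
proof -
  \<comment> \<open>The shear moves by at least \<open>C\<close> per unit, so the distance from
    \<open>F (0, y)\<close> to \<open>\<tau>\<close> divided by \<open>C\<close> is far enough on
    either side.\<close>
  define R where "R = \<bar>\<tau> - F (0, y)\<bar> / C"
  have R: "R \<ge> 0" "C * R = \<bar>\<tau> - F (0, y)\<bar>" using C_pos by (auto simp: R_def)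
  have up: "\<tau> \<le> shear y R"
    using lip[of R y 0] R unfolding shear_def by simp
  have low: "shear y (- R) \<le> \<tau>"
    using lip[of "-R" y 0] R unfolding shear_def by simp
  have "continuous_on {-R..R} (shear y)"
    unfolding shear_def
    by (intro continuous_intros continuous_on_compose2[OF cont]) auto
  thus ?thesis using IVT'[of "shear y" "-R" \<tau> R] up low R by auto
qed

definition unshear :: "real \<times> real \<Rightarrow> real" where
  "unshear w = (SOME x. shear (snd w) x = fst w)"

lemma shear_unshear: "shear y (unshear (\<tau>, y)) = \<tau>"
  unfolding unshear_def using someI_ex[OF shear_surj] by simp

lemma shear_measurable: "(\<lambda>y. shear y x) \<in> borel_measurable borel"
  unfolding shear_def
  by (intro borel_measurable_continuous_onI continuous_intros continuous_on_compose2[OF cont]) auto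

text \<open>Monotonicity of the rows turns a sublevel set of the inverse into a set described by the
  continuous function \<open>shear\<close> alone.\<close>

lemma unshear_measurable [measurable]: "unshear \<in> borel_measurable borel"
  unfolding borel_measurable_iff_le
proof
  fix c
  have "unshear w \<le> c \<longleftrightarrow> fst w \<le> shear (snd w) c" for w
    using shear_le_iff[of "snd w" "unshear w" c] shear_unshear[of "snd w" "fst w"] by simp
  hence "{w \<in> space borel. unshear w \<le> c} = {w. fst w \<le> shear (snd w) c}" by auto
  moreover have "closed {w. fst w \<le> shear (snd w) c}"
    unfolding shear_def
    by (intro closed_Collect_le continuous_intros continuous_on_compose2[OF cont]) auto
  ultimately show "{w \<in> space borel. unshear w \<le> c} \<in> sets borel" by simp
qed

text \<open>The area of the image, written as a pushforward under the inverse; countable additivity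
  is then automatic.\<close>

definition sheared_measure :: "(real \<times> real) measure" where
  "sheared_measure = distr lborel borel (\<lambda>w. (unshear w, snd w))"

lemma unshear_pair_measurable [measurable]: "(\<lambda>w. (unshear w, snd w)) \<in> borel \<rightarrow>\<^sub>M borel"
  by (intro borel_measurable_Pair unshear_measurable borel_measurable_continuous_onI continuous_intros)

lemma sets_sheared [simp]: "sets sheared_measure = sets borel"
  by (simp add: sheared_measure_def)

text \<open>By Fubini: the row at height \<open>y \<in> B\<close> is mapped to the interval from
  \<open>shear y s\<close> to \<open>shear y t\<close>, so the horizontal increments of
  \<open>F\<close> become lengths.\<close>

lemma emeasure_sheared:
  assumes B: "B \<in> sets borel" and st: "s \<le> t"
  shows "emeasure sheared_measure ({s<..<t} \<times> B) = (\<integral>\<^sup>+ y. ennreal (shear y t - shear y s) * indicator B y \<partial>lborel)"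
proof -
  have A: "{s<..<t} \<times> B \<in> sets borel" using B by (auto simp: borel_prod[symmetric])
  define P where "P = (\<lambda>w. (unshear w, snd w)) -` ({s<..<t} \<times> B)"
  have P: "P \<in> sets borel" unfolding P_def
    using measurable_sets[OF unshear_pair_measurable A] by simp
  have "emeasure sheared_measure ({s<..<t} \<times> B) = emeasure lborel P"
    unfolding sheared_measure_def P_def using A by (subst emeasure_distr) auto
  also have "\<dots> = (\<integral>\<^sup>+ y. emeasure lborel ((\<lambda>\<tau>. (\<tau>, y)) -` P) \<partial>lborel)"
  proof -
    have "P \<in> sets (lborel \<Otimes>\<^sub>M lborel)" unfolding lborel_prod using P by simp
    from lborel_pair.emeasure_pair_measure_alt2[OF this] show ?thesis unfolding lborel_prod .
  qed
  also have "\<dots> = (\<integral>\<^sup>+ y. ennreal (shear y t - shear y s) * indicator B y \<partial>lborel)"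
  proof (rule nn_integral_cong)
    fix y
    have "(\<lambda>\<tau>. (\<tau>, y)) -` P = (if y \<in> B then {shear y s<..<shear y t} else {})"
    proof -
      have "s < unshear (\<tau>, y) \<and> unshear (\<tau>, y) < t \<longleftrightarrow> shear y s < \<tau> \<and> \<tau> < shear y t" for \<tau>
        using shear_less_iff[of y s "unshear (\<tau>, y)"] shear_less_iff[of y "unshear (\<tau>, y)" t] shear_unshear[of y \<tau>] by simp
      hence "\<tau> \<in> (\<lambda>\<tau>. (\<tau>, y)) -` P \<longleftrightarrow> \<tau> \<in> (if y \<in> B then {shear y s<..<shear y t} else {})" for \<tau>
        by (simp add: P_def)
      thus ?thesis by blast
    qed
    moreover have "shear y s \<le> shear y t" using st by (simp add: shear_le_iff)
    ultimately show "emeasure lborel ((\<lambda>\<tau>. (\<tau>, y)) -` P) = ennreal (shear y t - shear y s) * indicator B y"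
      by simp
  qed
  finally show ?thesis .
qed

lemma shear_diff_nonneg: "s \<le> t \<Longrightarrow> 0 \<le> shear y t - shear y s"
  by (simp add: shear_le_iff)

end

text \<open>The increments of \<open>F\<close> and \<open>- F\<close> cancel and the two tilts add
  up to \<open>4 * C\<close>. This settles boxes, and a Borel measure with the right values on boxes
  is Lebesgue measure.\<close>

lemma lborel_eq_sheared_sum:
  assumes "sheared F C" "sheared F' C" and neg: "\<And>z. F' z = - F z" and A: "A \<in> sets borel"
  shows "emeasure (sheared.sheared_measure F C) A + emeasure (sheared.sheared_measure F' C) A = ennreal (4 * C) * emeasure lborel A"
proof -
  interpret p: sheared F C by fact
  interpret m: sheared F' C by fact
  have C: "C > 0" by (rule p.C_pos)
  note p.shear_measurable[measurable] m.shear_measurable[measurable]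
  define \<nu> where "\<nu> A = ennreal (1 / (4 * C)) * (emeasure p.sheared_measure A + emeasure m.sheared_measure A)" for A
  define N where "N = measure_of UNIV (sets (borel :: (real \<times> real) measure)) \<nu>"
  have s: "sets N = sets borel" unfolding N_def using sets.sigma_sets_eq[of borel] by (simp add: sets_measure_of)
  have N: "emeasure N A = \<nu> A" if "A \<in> sets borel" for A
  proof (rule emeasure_measure_of[OF N_def])
    show "countably_additive (sets N) \<nu>"
    proof (rule countably_additiveI)
      fix A :: "nat \<Rightarrow> (real \<times> real) set"
      assume A: "range A \<subseteq> sets N" "disjoint_family A" "(\<Union>i. A i) \<in> sets N"
      have "(\<Sum>i. \<nu> (A i)) = ennreal (1 / (4 * C)) * (\<Sum>i. emeasure p.sheared_measure (A i) + emeasure m.sheared_measure (A i))"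
        unfolding \<nu>_def by simp
      also have "(\<Sum>i. emeasure p.sheared_measure (A i) + emeasure m.sheared_measure (A i))
          = (\<Sum>i. emeasure p.sheared_measure (A i)) + (\<Sum>i. emeasure m.sheared_measure (A i))"
        by (intro suminf_add[symmetric]) auto
      also have "(\<Sum>i. emeasure p.sheared_measure (A i)) = emeasure p.sheared_measure (\<Union>i. A i)"
        using A s by (intro suminf_emeasure) auto
      also have "(\<Sum>i. emeasure m.sheared_measure (A i)) = emeasure m.sheared_measure (\<Union>i. A i)"
        using A s by (intro suminf_emeasure) auto
      finally show "(\<Sum>i. \<nu> (A i)) = \<nu> (\<Union>i. A i)" unfolding \<nu>_def .
    qed
    show "sets (borel :: (real \<times> real) measure) \<subseteq> Pow UNIV" by simp
    show "positive (sets N) \<nu>" by (simp add: positive_def \<nu>_def)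
    show "A \<in> sets N" using that s by simp
  qed
  have "lborel = N"
  proof (rule lborel_eqI)
    show "sets N = sets borel" by (fact s)
    fix l u :: "real \<times> real" assume le: "\<And>b. b \<in> Basis \<Longrightarrow> l \<bullet> b \<le> u \<bullet> b"
    have lu: "fst l \<le> fst u" "snd l \<le> snd u"
      using le[of "(1,0)"] le[of "(0,1)"] by (cases l; cases u; auto simp: Basis_prod_def)+
    have box: "box l u = {fst l<..<fst u} \<times> {snd l<..<snd u}"
      by (cases l; cases u) (auto simp: box_def Basis_prod_def)
    let ?B = "{snd l<..<snd u}"
    have "emeasure p.sheared_measure (box l u) + emeasure m.sheared_measure (box l u)
      = (\<integral>\<^sup>+ y. ennreal (p.shear y (fst u) - p.shear y (fst l)) * indicator ?B y \<partial>lborel)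
        + (\<integral>\<^sup>+ y. ennreal (m.shear y (fst u) - m.shear y (fst l)) * indicator ?B y \<partial>lborel)"
      unfolding box using p.emeasure_sheared[of ?B] m.emeasure_sheared[of ?B] lu by simp
    also have "\<dots> = (\<integral>\<^sup>+ y. ennreal (p.shear y (fst u) - p.shear y (fst l)) * indicator ?B y +
          ennreal (m.shear y (fst u) - m.shear y (fst l)) * indicator ?B y \<partial>lborel)"
      by (rule nn_integral_add[symmetric]) measurable
    also have "\<dots> = (\<integral>\<^sup>+ y. ennreal (4 * C * (fst u - fst l)) * indicator ?B y \<partial>lborel)"
    proof (rule nn_integral_cong)
      fix y
      have "ennreal (p.shear y (fst u) - p.shear y (fst l)) + ennreal (m.shear y (fst u) - m.shear y (fst l))
         = ennreal (p.shear y (fst u) - p.shear y (fst l) + (m.shear y (fst u) - m.shear y (fst l)))"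
        using p.shear_diff_nonneg[OF lu(1)] m.shear_diff_nonneg[OF lu(1)] by (simp add: ennreal_plus)
      also have "p.shear y (fst u) - p.shear y (fst l) + (m.shear y (fst u) - m.shear y (fst l)) = 4 * C * (fst u - fst l)"
        by (simp add: p.shear_def m.shear_def neg algebra_simps)
      finally show "ennreal (p.shear y (fst u) - p.shear y (fst l)) * indicator ?B y +
          ennreal (m.shear y (fst u) - m.shear y (fst l)) * indicator ?B y = ennreal (4 * C * (fst u - fst l)) * indicator ?B y"
        by (simp add: distrib_right[symmetric])
    qed
    also have "\<dots> = ennreal (4 * C * (fst u - fst l)) * ennreal (snd u - snd l)"
      using lu by (simp add: nn_integral_cmult_indicator)
    also have "\<dots> = ennreal (4 * C * (fst u - fst l) * (snd u - snd l))"
      using lu C by (simp add: ennreal_mult[symmetric])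
    finally have sum: "emeasure p.sheared_measure (box l u) + emeasure m.sheared_measure (box l u) = ennreal (4 * C * (fst u - fst l) * (snd u - snd l))" .
    have "emeasure N (box l u) = ennreal (1 / (4 * C)) * ennreal (4 * C * (fst u - fst l) * (snd u - snd l))"
      by (subst N) (simp_all add: \<nu>_def sum)
    also have "\<dots> = ennreal ((fst u - fst l) * (snd u - snd l))"
      using lu C by (simp add: ennreal_mult[symmetric])
    also have "(fst u - fst l) * (snd u - snd l) = (\<Prod>b\<in>Basis. (u - l) \<bullet> b)"
      by (cases l; cases u) (simp add: Basis_prod_def prod.union_disjoint)
    finally show "emeasure N (box l u) = (\<Prod>b\<in>Basis. (u - l) \<bullet> b)" .
  qed
  hence "emeasure lborel A = \<nu> A" using N[OF A] by simp
  hence "ennreal (4 * C) * emeasure lborel A = (ennreal (4 * C) * ennreal (1 / (4 * C))) * (emeasure p.sheared_measure A + emeasure m.sheared_measure A)"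
    by (simp add: \<nu>_def mult.assoc)
  also have "ennreal (4 * C) * ennreal (1 / (4 * C)) = 1" using C by (simp add: ennreal_mult[symmetric])
  finally show ?thesis by simp
qed

text \<open>An integrated form of \<open>\<partial>\<^sub>x F = h\<close>, with the slope
  \<open>a\<close> already subtracted so that it can be used directly for \<open>F - a x\<close>.
  The null set of heights depends on the end points, hence the countable set \<open>Q\<close> of
  admissible end points.\<close>

proposition horizontal_density:
  fixes F :: "real \<times> real \<Rightarrow> real"
  assumes F: "sheared F C" and Q: "countable Q"
  shows "\<exists>h\<in>borel_measurable borel. (\<forall>z. \<bar>h z\<bar> \<le> 2 * C) \<and>
    (AE y in lborel. \<forall>s\<in>Q. \<forall>t\<in>Q. s < t \<longrightarrow> (\<forall>a. ennreal \<bar>F (t, y) - F (s, y) - a * (t - s)\<bar>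
        \<le> (\<integral>\<^sup>+ u. ennreal \<bar>h (u, y) - a\<bar> * indicator {s<..<t} u \<partial>lborel)))"
proof -
  interpret p: sheared F C by fact
  have F': "sheared (\<lambda>z. - F z) C"
    using p.cont p.C_pos p.lip by unfold_locales (auto intro: continuous_intros simp: abs_minus_commute)
  interpret m: sheared "\<lambda>z. - F z" C by fact
  have C: "C > 0" by (rule p.C_pos)
  note p.shear_measurable[measurable] m.shear_measurable[measurable]
  note sum = lborel_eq_sheared_sum[OF F F' refl]
  have ac: "absolutely_continuous lborel p.sheared_measure" "absolutely_continuous lborel m.sheared_measure"
  proof -
    have "emeasure p.sheared_measure A = 0 \<and> emeasure m.sheared_measure A = 0"
      if "A \<in> sets borel" "emeasure lborel A = 0" for A
      using sum[OF that(1)] that(2) by (simp add: add_eq_0_iff_both_eq_0)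
    thus "absolutely_continuous lborel p.sheared_measure" "absolutely_continuous lborel m.sheared_measure"
      unfolding absolutely_continuous_def by (auto simp: null_sets_def)
  qed
  obtain D D' where D: "D \<in> borel_measurable lborel" "density lborel D = p.sheared_measure"
    and D': "D' \<in> borel_measurable lborel" "density lborel D' = m.sheared_measure"
    using sigma_finite_measure.Radon_Nikodym[OF sigma_finite_lborel ac(1)] sigma_finite_measure.Radon_Nikodym[OF sigma_finite_lborel ac(2)] by auto
  have [measurable]: "D \<in> borel_measurable borel" "D' \<in> borel_measurable borel" using D(1) D'(1) by simp_all
  have "density lborel (\<lambda>z. D z + D' z) = density lborel (\<lambda>_. ennreal (4 * C))"
  proof (rule measure_eqI)
    fix A assume "A \<in> sets (density lborel (\<lambda>z. D z + D' z))"
    hence A: "A \<in> sets borel" by simp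
    have "emeasure (density lborel (\<lambda>z. D z + D' z)) A = emeasure (density lborel D) A + emeasure (density lborel D') A"
      using A by (simp add: emeasure_density distrib_right nn_integral_add)
    thus "emeasure (density lborel (\<lambda>z. D z + D' z)) A = emeasure (density lborel (\<lambda>_. ennreal (4 * C))) A"
      using sum[OF A] D(2) D'(2) A by (simp add: emeasure_density nn_integral_cmult_indicator)
  qed simp
  hence "AE z in lborel. D z + D' z = ennreal (4 * C)"
    by (intro sigma_finite_measure.density_unique[OF sigma_finite_lborel]) auto
  hence D_le: "AE z in lborel. D z \<le> ennreal (4 * C)"
    by eventually_elim (metis le_iff_add)
  \<comment> \<open>The density is at most \<open>4 * C\<close> only almost everywhere; truncation
    makes the bound on \<open>h\<close> hold at every point.\<close>
  define h where "h z = enn2real (min (D z) (ennreal (4 * C))) - 2 * C" for z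
  have h_meas [measurable]: "h \<in> borel_measurable borel" unfolding h_def by measurable
  have enn: "ennreal (h z + 2 * C) = min (D z) (ennreal (4 * C))" for z
    by (simp add: h_def ennreal_enn2real min_less_iff_disj)
  have h_bd: "0 \<le> h z + 2 * C" "h z + 2 * C \<le> 4 * C" for z
    using C by (auto simp: h_def enn2real_leI)
  have h_abs: "\<bar>h z\<bar> \<le> 2 * C" for z using h_bd[of z] by linarith
  have D_ae: "AE y in lborel. AE u in lborel. D (u, y) = ennreal (h (u, y) + 2 * C)"
  proof -
    have "AE z in lborel. D z = ennreal (h z + 2 * C)"
      using D_le by eventually_elim (simp add: enn min_def)
    thus ?thesis by (rule AE_lborel_horizontal)
  qed
  have fixed: "AE y in lborel. \<forall>a. ennreal \<bar>F (t, y) - F (s, y) - a * (t - s)\<bar>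
        \<le> (\<integral>\<^sup>+ u. ennreal \<bar>h (u, y) - a\<bar> * indicator {s<..<t} u \<partial>lborel)" if st: "s < t" for s t
  proof -
    define I where "I y = (\<integral>\<^sup>+ u. D (u, y) * indicator {s<..<t} u \<partial>lborel)" for y
    have I_meas [measurable]: "I \<in> borel_measurable borel"
    proof -
      have "(\<lambda>(y, u). D (u, y) * indicator {s<..<t} u) \<in> borel_measurable (borel \<Otimes>\<^sub>M lborel)"
        by (simp add: borel_prod split_beta' cong: measurable_cong_sets) 
      from lborel.borel_measurable_nn_integral[OF this] show ?thesis by (simp add: I_def[abs_def])
    qed
    \<comment> \<open>Both sides are read as densities of measures in \<open>y\<close>; uniqueness
      of densities then gives equality for almost every height.\<close>
    have "density lborel I = density lborel (\<lambda>y. ennreal (p.shear y t - p.shear y s))"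
    proof (rule measure_eqI)
      fix B assume "B \<in> sets (density lborel I)"
      hence B: "B \<in> sets borel" by simp
      have A: "{s<..<t} \<times> B \<in> sets borel" using B by (auto simp: borel_prod[symmetric])
      have "(\<integral>\<^sup>+ y. ennreal (p.shear y t - p.shear y s) * indicator B y \<partial>lborel) = emeasure (density lborel D) ({s<..<t} \<times> B)"
        using p.emeasure_sheared[OF B, of s t] st D(2) by simp
      also have "\<dots> = (\<integral>\<^sup>+ z. D z * indicator ({s<..<t} \<times> B) z \<partial>(lborel \<Otimes>\<^sub>M lborel))"
        using A by (simp add: emeasure_density lborel_prod)
      also have "\<dots> = (\<integral>\<^sup>+ y. (\<integral>\<^sup>+ u. D (u, y) * indicator ({s<..<t} \<times> B) (u, y) \<partial>lborel) \<partial>lborel)"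
        using A by (subst lborel_pair.nn_integral_snd[symmetric]) (simp_all add: lborel_prod)
      also have "\<dots> = (\<integral>\<^sup>+ y. I y * indicator B y \<partial>lborel)"
        by (intro nn_integral_cong) (auto simp: I_def indicator_times split: split_indicator)
      finally show "emeasure (density lborel I) B = emeasure (density lborel (\<lambda>y. ennreal (p.shear y t - p.shear y s))) B"
        using B p.shear_measurable by (simp add: emeasure_density)
    qed simp
    hence "AE y in lborel. I y = ennreal (p.shear y t - p.shear y s)"
      using p.shear_measurable by (intro sigma_finite_measure.density_unique[OF sigma_finite_lborel]) auto
    with D_ae show ?thesis
    proof eventually_elim
      case (elim y)
      have hy [measurable]: "(\<lambda>u. h (u, y)) \<in> borel_measurable borel"
        by (rule measurable_compose[OF _ h_meas]) (simp add: borel_prod[symmetric])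
      have "I y = (\<integral>\<^sup>+ u. ennreal ((h (u, y) + 2 * C) * indicator {s<..<t} u) \<partial>lborel)"
        unfolding I_def using elim(1) by (intro nn_integral_cong_AE) (auto split: split_indicator)
      hence nn: "(\<integral>\<^sup>+ u. ennreal ((h (u, y) + 2 * C) * indicator {s<..<t} u) \<partial>lborel) = ennreal (p.shear y t - p.shear y s)"
        using elim(2) by simp
      have int: "integrable lborel (\<lambda>u. c * indicator {s<..<t} u :: real)" for c
        using st by (intro integrable_mult_right) (auto simp: integrable_indicator_iff)
      have hint: "integrable lborel (\<lambda>u. h (u, y) * indicator {s<..<t} u)"
      proof (rule Bochner_Integration.integrable_bound[OF int[of "2 * C"]])
        have "\<bar>h (u, y)\<bar> \<le> \<bar>2 * C\<bar>" for u using h_abs[of "(u, y)"] by linarith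
        thus "AE u in lborel. norm (h (u, y) * indicator {s<..<t} u) \<le> norm (2 * C * indicator {s<..<t} u :: real)"
          by (intro AE_I2) (simp split: split_indicator)
      qed measurable
      have "(\<integral>u. (h (u, y) + 2 * C) * indicator {s<..<t} u \<partial>lborel) = p.shear y t - p.shear y s"
        using nn h_bd st by (intro integral_eq_nn_integral[THEN trans]) (auto simp: p.shear_le_iff split: split_indicator)
      moreover have "(\<integral>u. (h (u, y) + 2 * C) * indicator {s<..<t} u \<partial>lborel) =
          (\<integral>u. h (u, y) * indicator {s<..<t} u \<partial>lborel) + 2 * C * (t - s)"
        using hint int[of "2 * C"] st by (simp add: distrib_right)
      ultimately have h1: "(\<integral>u. h (u, y) * indicator {s<..<t} u \<partial>lborel) = F (t, y) - F (s, y)"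
        by (simp add: p.shear_def algebra_simps)
      show ?case
      proof
        fix a
        have "F (t, y) - F (s, y) - a * (t - s) = (\<integral>u. (h (u, y) - a) * indicator {s<..<t} u \<partial>lborel)"
          using hint int[of a] st h1 by (simp add: left_diff_distrib)
        moreover have "integrable lborel (\<lambda>u. (h (u, y) - a) * indicator {s<..<t} u)"
          using hint int[of a] by (simp add: left_diff_distrib)
        ultimately have "ennreal \<bar>F (t, y) - F (s, y) - a * (t - s)\<bar> \<le> (\<integral>\<^sup>+ u. ennreal (norm ((h (u, y) - a) * indicator {s<..<t} u)) \<partial>lborel)"
          using integral_norm_bound_ennreal by fastforce
        also have "\<dots> = (\<integral>\<^sup>+ u. ennreal \<bar>h (u, y) - a\<bar> * indicator {s<..<t} u \<partial>lborel)"
          by (intro nn_integral_cong) (auto split: split_indicator)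
        finally show "ennreal \<bar>F (t, y) - F (s, y) - a * (t - s)\<bar> \<le> (\<integral>\<^sup>+ u. ennreal \<bar>h (u, y) - a\<bar> * indicator {s<..<t} u \<partial>lborel)" .
      qed
    qed
  qed
  have "AE y in lborel. \<forall>s\<in>Q. \<forall>t\<in>Q. s < t \<longrightarrow> (\<forall>a. ennreal \<bar>F (t, y) - F (s, y) - a * (t - s)\<bar>
        \<le> (\<integral>\<^sup>+ u. ennreal \<bar>h (u, y) - a\<bar> * indicator {s<..<t} u \<partial>lborel))"
    unfolding AE_ball_countable[OF Q] using fixed by (intro ballI AE_impI) 
  with h_meas h_abs show ?thesis by blast
qed

text \<open>Differentiability at a point is the Cauchy condition for the difference quotients. Each
  \<open>E m n\<close> is closed although \<open>r\<close> and \<open>s\<close> range over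
  uncountable sets, since it is an intersection of closed conditions in \<open>z\<close>; only
  \<open>m\<close> and \<open>n\<close> need to be countable.\<close>

proposition deriv_fst_measurable:
  fixes F :: "real \<times> real \<Rightarrow> real"
  assumes cont: "continuous_on UNIV F"
  shows "(\<lambda>z. deriv (\<lambda>t. F (t, snd z)) (fst z)) \<in> borel_measurable borel"
proof -
  define q where "q r z = (F (fst z + r, snd z) - F z) / r" for r z
  have q_cont: "continuous_on UNIV (q r)" for r
    unfolding q_def divide_inverse by (intro continuous_intros continuous_on_compose2[OF cont]) auto
  define E where "E m n = {z. \<forall>r s. r \<noteq> 0 \<longrightarrow> s \<noteq> 0 \<longrightarrow> \<bar>r\<bar> < 1 / real (Suc n) \<longrightarrow> \<bar>s\<bar> < 1 / real (Suc n) \<longrightarrow>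
      \<bar>q r z - q s z\<bar> \<le> 1 / real (Suc m)}" for m n
  have E_closed: "closed (E m n)" for m n
    unfolding E_def
    by (intro closed_Collect_all closed_Collect_imp open_Collect_const closed_Collect_le continuous_intros q_cont)
  define S where "S = (\<Inter>m. \<Union>n. E m n)"
  have S: "S \<in> sets borel" unfolding S_def using E_closed by (intro sets.countable_INT sets.countable_UN) auto
  have lim_D: "(\<lambda>k. q (1 / real (Suc k)) z) \<longlonglongrightarrow> D"
    if D: "((\<lambda>t. F (t, snd z)) has_real_derivative D) (at (fst z))" for z D
  proof -
    have "((\<lambda>r. q r z) \<longlongrightarrow> D) (at 0)"
      using D unfolding DERIV_def q_def by simp
    moreover have "filterlim (\<lambda>k. 1 / real (Suc k)) (at 0) sequentially"
      unfolding filterlim_at using LIMSEQ_inverse_real_of_nat by (auto simp: inverse_eq_divide)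
    ultimately show ?thesis by (rule filterlim_compose)
  qed
  have S_iff: "z \<in> S \<longleftrightarrow> (\<exists>D. ((\<lambda>t. F (t, snd z)) has_real_derivative D) (at (fst z)))" for z
  proof
    assume zS: "z \<in> S"
    have bound: "\<exists>n. \<forall>r s. r \<noteq> 0 \<longrightarrow> s \<noteq> 0 \<longrightarrow> \<bar>r\<bar> < 1 / real (Suc n) \<longrightarrow> \<bar>s\<bar> < 1 / real (Suc n) \<longrightarrow> \<bar>q r z - q s z\<bar> < e"
      if e: "e > 0" for e
    proof -
      obtain m where m: "1 / real (Suc m) < e" using nat_approx_posE[OF e] .
      obtain n where "z \<in> E m n" using zS unfolding S_def by blast
      thus ?thesis using m unfolding E_def by (intro exI[of _ n]) force
    qed
    have small: "1 / real (Suc k) < 1 / real (Suc n)" if "k > n" for k n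
      using that by (intro divide_strict_left_mono) auto
    have "Cauchy (\<lambda>k. q (1 / real (Suc k)) z)"
    proof (rule metric_CauchyI)
      fix e :: real assume "e > 0"
      then obtain n where n: "\<And>r s. r \<noteq> 0 \<Longrightarrow> s \<noteq> 0 \<Longrightarrow> \<bar>r\<bar> < 1 / real (Suc n) \<Longrightarrow> \<bar>s\<bar> < 1 / real (Suc n) \<Longrightarrow> \<bar>q r z - q s z\<bar> < e"
        using bound by blast
      show "\<exists>M. \<forall>k\<ge>M. \<forall>l\<ge>M. dist (q (1 / real (Suc k)) z) (q (1 / real (Suc l)) z) < e"
      proof (intro exI[of _ "Suc n"] allI impI)
        fix k l assume "Suc n \<le> k" "Suc n \<le> l"
        thus "dist (q (1 / real (Suc k)) z) (q (1 / real (Suc l)) z) < e"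
          unfolding dist_real_def using small[of n k] small[of n l] by (intro n) auto
      qed
    qed
    then obtain D where D: "(\<lambda>k. q (1 / real (Suc k)) z) \<longlonglongrightarrow> D" using Cauchy_convergent_iff convergent_def by blast
    have "((\<lambda>r. q r z) \<longlongrightarrow> D) (at 0)"
      unfolding tendsto_iff
    proof (intro allI impI)
      fix e :: real assume "e > 0"
      then obtain n where n: "\<And>r s. r \<noteq> 0 \<Longrightarrow> s \<noteq> 0 \<Longrightarrow> \<bar>r\<bar> < 1 / real (Suc n) \<Longrightarrow> \<bar>s\<bar> < 1 / real (Suc n) \<Longrightarrow> \<bar>q r z - q s z\<bar> < e / 2"
        using bound[of "e / 2"] by auto
      obtain N where N: "\<And>k. k \<ge> N \<Longrightarrow> \<bar>q (1 / real (Suc k)) z - D\<bar> < e / 2"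
        using D \<open>e > 0\<close> unfolding LIMSEQ_def dist_real_def by (meson half_gt_zero)
      define k where "k = max N (Suc n)"
      have k: "\<bar>q (1 / real (Suc k)) z - D\<bar> < e / 2" "1 / real (Suc k) < 1 / real (Suc n)"
        using N small[of n k] by (auto simp: k_def)
      have "dist (q r z) D < e" if r: "r \<noteq> 0" "\<bar>r\<bar> < 1 / real (Suc n)" for r
      proof -
        have "\<bar>q r z - q (1 / real (Suc k)) z\<bar> < e / 2" using r k(2) by (intro n) auto
        thus ?thesis using k(1) unfolding dist_real_def by linarith
      qed
      thus "eventually (\<lambda>r. dist (q r z) D < e) (at 0)"
        unfolding eventually_at by (intro exI[of _ "1 / real (Suc n)"]) auto
    qed
    hence "((\<lambda>t. F (t, snd z)) has_real_derivative D) (at (fst z))" unfolding DERIV_def q_def by simp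
    thus "\<exists>D. ((\<lambda>t. F (t, snd z)) has_real_derivative D) (at (fst z))" by blast
  next
    assume "\<exists>D. ((\<lambda>t. F (t, snd z)) has_real_derivative D) (at (fst z))"
    then obtain D where D: "((\<lambda>r. q r z) \<longlongrightarrow> D) (at 0)"
      unfolding DERIV_def q_def by auto
    show "z \<in> S"
      unfolding S_def
    proof
      fix m
      have "eventually (\<lambda>r. dist (q r z) D < 1 / real (Suc m) / 2) (at 0)"
        using D unfolding tendsto_iff by simp
      then obtain d where d: "d > 0" "\<And>r. r \<noteq> 0 \<Longrightarrow> \<bar>r\<bar> < d \<Longrightarrow> \<bar>q r z - D\<bar> < 1 / real (Suc m) / 2"
        unfolding eventually_at dist_real_def by auto
      obtain n where n: "1 / real (Suc n) < d" using nat_approx_posE[OF d(1)] .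
      have "z \<in> E m n" unfolding E_def mem_Collect_eq
      proof (intro allI impI)
        fix r s :: real assume rs: "r \<noteq> 0" "s \<noteq> 0" "\<bar>r\<bar> < 1 / real (Suc n)" "\<bar>s\<bar> < 1 / real (Suc n)"
        have "\<bar>x - y\<bar> \<le> e" if "\<bar>x - D\<bar> < e / 2" "\<bar>y - D\<bar> < e / 2" for x y e :: real
          using that by linarith
        moreover have "\<bar>q r z - D\<bar> < 1 / real (Suc m) / 2" "\<bar>q s z - D\<bar> < 1 / real (Suc m) / 2"
          using rs n by (intro d(2); linarith)+
        ultimately show "\<bar>q r z - q s z\<bar> \<le> 1 / real (Suc m)" .
      qed
      thus "z \<in> (\<Union>n. E m n)" by blast
    qed
  qed
  \<comment> \<open>Where there is no derivative, \<open>deriv\<close> chooses from the empty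
    predicate, hence takes the same value at all such points.\<close>
  have "deriv (\<lambda>t. F (t, snd z)) (fst z) = (if z \<in> S then lim (\<lambda>k. q (1 / real (Suc k)) z) else (SOME D. False))" for z
  proof (cases "z \<in> S")
    case True
    then obtain D where D: "((\<lambda>t. F (t, snd z)) has_real_derivative D) (at (fst z))" using S_iff by blast
    show ?thesis using DERIV_imp_deriv[OF D] limI[OF lim_D[OF D]] True by simp
  next
    case False
    hence "(\<lambda>D. ((\<lambda>t. F (t, snd z)) has_real_derivative D) (at (fst z))) = (\<lambda>_. False)" using S_iff by auto
    thus ?thesis using False unfolding deriv_def by simp
  qed
  moreover have "(\<lambda>z. if z \<in> S then lim (\<lambda>k. q (1 / real (Suc k)) z) else (SOME D. False)) \<in> borel_measurable borel"
    using S q_cont by (intro measurable_If_set borel_measurable_lim_metric borel_measurable_continuous_onI) auto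
  ultimately show ?thesis by (simp cong: measurable_cong)
qed

section \<open>The gluing relation\<close>

locale slit_plane =
  fixes L :: nat
  assumes L_ge: "L \<ge> 100"
begin

abbreviation M :: real where "M \<equiv> mv L"

definition Mi :: int where "Mi = 3 * int L"

lemma M_eq: "M = real_of_int Mi"
  by (simp add: mv_def Mi_def)

lemma M_ge: "M \<ge> 300"
  using L_ge by (simp add: mv_def)

lemma M_pos [simp]: "M > 0" "M \<noteq> 0"
  using M_ge by linarith+

text \<open>All gluings of level \<open>n\<close>, that is those of \<open>\<Phi>\<close> to the power \<open>n - 1\<close>: on the line \<open>x = N 4 powi (- n)\<close> with \<open>4\<close> not dividing \<open>N\<close>, the closed strip
  number \<open>t \<equiv> N mod 4 - 1\<close> (modulo 3) of height \<open>M powi (- n)\<close> is glued to the strip above it. The line determines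
  \<open>n\<close>, so different levels never interact.\<close>

definition glue :: "real \<times> real \<Rightarrow> real \<times> real \<Rightarrow> bool" where
  "glue p q \<longleftrightarrow> (\<exists>n N t. N mod 4 \<noteq> 0 \<and> t mod 3 = N mod 4 - 1 \<and>
     fst p = of_int N * 4 powi (- n) \<and> fst q = fst p \<and>
     of_int t * M powi (- n) \<le> snd p \<and> snd p \<le> of_int (t + 1) * M powi (- n) \<and>
     snd q = snd p + M powi (- n))"

lemma powi_shift: "x \<noteq> 0 \<Longrightarrow> (x::real) powi (- n) = x * x powi (- (n + 1))"
  using power_int_add_1[of x "-(n+1)"] by (simp add: mult.commute)

lemma glue_Phi_pow:
  assumes "(p, q) \<in> gen_rel L"
  shows "glue (Phi_pow L j p) (Phi_pow L j q)"
proof -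
  from assms obtain k l i y where i: "i \<in> {1,2,3}" and p: "p = (real_of_int k + real i / 4, y)"
    and y: "(3 * real_of_int l + real i - 1) / M \<le> y" "y \<le> (3 * real_of_int l + real i) / M"
    and q: "q = (fst p, snd p + 1 / M)"
    by (auto simp: gen_rel_def aseg_def)
  have e: "M powi (- j) = M * M powi (- (j + 1))" "(4::real) powi (- j) = 4 * 4 powi (- (j + 1))"
    using powi_shift[of M j] powi_shift[of 4 j] by simp_all
  define u where "u = M powi (- (j + 1))"
  have u: "u > 0" by (simp add: u_def)
  have *: "(3 * real_of_int l + real i - 1) \<le> M * y" "M * y \<le> (3 * real_of_int l + real i)"
    using y by (simp_all add: field_simps)
  have "(3 * real_of_int l + real i - 1) * u \<le> M * y * u" "M * y * u \<le> (3 * real_of_int l + real i) * u"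
    using * u by (auto intro: mult_right_mono)
  moreover have "(4 * k + int i) mod 4 = int i" "(3 * l + int i - 1) mod 3 = int i - 1" using i by auto
  ultimately show ?thesis
    unfolding glue_def Phi_pow_def q p e
    using i
    by (intro exI[of _ "j+1"] exI[of _ "4 * k + int i"] exI[of _ "3 * l + int i - 1"])
       (auto simp: algebra_simps u_def)
qed

lemma glue_in_Rinf:
  assumes "glue p q" shows "(p, q) \<in> Rinf L"
proof -
  obtain n N t where N: "N mod 4 \<noteq> 0" "t mod 3 = N mod 4 - 1"
     "fst p = of_int N * 4 powi (- n)" "fst q = fst p"
     "of_int t * M powi (- n) \<le> snd p" "snd p \<le> of_int (t + 1) * M powi (- n)"
     "snd q = snd p + M powi (- n)" using assms unfolding glue_def by blast
  define j where "j = n - 1"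
  have e: "M powi (- j) = M * M powi (- n)" "(4::real) powi (- j) = 4 * 4 powi (- n)"
    unfolding j_def using powi_shift[of M "n - 1"] powi_shift[of 4 "n - 1"] by simp_all
  define u where "u = M powi (- n)"
  have u: "u > 0" by (simp add: u_def)
  define i where "i = nat (N mod 4)"
  have i: "i \<in> {1,2,3}" "int i = N mod 4" using N(1) by (auto simp: i_def)
  define k where "k = N div 4"
  define l where "l = t div 3"
  have Nk: "N = 4 * k + int i" unfolding k_def i by simp
  have tl: "t = 3 * l + int i - 1" unfolding l_def i using N(2) by presburger
  define p0 where "p0 = (real_of_int k + real i / 4, snd p / (M * u))"
  have p0y: "snd p0 * (M * u) = snd p" using u by (simp add: p0_def)
  have "(3 * real_of_int l + real i - 1) * u \<le> (snd p0 * M) * u"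
    "(snd p0 * M) * u \<le> (3 * real_of_int l + real i) * u"
    using N(5,6) p0y unfolding u_def[symmetric] tl by (auto simp: algebra_simps)
  hence "3 * real_of_int l + real i - 1 \<le> snd p0 * M" "snd p0 * M \<le> 3 * real_of_int l + real i"
    using u by (simp_all only: mult_le_cancel_right_pos)
  hence "p0 \<in> aseg L k l i"
    unfolding aseg_def mem_Collect_eq
    by (intro exI[of _ "snd p0"] conjI) (simp_all add: p0_def pos_divide_le_eq pos_le_divide_eq)
  hence "(p0, (fst p0, snd p0 + 1 / M)) \<in> gen_rel L"
    unfolding gen_rel_def using i by blast
  hence "(p0, (fst p0, snd p0 + 1 / M)) \<in> R0 L"
    unfolding R0_def eq_closure_def by (intro r_into_rtrancl UnI1)
  hence "(Phi_pow L j p0, Phi_pow L j (fst p0, snd p0 + 1/M)) \<in>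
      (\<Union>j::int. (\<lambda>(p, q). (Phi_pow L j p, Phi_pow L j q)) ` R0 L)"
    by (intro UN_I[of j] image_eqI[where x = "(p0, (fst p0, snd p0 + 1 / M))"]) auto
  hence "(Phi_pow L j p0, Phi_pow L j (fst p0, snd p0 + 1/M)) \<in> Rinf L"
    unfolding Rinf_def eq_closure_def by (intro r_into_rtrancl UnI1)
  moreover have "Phi_pow L j p0 = p"
    unfolding Phi_pow_def e u_def[symmetric] using p0y N(3) Nk
    by (intro prod_eqI) (auto simp: p0_def algebra_simps)
  moreover have "Phi_pow L j (fst p0, snd p0 + 1/M) = q"
    unfolding Phi_pow_def e u_def[symmetric] using p0y N(3,4,7) Nk
    by (intro prod_eqI) (auto simp: p0_def algebra_simps u_def)
  ultimately show ?thesis by simp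
qed

lemma equiv_Rinf: "equiv UNIV (Rinf L)"
  unfolding Rinf_def eq_closure_def equiv_def
  by (auto simp: refl_on_def intro!: sym_rtrancl sym_Un_converse trans_rtrancl)

lemma Rinf_refl [simp]: "(p, p) \<in> Rinf L"
  using equiv_Rinf by (meson UNIV_I equiv_def refl_onD)

lemma Rinf_sym: "(p, q) \<in> Rinf L \<Longrightarrow> (q, p) \<in> Rinf L"
  using equiv_Rinf by (meson equiv_def symE)

lemma Rinf_trans: "(p, q) \<in> Rinf L \<Longrightarrow> (q, r) \<in> Rinf L \<Longrightarrow> (p, r) \<in> Rinf L"
  using equiv_Rinf by (meson equiv_def transE)

lemma eq_closure_least:
  assumes "(p, q) \<in> eq_closure S" and refl: "\<And>p. E p p" and sym: "\<And>p q. E p q \<Longrightarrow> E q p"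
    and trans: "\<And>p q r. E p q \<Longrightarrow> E q r \<Longrightarrow> E p r" and S: "\<And>p q. (p, q) \<in> S \<Longrightarrow> E p q"
  shows "E p q"
  using assms(1) unfolding eq_closure_def
  by (induction rule: rtrancl_induct) (use refl sym trans S in blast)+

text \<open>The pullback of \<open>E\<close> along \<open>Phi_pow L j\<close> is again an
  equivalence, so the inner closure is absorbed before the outer one. Afterwards only single gluings
  have to be checked, for all levels at once.\<close>

lemma Rinf_least:
  assumes "(p, q) \<in> Rinf L" and refl: "\<And>p. E p p" and sym: "\<And>p q. E p q \<Longrightarrow> E q p"
    and trans: "\<And>p q r. E p q \<Longrightarrow> E q r \<Longrightarrow> E p r" and S: "\<And>p q. glue p q \<Longrightarrow> E p q"
  shows "E p q"
proof -
  have *: "E (Phi_pow L j p) (Phi_pow L j q)" if "(p, q) \<in> R0 L" for p q j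
    using that unfolding R0_def
    by (rule eq_closure_least[where E = "\<lambda>p q. E (Phi_pow L j p) (Phi_pow L j q)"])
       (fact refl, erule sym, erule (1) trans, rule S, erule glue_Phi_pow)
  show ?thesis
    using assms(1) unfolding Rinf_def
    by (rule eq_closure_least[where E = E])
       (fact refl, erule sym, erule (1) trans, use * in auto)
qed

text \<open>If the levels differed, the numerator at the finer level would be divisible by
  4.\<close>

lemma level_unique:
  assumes "of_int N * (4::real) powi (- n) = of_int N' * 4 powi (- n')"
    and "N mod 4 \<noteq> 0" "N' mod 4 \<noteq> 0"
  shows "n = n' \<and> N = N'"
proof -
  have aux: "\<not> n < n'" if e: "of_int N * (4::real) powi (- n) = of_int N' * 4 powi (- n')"
      and N': "N' mod 4 \<noteq> 0" for N N' n n'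
  proof
    assume "n < n'"
    define k where "k = nat (n' - n)"
    have k: "n' = n + int k" "k > 0" using \<open>n < n'\<close> by (auto simp: k_def)
    have "(4::real) powi (- n) = 4 ^ k * 4 powi (- n')"
      unfolding k by (simp add: power_int_diff power_int_minus power_int_add divide_simps)
    with e have "of_int N * (4::real) ^ k = of_int N'" by simp
    hence "N * 4 ^ k = N'" by (metis of_int_eq_iff of_int_mult of_int_numeral of_int_power)
    thus False using N' k(2) by (cases k) auto
  qed
  from aux[OF assms(1,3)] aux[OF assms(1)[symmetric] assms(2)] have "n = n'" by simp
  with assms(1) show ?thesis by simp
qed

text \<open>A nontrivial class lies in two consecutive strips \<open>[t, t + 2]\<close>. It has three points when they are on the
  edges of the strips and two otherwise.\<close>

definition window :: "real \<times> real \<Rightarrow> real \<times> real \<Rightarrow> int \<Rightarrow> int \<Rightarrow> int \<Rightarrow> bool" where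
  "window p q n N t \<longleftrightarrow> N mod 4 \<noteq> 0 \<and> t mod 3 = N mod 4 - 1 \<and>
     fst p = of_int N * 4 powi (- n) \<and> fst q = fst p \<and>
     of_int t * M powi (- n) \<le> snd p \<and> snd p \<le> of_int (t + 2) * M powi (- n) \<and>
     of_int t * M powi (- n) \<le> snd q \<and> snd q \<le> of_int (t + 2) * M powi (- n) \<and>
     (\<exists>c::int. snd q = snd p + of_int c * M powi (- n))"

lemma Rinf_window:
  assumes "(p, q) \<in> Rinf L"
  shows "p = q \<or> (\<exists>n N t. window p q n N t)"
  using assms
proof (rule Rinf_least)
  fix p q assume "p = q \<or> (\<exists>n N t. window p q n N t)"
  thus "q = p \<or> (\<exists>n N t. window q p n N t)"
  proof
    assume "\<exists>n N t. window p q n N t"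
    then obtain n N t where "window p q n N t" by blast
    then obtain c :: int where "window p q n N t" "snd q = snd p + of_int c * M powi (- n)"
      by (auto simp: window_def)
    hence "window q p n N t" unfolding window_def by (auto intro!: exI[of _ "-c"])
    thus ?thesis by blast
  qed auto
next
  fix p q r assume *: "p = q \<or> (\<exists>n N t. window p q n N t)" "q = r \<or> (\<exists>n N t. window q r n N t)"
  show "p = r \<or> (\<exists>n N t. window p r n N t)"
  proof (cases "p = q \<or> q = r")
    case False
    with * obtain n N t n' N' t' where w: "window p q n N t" "window q r n' N' t'" by blast
    have eq: "n = n'" "N = N'" using w level_unique[of N n N' n'] by (auto simp: window_def)
    \<comment> \<open>Both windows contain \<open>q\<close>, so their starts differ by at most 2,
      while they agree modulo 3. This is why gluings on one line never chain beyond two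
      strips.\<close>
    have tt: "t = t'"
    proof -
      have "M powi (- n) > 0" by simp
      have "real_of_int t * M powi (- n) \<le> snd q" "snd q \<le> real_of_int (t'+2) * M powi (- n)"
        "real_of_int t' * M powi (- n) \<le> snd q" "snd q \<le> real_of_int (t+2) * M powi (- n)"
        using w eq by (simp_all add: window_def)
      note this(1)[THEN order_trans, OF this(2)] this(3)[THEN order_trans, OF this(4)]
      hence "real_of_int t \<le> real_of_int (t'+2)" "real_of_int t' \<le> real_of_int (t+2)"
        using \<open>M powi (- n) > 0\<close> by (simp_all only: mult_le_cancel_right_pos)
      hence "t \<le> t' + 2" "t' \<le> t + 2" by linarith+
      moreover have "t mod 3 = t' mod 3" using w eq by (simp add: window_def)
      ultimately show ?thesis by presburger
    qed
    obtain c c' :: int where "snd q = snd p + of_int c * M powi (- n)" "snd r = snd q + of_int c' * M powi (- n)"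
      using w eq unfolding window_def by blast
    hence "snd r = snd p + of_int (c + c') * M powi (- n)" by (simp add: algebra_simps)
    hence c: "\<exists>c::int. snd r = snd p + of_int c * M powi (- n)" by blast
    have "window q r n N t" using w(2) eq tt by simp
    hence "fst r = fst q" "of_int t * M powi (- n) \<le> snd r" "snd r \<le> of_int (t + 2) * M powi (- n)"
      by (simp_all only: window_def)
    with w(1) c have "window p r n N t" unfolding window_def by metis
    thus ?thesis by blast
  qed (use * in auto)
next
  fix p q assume "glue p q"
  then obtain n N t where "N mod 4 \<noteq> 0" "t mod 3 = N mod 4 - 1"
     "fst p = of_int N * 4 powi (- n)" "fst q = fst p"
     "of_int t * M powi (- n) \<le> snd p" "snd p \<le> of_int (t + 1) * M powi (- n)"
     "snd q = snd p + M powi (- n)" unfolding glue_def by blast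
  moreover have "M powi (- n) > 0" by simp
  ultimately have "window p q n N t" unfolding window_def
    by (auto simp: algebra_simps intro!: exI[of _ 1])
  thus "p = q \<or> (\<exists>n N t. window p q n N t)" by blast
qed simp

lemma Rinf_fst: "(p, q) \<in> Rinf L \<Longrightarrow> fst p = fst q"
  using Rinf_window[of p q] by (auto simp: window_def)

lemma pi_inf_eq_iff: "pi_inf L p = pi_inf L q \<longleftrightarrow> (p, q) \<in> Rinf L"
  unfolding pi_inf_def using equiv_Rinf by (metis UNIV_I eq_equiv_class_iff)

lemma pi_inf_in [simp]: "pi_inf L p \<in> Xinf L"
  by (auto simp: pi_inf_def Xinf_def intro: quotientI)

lemma Xinf_cases: assumes "P \<in> Xinf L" obtains p where "P = pi_inf L p"
  using assms by (auto simp: pi_inf_def Xinf_def quotient_def)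

lemma Some_pi_inf: "(p, SOME z. z \<in> pi_inf L p) \<in> Rinf L"
proof -
  have "p \<in> pi_inf L p" by (simp add: pi_inf_def)
  hence "(SOME z. z \<in> pi_inf L p) \<in> pi_inf L p" by (rule someI)
  thus ?thesis by (simp add: pi_inf_def)
qed

lemma x_inf_pi [simp]: "x_inf (pi_inf L p) = fst p"
  using Rinf_fst[OF Some_pi_inf] by (simp add: x_inf_def)

section \<open>The distance\<close>

lemma admissible_zero: "admissible_dist L (\<lambda>_ _. 0)"
  by (auto simp: admissible_dist_def pseudodist_on_def)

text \<open>The four cells at the origin exhaust the plane as the level tends to minus infinity, so
  every point shares some cell with the origin. Going through the origin bounds all admissible
  distances at once.\<close>

lemma admissible_bound: "\<exists>B. \<forall>d. admissible_dist L d \<longrightarrow> d (pi_inf L p) (pi_inf L q) \<le> B"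
proof -
  have "\<exists>n::nat. \<exists>a b. p \<in> cell L (- int n) a b \<and> (0,0) \<in> cell L (- int n) a b" for p
  proof -
    obtain n where n: "\<bar>fst p\<bar> + \<bar>snd p\<bar> < 4 ^ n" using real_arch_pow[of 4 "\<bar>fst p\<bar> + \<bar>snd p\<bar>"] by auto
    have "(4::real) ^ n \<le> M ^ n" using M_ge by (intro power_mono) auto
    with n have b: "\<bar>fst p\<bar> \<le> 4 ^ n" "\<bar>snd p\<bar> \<le> M ^ n" by linarith+
    have "p \<in> cell L (- int n) (if fst p \<ge> 0 then 0 else -1) (if snd p \<ge> 0 then 0 else -1)
       \<and> (0,0) \<in> cell L (- int n) (if fst p \<ge> 0 then 0 else -1) (if snd p \<ge> 0 then 0 else -1)"
      using b by (cases p) (auto simp: cell_def)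
    thus ?thesis by blast
  qed
  then obtain n :: "real \<times> real \<Rightarrow> nat" and a b where
     n: "\<And>p. p \<in> cell L (- int (n p)) (a p) (b p)" "\<And>p. (0,0) \<in> cell L (- int (n p)) (a p) (b p)"
    by metis
  show ?thesis
  proof (intro exI allI impI)
    fix d assume d: "admissible_dist L d"
    have 1: "d (pi_inf L p) (pi_inf L (0,0)) \<le> 4 powi (int (n p))" 
      "d (pi_inf L q) (pi_inf L (0,0)) \<le> 4 powi (int (n q))" 
      using d n[of p] n[of q] unfolding admissible_dist_def by fastforce+
    have "d (pi_inf L p) (pi_inf L q) \<le> d (pi_inf L p) (pi_inf L (0,0)) + d (pi_inf L (0,0)) (pi_inf L q)"
      "d (pi_inf L (0,0)) (pi_inf L q) = d (pi_inf L q) (pi_inf L (0,0))"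
      using d unfolding admissible_dist_def pseudodist_on_def by (meson pi_inf_in)+
    with 1 show "d (pi_inf L p) (pi_inf L q) \<le> 4 powi (int (n p)) + 4 powi (int (n q))" by linarith
  qed
qed

abbreviation dpi :: "real \<times> real \<Rightarrow> real \<times> real \<Rightarrow> real" where
  "dpi p q \<equiv> dinf L (pi_inf L p) (pi_inf L q)"

text \<open>\<open>real_of_ereal\<close> sends infinite values to 0, so finiteness has to be known
  before \<open>dinf\<close> can be treated as a supremum.\<close>

lemma dinf_ereal:
  "ereal (dpi p q) = (SUP d\<in>{d. admissible_dist L d}. ereal (d (pi_inf L p) (pi_inf L q)))"
proof -
  let ?S = "SUP d\<in>{d. admissible_dist L d}. ereal (d (pi_inf L p) (pi_inf L q))"
  have "0 \<le> ?S" using admissible_zero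
    by (intro SUP_upper2[where i="\<lambda>_ _. 0"]) (auto simp: zero_ereal_def)
  moreover obtain B where "\<forall>d. admissible_dist L d \<longrightarrow> d (pi_inf L p) (pi_inf L q) \<le> B"
    using admissible_bound by blast
  hence "?S \<le> ereal B" by (intro SUP_least) auto
  ultimately have "\<bar>?S\<bar> \<noteq> \<infinity>" by (cases ?S) auto
  thus ?thesis unfolding dinf_def by (simp add: ereal_real')
qed

lemma dinf_ge: "admissible_dist L d \<Longrightarrow> d (pi_inf L p) (pi_inf L q) \<le> dpi p q"
  by (subst ereal_less_eq(3)[symmetric], subst dinf_ereal) (auto intro: SUP_upper)

lemma dinf_le:
  assumes "\<And>d. admissible_dist L d \<Longrightarrow> d (pi_inf L p) (pi_inf L q) \<le> c"
  shows "dpi p q \<le> c"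
  by (subst ereal_less_eq(3)[symmetric], subst dinf_ereal) (auto intro!: SUP_least assms)

text \<open>The defining conditions survive a pointwise supremum, so the cell bound and the triangle
  inequality may be applied to \<open>dinf\<close> itself.\<close>

lemma admissible_dinf: "admissible_dist L (dinf L)"
  unfolding admissible_dist_def
proof
  show "pseudodist_on (Xinf L) (dinf L)"
    unfolding pseudodist_on_def
  proof (intro ballI)
    fix P Q R assume "P \<in> Xinf L" "Q \<in> Xinf L" "R \<in> Xinf L"
    then obtain p q r where P: "P = pi_inf L p" "Q = pi_inf L q" "R = pi_inf L r"
      by (metis Xinf_cases)
    have pd: "pseudodist_on (Xinf L) d" if "admissible_dist L d" for d
      using that by (simp add: admissible_dist_def)
    have nn: "0 \<le> dinf L P Q" using dinf_ge[OF admissible_zero] by (simp add: P)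
    have "dinf L P P \<le> 0" unfolding P
    proof (rule dinf_le)
      fix d assume "admissible_dist L d"
      with pd have "pseudodist_on (Xinf L) d" .
      hence "d (pi_inf L p) (pi_inf L p) = 0" unfolding pseudodist_on_def by (meson pi_inf_in)
      thus "d (pi_inf L p) (pi_inf L p) \<le> 0" by simp
    qed
    moreover have "0 \<le> dinf L P P" using dinf_ge[OF admissible_zero] by (simp add: P)
    ultimately have z: "dinf L P P = 0" by simp
    have sy: "d P Q = d Q P" if "admissible_dist L d" for d
      using pd[OF that] unfolding pseudodist_on_def P by (meson pi_inf_in)
    have s: "dinf L P Q = dinf L Q P" unfolding dinf_def using sy by (auto intro!: arg_cong[of _ _ real_of_ereal] SUP_cong)
    have t: "dinf L P R \<le> dinf L P Q + dinf L Q R" unfolding P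
    proof (rule dinf_le)
      fix d assume d: "admissible_dist L d"
      have "d (pi_inf L p) (pi_inf L r) \<le> d (pi_inf L p) (pi_inf L q) + d (pi_inf L q) (pi_inf L r)"
        using pd[OF d] unfolding pseudodist_on_def by (meson pi_inf_in)
      with dinf_ge[OF d, of p q] dinf_ge[OF d, of q r]
      show "d (pi_inf L p) (pi_inf L r) \<le> dpi p q + dpi q r"
        by linarith
    qed
    show "0 \<le> dinf L P Q \<and> dinf L P P = 0 \<and> dinf L P Q = dinf L Q P \<and> dinf L P R \<le> dinf L P Q + dinf L Q R"
      using nn z s t by blast
  qed
  show "\<forall>i a b. \<forall>z\<in>cell L i a b. \<forall>w\<in>cell L i a b. dpi z w \<le> 4 powi (- i)"
    by (intro allI ballI dinf_le) (simp add: admissible_dist_def)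
qed

lemma dinf_nonneg: "P \<in> Xinf L \<Longrightarrow> Q \<in> Xinf L \<Longrightarrow> 0 \<le> dinf L P Q"
  and dinf_self: "P \<in> Xinf L \<Longrightarrow> dinf L P P = 0"
  and dinf_sym: "P \<in> Xinf L \<Longrightarrow> Q \<in> Xinf L \<Longrightarrow> dinf L P Q = dinf L Q P"
  and dinf_triangle: "P \<in> Xinf L \<Longrightarrow> Q \<in> Xinf L \<Longrightarrow> R \<in> Xinf L \<Longrightarrow> dinf L P R \<le> dinf L P Q + dinf L Q R"
  using admissible_dinf unfolding admissible_dist_def pseudodist_on_def by meson+

lemma dinf_cell: "z \<in> cell L i a b \<Longrightarrow> w \<in> cell L i a b \<Longrightarrow> dpi z w \<le> 4 powi (- i)"
  using admissible_dinf unfolding admissible_dist_def by blast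

text \<open>The distance pulled back from the real line along \<open>\<phi>\<close> and divided by
  \<open>c\<close> is admissible, hence below the supremum. It is applied to the first coordinate
  and to the test functions that separate cells.\<close>

lemma dinf_lower_bound:
  assumes inv: "\<And>p q. (p, q) \<in> Rinf L \<Longrightarrow> \<phi> p = \<phi> q" and c: "c > 0"
    and osc: "\<And>i a b z w. z \<in> cell L i a b \<Longrightarrow> w \<in> cell L i a b \<Longrightarrow> \<bar>\<phi> z - \<phi> w\<bar> \<le> c * 4 powi (- i)"
  shows "\<bar>\<phi> p - \<phi> q\<bar> \<le> c * dpi p q"
proof -
  define d where "d = (\<lambda>P Q. \<bar>\<phi> (SOME z. z \<in> P) - \<phi> (SOME z. z \<in> Q)\<bar> / c)"
  have d: "d (pi_inf L p) (pi_inf L q) = \<bar>\<phi> p - \<phi> q\<bar> / c" for p q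
    unfolding d_def using inv[OF Some_pi_inf] by metis
  have "admissible_dist L d"
    unfolding admissible_dist_def
  proof
    show "pseudodist_on (Xinf L) d"
      using c unfolding pseudodist_on_def d_def
      by (auto simp: abs_minus_commute add_divide_distrib[symmetric] intro!: divide_right_mono)
    show "\<forall>i a b. \<forall>z\<in>cell L i a b. \<forall>w\<in>cell L i a b. d (pi_inf L z) (pi_inf L w) \<le> 4 powi (- i)"
      unfolding d using osc c by (auto simp: pos_divide_le_eq mult.commute)
  qed
  from dinf_ge[OF this, of p q] show ?thesis using c by (simp add: d pos_divide_le_eq mult.commute)
qed

lemma dinf_ge_fst: "\<bar>fst p - fst q\<bar> \<le> dpi p q"
proof -
  have "\<bar>fst p - fst q\<bar> \<le> 1 * dpi p q"
    by (rule dinf_lower_bound) (auto simp: Rinf_fst cell_def algebra_simps)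
  thus ?thesis by simp
qed

lemma powi_nat: "(4::real) powi (- int n) = 1 / 4 ^ n" "M powi (- int n) = 1 / M ^ n"
  by (simp_all add: power_int_minus divide_simps)

lemma cell_nat: "cell L (int n) a b = {of_int a / 4 ^ n .. (of_int a + 1) / 4 ^ n} \<times> {of_int b / M ^ n .. (of_int b + 1) / M ^ n}"
  unfolding cell_def powi_nat by simp

lemma floor_bounds:
  assumes "(c::real) > 0"
  shows "of_int \<lfloor>x * c\<rfloor> / c \<le> x" "x < (of_int \<lfloor>x * c\<rfloor> + 1) / c"
  using assms by (simp_all add: pos_divide_le_eq pos_less_divide_eq)

lemma in_cell_floor: "z \<in> cell L (int n) \<lfloor>fst z * 4 ^ n\<rfloor> \<lfloor>snd z * M ^ n\<rfloor>"
  using floor_bounds[of "4^n" "fst z"] floor_bounds[of "M^n" "snd z"]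
  by (cases z) (auto simp: cell_nat)

text \<open>A horizontal segment runs through about \<open>(t - s) * 4 ^ n\<close> cells of level
  \<open>n\<close>, each of diameter at most \<open>1 / 4 ^ n\<close>. The two end pieces and the
  rounding cost \<open>3 / 4 ^ n\<close>, which vanishes as \<open>n\<close> grows; the reverse
  bound is the first coordinate.\<close>

lemma dinf_horizontal: "dpi (s, y) (t, y) = \<bar>s - t\<bar>"
proof -
  have le: "dpi (s, y) (t, y) \<le> t - s" if "s \<le> t" for s t
  proof (rule field_le_epsilon)
    fix e :: real assume "e > 0"
    then obtain n where n: "3 / e < 4 ^ n" using real_arch_pow[of 4 "3 / e"] by auto
    hence e: "3 / 4 ^ n < e" using \<open>e > 0\<close> by (simp add: field_simps)
    define B where "B = \<lfloor>y * M ^ n\<rfloor>"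
    have y: "of_int B / M ^ n \<le> y" "y \<le> (of_int B + 1) / M ^ n"
      using floor_bounds[of "M^n" y] by (simp_all add: B_def)
    have step: "dpi (u, y) (v, y) \<le> 1 / 4 ^ n"
      if "u \<in> {of_int a / 4 ^ n .. (of_int a + 1) / 4 ^ n}" "v \<in> {of_int a / 4 ^ n .. (of_int a + 1) / 4 ^ n}" for u v a
      using dinf_cell[of "(u,y)" "int n" a B "(v,y)"] that y unfolding powi_nat by (simp add: cell_nat)
    define a where "a = \<lfloor>s * 4 ^ n\<rfloor>"
    define b where "b = \<lfloor>t * 4 ^ n\<rfloor>"
    have ab: "a \<le> b" using that by (simp add: a_def b_def floor_mono)
    have ch: "dpi (of_int a / 4 ^ n, y) ((of_int a + real k) / 4 ^ n, y) \<le> k / 4 ^ n" for k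
    proof (induction k)
      case 0 show ?case by (simp add: dinf_self)
    next
      case (Suc k)
      have "dpi ((of_int a + real k) / 4 ^ n, y) ((of_int a + real (Suc k)) / 4 ^ n, y) \<le> 1 / 4 ^ n"
        by (rule step[where a = "a + int k"]) (auto simp: divide_simps)
      with Suc dinf_triangle[of "pi_inf L (of_int a / 4 ^ n, y)" "pi_inf L ((of_int a + real k) / 4 ^ n, y)"
           "pi_inf L ((of_int a + real (Suc k)) / 4 ^ n, y)"]
      show ?case by (simp add: add_divide_distrib)
    qed
    have "of_int a + real (nat (b - a)) = of_int b" using ab by simp
    hence 2: "dpi (of_int a / 4 ^ n, y) (of_int b / 4 ^ n, y) \<le> (of_int b - of_int a) / 4 ^ n"
      using ch[of "nat (b - a)"] ab by (simp add: of_nat_nat)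
    have 1: "dpi (s, y) (of_int a / 4 ^ n, y) \<le> 1 / 4 ^ n"
      using floor_bounds[of "4^n" s] by (intro step[where a = a]) (auto simp: a_def divide_right_mono)
    have 3: "dpi (of_int b / 4 ^ n, y) (t, y) \<le> 1 / 4 ^ n"
      using floor_bounds[of "4^n" t] by (intro step[where a = b]) (auto simp: b_def divide_right_mono)
    have "of_int b / 4 ^ n \<le> t" "s < (of_int a + 1) / 4 ^ n" 
      using floor_bounds[of "4^n" t] floor_bounds[of "4^n" s] by (auto simp: a_def b_def)
    hence "(of_int b - of_int a) / 4 ^ n \<le> t - s + 1 / 4 ^ n" by (simp add: diff_divide_distrib add_divide_distrib)
    with 1 2 3 e dinf_triangle[of "pi_inf L (s,y)" "pi_inf L (of_int a / 4 ^ n, y)" "pi_inf L (t,y)"]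
      dinf_triangle[of "pi_inf L (of_int a / 4 ^ n, y)" "pi_inf L (of_int b / 4 ^ n, y)" "pi_inf L (t,y)"]
    show "dpi (s, y) (t, y) \<le> t - s + e" by simp
  qed
  have "dpi (s, y) (t, y) \<le> \<bar>s - t\<bar>"
    using le[of s t] le[of t s] dinf_sym[of "pi_inf L (s, y)" "pi_inf L (t, y)"] by (cases "s \<le> t") auto
  with dinf_ge_fst[of "(s,y)" "(t,y)"] show ?thesis by simp
qed

text \<open>A vertical segment no longer than the height of a cell is covered by two stacked cells,
  whence the 2; \<open>m\<close> is the point where it passes from one to the other.\<close>

lemma dinf_near:
  assumes "\<bar>y - y'\<bar> \<le> 1 / M ^ n"
  shows "dpi (x, y) (x', y') \<le> \<bar>x - x'\<bar> + 2 / 4 ^ n"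
proof -
  have v: "dpi (x, y) (x, y') \<le> 2 / 4 ^ n" if "\<bar>y - y'\<bar> \<le> 1 / M ^ n" "y \<le> y'" for y y'
  proof -
    define a where "a = \<lfloor>x * 4 ^ n\<rfloor>"
    define B where "B = \<lfloor>y * M ^ n\<rfloor>"
    have x: "of_int a / 4 ^ n \<le> x" "x \<le> (of_int a + 1) / 4 ^ n"
      using floor_bounds[of "4^n" x] by (simp_all add: a_def)
    have y: "of_int B / M ^ n \<le> y" "y \<le> (of_int B + 1) / M ^ n"
      using floor_bounds[of "M^n" y] by (simp_all add: B_def)
    have step: "dpi (x, u) (x, v) \<le> 1 / 4 ^ n"
      if "u \<in> {of_int b / M ^ n .. (of_int b + 1) / M ^ n}" "v \<in> {of_int b / M ^ n .. (of_int b + 1) / M ^ n}" for u v b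
      using dinf_cell[of "(x,u)" "int n" a b "(x,v)"] that x unfolding powi_nat by (simp add: cell_nat)
    define m where "m = min y' ((of_int B + 1) / M ^ n)"
    have "dpi (x, y) (x, m) \<le> 1 / 4 ^ n"
      using y that by (intro step[where b = B]) (auto simp: m_def min_def)
    moreover have "dpi (x, m) (x, y') \<le> 1 / 4 ^ n"
    proof (cases "y' \<le> (of_int B + 1) / M ^ n")
      case True thus ?thesis by (simp add: m_def dinf_self)
    next
      case False
      have "y' \<le> (of_int B + 1) / M ^ n + 1 / M ^ n" using that y by linarith
      thus ?thesis using False by (intro step[where b = "B + 1"]) (auto simp: m_def min_def add_divide_distrib)
    qed
    ultimately show ?thesis using dinf_triangle[of "pi_inf L (x,y)" "pi_inf L (x,m)" "pi_inf L (x,y')"] by simp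
  qed
  have "dpi (x, y) (x, y') \<le> 2 / 4 ^ n"
    using v[of y y'] v[of y' y] assms dinf_sym[of "pi_inf L (x, y)" "pi_inf L (x, y')"] by (cases "y \<le> y'") (auto simp: abs_minus_commute)
  thus ?thesis
    using dinf_triangle[of "pi_inf L (x,y)" "pi_inf L (x,y')" "pi_inf L (x',y')"] dinf_horizontal[of x y' x']
    by simp
qed

section \<open>Continuity and Borel measurability of the projection\<close>

lemma dinf_continuous:
  assumes "e > 0"
  shows "\<exists>\<rho>>0. \<forall>w. dist z w < \<rho> \<longrightarrow> dpi z w < e"
proof -
  obtain n where n: "4 / e < 4 ^ n" using real_arch_pow[of 4 "4 / e"] by auto
  hence n: "4 / 4 ^ n < e" using assms by (simp add: field_simps)
  show ?thesis
  proof (intro exI[of _ "min (e/2) (1 / M ^ n)"] conjI allI impI)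
    fix w assume w: "dist z w < min (e/2) (1 / M ^ n)"
    have "\<bar>fst z - fst w\<bar> \<le> dist z w" "\<bar>snd z - snd w\<bar> \<le> dist z w"
      using dist_fst_le[of z w] dist_snd_le[of z w] by (simp_all add: dist_real_def)
    with w dinf_near[of "snd z" "snd w" n "fst z" "fst w"] n
    show "dpi z w < e" by simp
  qed (use assms in auto)
qed

lemma space_borel_Xinf [simp]: "space (borel_Xinf L) = Xinf L"
  by (simp add: borel_Xinf_def space_measure_of_conv)

lemma d_open_sets: "d_open L U \<Longrightarrow> U \<in> sets (borel_Xinf L)"
  unfolding borel_Xinf_def by (subst sets_measure_of) (auto simp: d_open_def)

lemma pi_inf_measurable [measurable]: "pi_inf L \<in> borel \<rightarrow>\<^sub>M borel_Xinf L"
  unfolding borel_Xinf_def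
proof (rule measurable_measure_of)
  show "{U. d_open L U} \<subseteq> Pow (Xinf L)" by (auto simp: d_open_def)
  fix U assume "U \<in> {U. d_open L U}"
  hence U: "d_open L U" by simp
  have "open (pi_inf L -` U)"
    unfolding open_dist
  proof
    fix z assume "z \<in> pi_inf L -` U"
    then obtain e where e: "e > 0" "\<And>Q. Q \<in> Xinf L \<Longrightarrow> dinf L (pi_inf L z) Q < e \<Longrightarrow> Q \<in> U"
      using U unfolding d_open_def by (metis vimageE)
    obtain \<rho> where "\<rho> > 0" "\<And>w. dist z w < \<rho> \<Longrightarrow> dpi z w < e"
      using dinf_continuous[OF e(1)] by blast
    thus "\<exists>e>0. \<forall>y. dist y z < e \<longrightarrow> y \<in> pi_inf L -` U"
      using e(2) by (intro exI[of _ \<rho>]) (auto simp: dist_commute)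
  qed
  thus "pi_inf L -` U \<inter> space borel \<in> sets borel" by auto
qed auto

lemma lipschitz_continuous:
  assumes "lipschitz_X (Xinf L) (dinf L) f"
  shows "continuous_on UNIV (\<lambda>z. f (pi_inf L z))"
proof -
  obtain C where C: "\<And>P Q. P \<in> Xinf L \<Longrightarrow> Q \<in> Xinf L \<Longrightarrow> \<bar>f P - f Q\<bar> \<le> C * dinf L P Q"
    using assms unfolding lipschitz_X_def by blast
  show ?thesis
    unfolding continuous_on_iff
  proof (intro ballI allI impI)
    fix z :: "real \<times> real" and e :: real assume "e > 0"
    have pos: "\<bar>C\<bar> + 1 > 0" by simp
    obtain \<rho> where \<rho>: "\<rho> > 0" "\<And>w. dist z w < \<rho> \<Longrightarrow> dpi z w < e / (\<bar>C\<bar> + 1)"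
      using dinf_continuous[of "e / (\<bar>C\<bar> + 1)" z] \<open>e > 0\<close> pos by (metis divide_pos_pos)
    show "\<exists>d>0. \<forall>x'\<in>UNIV. dist x' z < d \<longrightarrow> dist (f (pi_inf L x')) (f (pi_inf L z)) < e"
    proof (intro exI[of _ \<rho>] conjI ballI impI \<rho>(1))
      fix w assume "dist w z < \<rho>"
      hence "dpi z w * (\<bar>C\<bar> + 1) < e" using \<rho>(2)[of w] pos
        by (simp add: dist_commute pos_less_divide_eq)
      moreover have "C * dpi z w \<le> (\<bar>C\<bar> + 1) * dpi z w"
        by (intro mult_right_mono) (auto simp: dinf_nonneg)
      ultimately show "dist (f (pi_inf L w)) (f (pi_inf L z)) < e"
        using C[of "pi_inf L z" "pi_inf L w"] by (simp add: dist_real_def abs_minus_commute mult.commute)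
    qed
  qed
qed

section \<open>Test functions separating cells\<close>

text \<open>A function on the grid points of level \<open>i\<close> that respects the gluing is extended to all finer grids:
  linearly along the horizontal edges, and from the bottom to the top edge of a cell in \<open>L - 1\<close> equal
  jumps. The line \<open>x \<equiv> r/4\<close> takes its jumps where the strips are not glued on it, which is what the
  argument \<open>(c + 1 - r) div 3\<close> of \<open>ramp\<close> achieves. A jump is at most \<open>1/99\<close>, far below the factor \<open>1/4\<close> by
  which the cells shrink, so the limit is Lipschitz for the distance.\<close>

definition ramp :: "int \<Rightarrow> real" where
  "ramp l = max 0 (min 1 (of_int l / (real L - 1)))"

lemma ramp_range: "0 \<le> ramp l" "ramp l \<le> 1"
  by (auto simp: ramp_def)

lemma ramp_0: "l \<le> 0 \<Longrightarrow> ramp l = 0"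
  using L_ge by (auto simp: ramp_def max_def min_def divide_simps)

lemma ramp_1: "l \<ge> int L - 1 \<Longrightarrow> ramp l = 1"
proof -
  assume "l \<ge> int L - 1"
  hence "real_of_int l \<ge> real L - 1" by linarith
  thus ?thesis using L_ge by (auto simp: ramp_def max_def min_def divide_simps)
qed

lemma ramp_diff:
  assumes "\<bar>l - l'\<bar> \<le> 1" shows "\<bar>ramp l - ramp l'\<bar> \<le> 1 / 99"
proof -
  have "\<bar>ramp l - ramp l'\<bar> \<le> \<bar>of_int l / (real L - 1) - of_int l' / (real L - 1)\<bar>"
    unfolding ramp_def by linarith
  also have "\<dots> = \<bar>of_int (l - l')\<bar> / (real L - 1)"
    using L_ge by (simp add: diff_divide_distrib[symmetric])
  also have "\<dots> \<le> 1 / 99" using L_ge assms by (intro frac_le) auto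
  finally show ?thesis .
qed

definition edge :: "(int \<Rightarrow> int \<Rightarrow> real) \<Rightarrow> int \<Rightarrow> int \<Rightarrow> real" where
  "edge G A b = (1 - of_int (A mod 4) / 4) * G (A div 4) b + of_int (A mod 4) / 4 * G (A div 4 + 1) b"

definition refine :: "(int \<Rightarrow> int \<Rightarrow> real) \<Rightarrow> int \<Rightarrow> int \<Rightarrow> real" where
  "refine G A B = edge G A (B div Mi) +
     (edge G A (B div Mi + 1) - edge G A (B div Mi)) * ramp ((B mod Mi + 1 - A mod 4) div 3)"

lemma Mi_pos: "Mi > 0" "Mi \<ge> 300" using L_ge by (auto simp: Mi_def)

lemma mod4: "0 \<le> (A::int) mod 4" "(A::int) mod 4 \<le> 3" by presburger+

text \<open>The end \<open>c = Mi\<close> is included because neighbouring cells agree on their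
  common edge. For every residue of \<open>A\<close> the argument of \<open>ramp\<close> is at most
  0 at the bottom and at least \<open>L - 1\<close> at the top; the offsets use up the last jump,
  which is why there are \<open>L - 1\<close> and not \<open>L\<close>.\<close>

lemma refine_eq:
  assumes "0 \<le> c" "c \<le> Mi"
  shows "refine G A (Mi * b + c) = edge G A b + (edge G A (b + 1) - edge G A b) * ramp ((c + 1 - A mod 4) div 3)"
proof (cases "c = Mi")
  case False
  hence "(Mi * b + c) div Mi = b" "(Mi * b + c) mod Mi = c"
    using assms by auto
  thus ?thesis by (simp only: refine_def)
next
  case True
  have "(Mi * b + c) div Mi = b + 1" "(Mi * b + c) mod Mi = 0" using Mi_pos unfolding True by auto
  moreover have "ramp ((0 + 1 - A mod 4) div 3) = 0" using mod4[of A] by (intro ramp_0) linarith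
  moreover have "ramp ((c + 1 - A mod 4) div 3) = 1" using mod4[of A] unfolding True Mi_def by (intro ramp_1) linarith
  ultimately show ?thesis by (simp only: refine_def) simp
qed

lemma Mi_decomp: obtains b c where "B = Mi * b + c" "0 \<le> c" "c < Mi" "b = B div Mi" "c = B mod Mi"
  using Mi_pos by (metis mult_div_mod_eq pos_mod_bound pos_mod_sign)

lemma convex_diff:
  assumes "0 \<le> w" "w \<le> (1::real)" "\<bar>x\<bar> \<le> v" "\<bar>y\<bar> \<le> v"
  shows "\<bar>(1 - w) * x + w * y\<bar> \<le> v"
proof -
  have "\<bar>(1 - w) * x + w * y\<bar> \<le> (1 - w) * \<bar>x\<bar> + w * \<bar>y\<bar>"
    using assms by (metis abs_mult abs_of_nonneg abs_triangle_ineq diff_ge_0_iff_ge)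
  also have "\<dots> \<le> (1 - w) * v + w * v" using assms by (intro add_mono mult_left_mono) auto
  finally show ?thesis by (simp add: algebra_simps)
qed

lemma frac4: "0 \<le> real_of_int (A mod 4) / 4" "real_of_int (A mod 4) / 4 \<le> 1"
  using mod4[of A] by auto

lemma edge_vertical:
  assumes "\<And>a b. \<bar>G a (b + 1) - G a b\<bar> \<le> v"
  shows "\<bar>edge G A (b + 1) - edge G A b\<bar> \<le> v"
proof -
  have "edge G A (b + 1) - edge G A b = (1 - of_int (A mod 4) / 4) * (G (A div 4) (b + 1) - G (A div 4) b)
     + of_int (A mod 4) / 4 * (G (A div 4 + 1) (b + 1) - G (A div 4 + 1) b)"
    by (simp add: edge_def algebra_simps)
  thus ?thesis using convex_diff[OF frac4 assms assms] by presburger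
qed

lemma edge_step: "edge G (A + 1) b - edge G A b = (G (A div 4 + 1) b - G (A div 4) b) / 4"
proof (cases "A mod 4 = 3")
  case True
  hence "(A + 1) div 4 = A div 4 + 1" "(A + 1) mod 4 = 0" by presburger+
  thus ?thesis using True by (simp add: edge_def field_simps)
next
  case False
  hence "(A + 1) div 4 = A div 4" "(A + 1) mod 4 = A mod 4 + 1" by presburger+
  thus ?thesis by (simp add: edge_def field_simps)
qed

text \<open>Inside a coarse cell only \<open>ramp\<close> varies with \<open>B\<close>, by at most
  one jump per step.\<close>

lemma refine_vertical:
  assumes "\<And>a b. \<bar>G a (b + 1) - G a b\<bar> \<le> v"
  shows "\<bar>refine G A (B + 1) - refine G A B\<bar> \<le> v / 99"
proof -
  obtain b c where B: "B = Mi * b + c" "0 \<le> c" "c < Mi" by (rule Mi_decomp)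
  have "refine G A (B + 1) - refine G A B = (edge G A (b + 1) - edge G A b) *
      (ramp ((c + 1 + 1 - A mod 4) div 3) - ramp ((c + 1 - A mod 4) div 3))"
    using refine_eq[of c G A b] refine_eq[of "c + 1" G A b] B by (simp add: algebra_simps)
  hence "\<bar>refine G A (B + 1) - refine G A B\<bar> = \<bar>edge G A (b + 1) - edge G A b\<bar> *
      \<bar>ramp ((c + 1 + 1 - A mod 4) div 3) - ramp ((c + 1 - A mod 4) div 3)\<bar>"
    by (simp add: abs_mult)
  also have "\<dots> \<le> v * (1 / 99)"
    using edge_vertical[of G v, OF assms] order_trans[OF abs_ge_zero assms[of 0 0]]
    by (intro mult_mono ramp_diff) auto
  finally show ?thesis by simp
qed

text \<open>A step to the right takes a quarter of the coarse horizontal difference, and it may move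
  the position in the ramp by one jump. The latter gives the term \<open>v / 99\<close>, which links
  the horizontal to the vertical differences.\<close>

lemma refine_horizontal:
  assumes v: "\<And>a b. \<bar>G a (b + 1) - G a b\<bar> \<le> v" and h: "\<And>a b. \<bar>G (a + 1) b - G a b\<bar> \<le> h"
  shows "\<bar>refine G (A + 1) B - refine G A B\<bar> \<le> h / 4 + v / 99"
proof -
  define b c where "b = B div Mi" and "c = B mod Mi"
  define w where "w = ramp ((c + 1 - A mod 4) div 3)"
  define w' where "w' = ramp ((c + 1 - (A + 1) mod 4) div 3)"
  \<comment> \<open>When the residue wraps from 3 to 0 the numerator grows by 3, so the quotient
    grows by exactly 1.\<close>
  have "\<bar>(c + 1 - (A + 1) mod 4) div 3 - (c + 1 - A mod 4) div 3\<bar> \<le> 1"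
  proof -
    have "(A + 1) mod 4 = A mod 4 + 1 \<or> ((A + 1) mod 4 = 0 \<and> A mod 4 = 3)" by presburger
    moreover have "((c + 1 - (r + 1)) div 3) - (c + 1 - r) div 3 \<in> {-1..0}" for r :: int by simp presburger
    moreover have "((c + 1 - 0) div 3) - (c + 1 - 3) div 3 = (1::int)" by presburger
    ultimately show ?thesis by (smt (verit) atLeastAtMost_iff)
  qed
  hence w': "\<bar>w' - w\<bar> \<le> 1 / 99" unfolding w_def w'_def by (rule ramp_diff)
  have "\<bar>(edge G (A + 1) (b + 1) - edge G (A + 1) b) * (w' - w)\<bar> \<le> v * (1 / 99)"
    unfolding abs_mult using w' edge_vertical[of G v, OF v] order_trans[OF abs_ge_zero v[of 0 0]]
    by (intro mult_mono) auto
  moreover have "\<bar>(1 - w) * (edge G (A + 1) b - edge G A b) + w * (edge G (A + 1) (b + 1) - edge G A (b + 1))\<bar> \<le> h / 4"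
    using ramp_range h unfolding edge_step w_def by (intro convex_diff) (auto simp: abs_divide divide_right_mono)
  moreover have "refine G (A + 1) B - refine G A B =
     ((1 - w) * (edge G (A + 1) b - edge G A b) + w * (edge G (A + 1) (b + 1) - edge G A (b + 1)))
     + (edge G (A + 1) (b + 1) - edge G (A + 1) b) * (w' - w)"
    unfolding refine_def b_def[symmetric] c_def[symmetric] w_def[symmetric] w'_def[symmetric]
    by (simp add: algebra_simps)
  ultimately show ?thesis by linarith
qed

lemma refine_near:
  assumes v: "\<And>a b. \<bar>G a (b + 1) - G a b\<bar> \<le> v" and h: "\<And>a b. \<bar>G (a + 1) b - G a b\<bar> \<le> h"
  shows "\<bar>refine G A B - G (A div 4) (B div Mi)\<bar> \<le> h + v"
proof -
  define b where "b = B div Mi"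
  define w where "w = ramp ((B mod Mi + 1 - A mod 4) div 3)"
  have "\<bar>edge G A b - G (A div 4) b\<bar> = \<bar>of_int (A mod 4) / 4 * (G (A div 4 + 1) b - G (A div 4) b)\<bar>"
    unfolding edge_def by (intro arg_cong[where f = abs]) (simp add: algebra_simps)
  also have "\<dots> \<le> 1 * h" unfolding abs_mult using frac4[of A] h by (intro mult_mono) auto
  finally have 1: "\<bar>edge G A b - G (A div 4) b\<bar> \<le> h" by simp
  have "\<bar>(edge G A (b + 1) - edge G A b) * w\<bar> \<le> v * 1"
    unfolding abs_mult using ramp_range edge_vertical[of G v, OF v] order_trans[OF abs_ge_zero v[of 0 0]]
    by (intro mult_mono) (auto simp: w_def)
  with 1 show ?thesis unfolding refine_def b_def[symmetric] w_def[symmetric] by linarith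
qed

lemma convex_range:
  assumes "0 \<le> w" "w \<le> (1::real)" "0 \<le> x" "x \<le> 1" "0 \<le> y" "y \<le> 1"
  shows "0 \<le> (1 - w) * x + w * y \<and> (1 - w) * x + w * y \<le> 1"
proof -
  have "(1 - w) * x + w * y \<le> (1 - w) * 1 + w * 1" using assms by (intro add_mono mult_left_mono) auto
  thus ?thesis using assms by simp
qed

lemma refine_range:
  assumes "\<And>a b. 0 \<le> G a b \<and> G a b \<le> 1"
  shows "0 \<le> refine G A B \<and> refine G A B \<le> 1"
proof -
  have e: "0 \<le> edge G A b \<and> edge G A b \<le> 1" for b
    unfolding edge_def using assms frac4 by (intro convex_range) auto
  define w where "w = ramp ((B mod Mi + 1 - A mod 4) div 3)"
  have "refine G A B = (1 - w) * edge G A (B div Mi) + w * edge G A (B div Mi + 1)"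
    unfolding refine_def w_def[symmetric] by (simp add: algebra_simps)
  thus ?thesis using convex_range[of w "edge G A (B div Mi)" "edge G A (B div Mi + 1)"] e ramp_range
    by (simp add: w_def)
qed

text \<open>On a line with residue \<open>r\<close> the three edges of two glued strips are
  \<open>c = 3 * q + r - 1\<close> and its two successors. The argument of \<open>ramp\<close>
  equals \<open>q\<close> on all three, so no jump occurs between them.\<close>

lemma refine_glued:
  assumes "A mod 4 \<noteq> 0" "B mod 3 = A mod 4 - 1"
  shows "refine G A B = refine G A (B + 1)" "refine G A (B + 1) = refine G A (B + 2)"
proof -
  obtain b c where B: "B = Mi * b + c" "0 \<le> c" "c < Mi" by (rule Mi_decomp)
  have "B mod 3 = c mod 3" unfolding B(1) Mi_def by (simp add: mult.assoc)
  hence c: "c mod 3 = A mod 4 - 1" using assms by simp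
  have A: "A mod 4 \<in> {1,2,3}" using assms(1) mod4[of A] by auto
  define F where "F u = edge G A b + (edge G A (b + 1) - edge G A b) * ramp u" for u
  have r: "refine G A B' = F ((c' + 1 - A mod 4) div 3)" if "B' = Mi * b + c'" "0 \<le> c'" "c' \<le> Mi" for B' c'
    using refine_eq[OF that(2,3)] unfolding F_def that(1) .
  have r0: "refine G A B = F ((c + 1 - A mod 4) div 3)" by (rule r) (use B in linarith)+
  have r1: "refine G A (B + 1) = F ((c + 1 + 1 - A mod 4) div 3)" by (rule r) (use B in linarith)+
  define r0 where "r0 = A mod 4"
  define q where "q = (c + 1 - r0) div 3"
  have "(c + 1 - r0) mod 3 = 0" using c unfolding r0_def[symmetric] by presburger
  hence q: "c = 3 * q + r0 - 1" unfolding q_def by presburger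
  have 1: "(c + 1 - A mod 4) div 3 = (c + 1 + 1 - A mod 4) div 3" unfolding r0_def[symmetric] q by simp
  show "refine G A B = refine G A (B + 1)" unfolding r0 r1 1 ..
  show "refine G A (B + 1) = refine G A (B + 2)"
  proof (cases "c + 2 \<le> Mi")
    case True
    have r2: "refine G A (B + 2) = F ((c + 2 + 1 - A mod 4) div 3)" by (rule r) (use B True in linarith)+
    have 2: "(c + 1 + 1 - A mod 4) div 3 = (c + 2 + 1 - A mod 4) div 3" unfolding r0_def[symmetric] q by simp
    show ?thesis unfolding r1 r2 2 ..
  next
    case False
    \<comment> \<open>The pair of strips reaches into the next cell. This happens only for residue
      3, and there the ramp of the next cell is still at 0 on its first two edges.\<close>
    hence cM: "c = Mi - 1" using B by linarith
    have B1: "B + 1 = Mi * (b + 1) + 0" "B + 2 = Mi * (b + 1) + 1"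
      using B(1) unfolding cM distrib_left by linarith+
    have "c mod 3 = 2" unfolding cM Mi_def by presburger
    hence "A mod 4 = 3" using c by simp
    hence "ramp ((0 + 1 - A mod 4) div 3) = 0" "ramp ((1 + 1 - A mod 4) div 3) = 0" by (auto intro: ramp_0)
    thus ?thesis unfolding B1 using refine_eq[of 0 G A "b+1"] refine_eq[of 1 G A "b+1"] Mi_pos by simp
  qed
qed

lemma edge_4 [simp]: "edge G (4 * a) b = G a b"
  by (simp add: edge_def)

text \<open>On the vertical lines of the coarse grid the refinement uses only the column
  \<open>a\<close>, by the same formula at every height. An agreement of two stretches of this
  column thus survives refinement, which keeps older gluings respected.\<close>

lemma refine_periodic:
  assumes G: "\<And>b. lo \<le> b \<Longrightarrow> b \<le> hi \<Longrightarrow> G a b = G a (b + S)" and B: "Mi * lo \<le> B" "B \<le> Mi * hi"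
  shows "refine G (4 * a) B = refine G (4 * a) (B + Mi * S)"
proof -
  obtain b c where bc: "B = Mi * b + c" "0 \<le> c" "c < Mi" "b = B div Mi" by (rule Mi_decomp)
  have lo: "lo \<le> b" 
    using zdiv_mono1[OF B(1) Mi_pos(1)] Mi_pos bc(4) by simp
  have hi: "b \<le> hi" using zdiv_mono1[OF B(2) Mi_pos(1)] Mi_pos bc(4) by simp
  have e: "B + Mi * S = Mi * (b + S) + c" using bc by (simp add: algebra_simps)
  have z: "(4 * a) mod 4 = 0" by simp
  have r: "refine G (4 * a) (Mi * b' + c) = G a b' + (G a (b' + 1) - G a b') * ramp ((c + 1) div 3)" for b'
    using refine_eq[OF bc(2) less_imp_le[OF bc(3)], of G "4 * a" b'] unfolding edge_4 z diff_0_right .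
  show ?thesis
  \<comment> \<open>For \<open>b = hi\<close> the row \<open>b + 1\<close> is outside the known
    range, but then \<open>c = 0\<close> and the ramp gives it weight 0.\<close>
  proof (cases "b = hi")
    case True
    hence "c = 0" using B(2) bc(1,2) unfolding True[symmetric] by linarith
    hence "ramp ((c + 1) div 3) = 0" by (intro ramp_0) auto
    thus ?thesis unfolding e unfolding bc(1) r using G[OF lo hi] by simp
  next
    case False
    hence "G a (b + 1) = G a (b + S + 1)" using G[of "b+1"] lo hi by (simp add: add_ac)
    thus ?thesis unfolding e unfolding bc(1) r using G[OF lo hi] by simp
  qed
qed

lemma refine_const:
  assumes G: "\<And>a b. a \<in> {lo..hi} \<Longrightarrow> b \<in> {lo'..hi'} \<Longrightarrow> G a b = \<kappa>"
    and A: "4 * lo \<le> A" "A \<le> 4 * hi" and B: "Mi * lo' \<le> B" "B \<le> Mi * hi'"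
  shows "refine G A B = \<kappa>"
proof -
  obtain b c where bc: "B = Mi * b + c" "0 \<le> c" "c < Mi" "b = B div Mi" by (rule Mi_decomp)
  have lo: "lo' \<le> b" 
    using zdiv_mono1[OF B(1) Mi_pos(1)] Mi_pos bc(4) by simp
  have hi: "b \<le> hi'" using zdiv_mono1[OF B(2) Mi_pos(1)] Mi_pos bc(4) by simp
  have e: "edge G A b' = \<kappa>" if "b' \<in> {lo'..hi'}" for b'
  proof -
    have "A div 4 \<in> {lo..hi}" "A mod 4 = 0 \<or> A div 4 + 1 \<in> {lo..hi}"
      using A by (simp_all, presburger+)
    thus ?thesis using G that by (auto simp: edge_def algebra_simps)
  qed
  show ?thesis
  proof (cases "b = hi'")
    case True
    hence "c = 0" using B(2) bc(1,2) unfolding True[symmetric] by linarith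
    hence "ramp ((c + 1 - A mod 4) div 3) = 0" using mod4[of A] by (intro ramp_0) linarith
    thus ?thesis unfolding bc(1) refine_eq[OF bc(2) less_imp_le[OF bc(3)]] using e[of b] lo hi by simp
  next
    case False
    thus ?thesis unfolding bc(1) refine_eq[OF bc(2) less_imp_le[OF bc(3)]]
      using e[of b] e[of "b+1"] lo hi by simp
  qed
qed

primrec refines :: "(int \<Rightarrow> int \<Rightarrow> real) \<Rightarrow> nat \<Rightarrow> int \<Rightarrow> int \<Rightarrow> real" where
  "refines G 0 = G"
| "refines G (Suc k) = refine (refines G k)"

lemma refines_periodic:
  assumes G: "\<And>b. lo \<le> b \<Longrightarrow> b \<le> hi \<Longrightarrow> refines G k a b = refines G k a (b + S)"
    and B: "Mi ^ m * lo \<le> B" "B \<le> Mi ^ m * hi"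
  shows "refines G (k + m) (4 ^ m * a) B = refines G (k + m) (4 ^ m * a) (B + Mi ^ m * S)"
  using B
proof (induction m arbitrary: B)
  case (Suc m)
  have "refine (refines G (k + m)) (4 * (4 ^ m * a)) B = refine (refines G (k + m)) (4 * (4 ^ m * a)) (B + Mi * (Mi ^ m * S))"
    by (rule refine_periodic[of "Mi ^ m * lo" "Mi ^ m * hi"]) (use Suc in \<open>simp_all add: mult.assoc\<close>)
  thus ?case by (simp add: mult.assoc)
qed (use G in auto)

text \<open>When the four corners of a cell carry the same value, the test function is to be
  constant on the whole cell, including the grid points on its edges.\<close>

lemma refines_const:
  assumes G: "\<And>a b. a \<in> {lo..hi} \<Longrightarrow> b \<in> {lo'..hi'} \<Longrightarrow> G a b = \<kappa>"
    and "A \<in> {4 ^ k * lo..4 ^ k * hi}" "B \<in> {Mi ^ k * lo'..Mi ^ k * hi'}"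
  shows "refines G k A B = \<kappa>"
  using assms(2,3)
proof (induction k arbitrary: A B)
  case (Suc k)
  show ?case unfolding refines.simps
    by (rule refine_const[of "4 ^ k * lo" "4 ^ k * hi" "Mi ^ k * lo'" "Mi ^ k * hi'"])
       (use Suc in \<open>simp_all add: mult.assoc\<close>)
qed (use G in auto)

lemma refines_range:
  assumes "\<And>a b. 0 \<le> G a b \<and> G a b \<le> 1"
  shows "0 \<le> refines G k A B \<and> refines G k A B \<le> 1"
proof (induction k arbitrary: A B)
  case (Suc k)
  show ?case unfolding refines.simps by (rule refine_range) (rule Suc)
qed (use assms in simp)

text \<open>Subtracting \<open>1 / 8 ^ k\<close> strengthens the induction hypothesis: a quarter of
  it pays both for its successor and for the term \<open>1 / 99 ^ Suc k\<close> contributed by the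
  vertical jumps.\<close>

lemma refines_osc:
  assumes G: "\<And>a b. 0 \<le> G a b \<and> G a b \<le> 1"
  shows "\<bar>refines G k A (B + 1) - refines G k A B\<bar> \<le> 1 / 99 ^ k"
    and "\<bar>refines G k (A + 1) B - refines G k A B\<bar> \<le> 2 / 4 ^ k - 1 / 8 ^ k"
proof (induction k arbitrary: A B)
  case 0
  { case 1 show ?case using G[of A B] G[of A "B+1"] by auto }
  { case 2 show ?case using G[of A B] G[of "A+1" B] by auto }
next
  case (Suc k)
  { case 1 show ?case using refine_vertical[of "refines G k" "1 / 99 ^ k" A B, OF Suc(1)] by (simp add: mult.commute) }
  { case 2
    have "\<bar>refine (refines G k) (A + 1) B - refine (refines G k) A B\<bar> \<le> (2 / 4 ^ k - 1 / 8 ^ k) / 4 + (1 / 99 ^ k) / 99"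
      by (rule refine_horizontal) (use Suc in auto)
    moreover have "(1::real) / 99 ^ k \<le> 1 / 8 ^ k" by (intro divide_left_mono power_mono) auto
    moreover have "(0::real) < 1 / 8 ^ k" by simp
    moreover have "(2::real) / 4 ^ Suc k - 1 / 8 ^ Suc k = 2 / 4 ^ k / 4 - (1 / 8 ^ k) / 8" by simp
    moreover have "x \<le> g / 4 - e / 8" if "x \<le> (g - e) / 4 + f / 99" "f \<le> e" "0 < e" for x e f g :: real
      using that by (simp add: field_simps)
    ultimately show ?case unfolding refines.simps by metis }
qed

section \<open>Limits of the refinements as functions on the plane\<close>

definition fl :: "nat \<Rightarrow> real \<times> real \<Rightarrow> int \<times> int" where
  "fl n z = (\<lfloor>fst z * 4 ^ n\<rfloor>, \<lfloor>snd z * M ^ n\<rfloor>)"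

lemma fl_Suc: "fst (fl (Suc n) z) div 4 = fst (fl n z)" "snd (fl (Suc n) z) div Mi = snd (fl n z)"
proof -
  have "\<lfloor>fst z * 4 ^ Suc n / real_of_int 4\<rfloor> = \<lfloor>fst z * 4 ^ Suc n\<rfloor> div 4" by (rule floor_divide_real_eq_div) simp
  thus "fst (fl (Suc n) z) div 4 = fst (fl n z)" by (simp add: fl_def)
  have "\<lfloor>snd z * M ^ Suc n / real_of_int Mi\<rfloor> = \<lfloor>snd z * M ^ Suc n\<rfloor> div Mi"
    using Mi_pos by (intro floor_divide_real_eq_div) simp
  moreover have "snd z * M ^ Suc n / real_of_int Mi = snd z * M ^ n" using M_pos unfolding M_eq by simp
  ultimately show "snd (fl (Suc n) z) div Mi = snd (fl n z)" by (simp add: fl_def)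
qed

definition approx :: "(int \<Rightarrow> int \<Rightarrow> real) \<Rightarrow> nat \<Rightarrow> real \<times> real \<Rightarrow> nat \<Rightarrow> real" where
  "approx G i z k = refines G k (fst (fl (i + k) z)) (snd (fl (i + k) z))"

definition extend :: "(int \<Rightarrow> int \<Rightarrow> real) \<Rightarrow> nat \<Rightarrow> real \<times> real \<Rightarrow> real" where
  "extend G i z = lim (approx G i z)"

context
  fixes G :: "int \<Rightarrow> int \<Rightarrow> real"
  assumes G: "\<And>a b. 0 \<le> G a b \<and> G a b \<le> 1"
begin

lemma pow_le: "(1::real) / 99 ^ k \<le> 1 / 4 ^ k" "0 \<le> (1::real) / 8 ^ k"
  by (auto intro!: divide_left_mono power_mono)

lemma refines_osc':
  "\<bar>refines G k A (B + 1) - refines G k A B\<bar> \<le> 1 / 4 ^ k"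
  "\<bar>refines G k (A + 1) B - refines G k A B\<bar> \<le> 2 / 4 ^ k"
proof -
  show "\<bar>refines G k A (B + 1) - refines G k A B\<bar> \<le> 1 / 4 ^ k"
    using refines_osc(1)[of G k A B, OF G] pow_le[of k] by linarith
  show "\<bar>refines G k (A + 1) B - refines G k A B\<bar> \<le> 2 / 4 ^ k"
    using refines_osc(2)[of G k A B, OF G] pow_le[of k] by linarith
qed

lemma approx_step: "\<bar>approx G i z (Suc k) - approx G i z k\<bar> \<le> 3 / 4 ^ k"
proof -
  have "\<bar>refine (refines G k) (fst (fl (Suc (i + k)) z)) (snd (fl (Suc (i + k)) z))
     - refines G k (fst (fl (Suc (i + k)) z) div 4) (snd (fl (Suc (i + k)) z) div Mi)\<bar> \<le> 2 / 4 ^ k + 1 / 4 ^ k"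
    by (rule refine_near) (fact refines_osc')+
  thus ?thesis unfolding fl_Suc by (simp add: approx_def)
qed

lemma approx_tail: "\<bar>approx G i z (k + m) - approx G i z k\<bar> \<le> 4 / 4 ^ k - 4 / 4 ^ (k + m)"
proof (induction m)
  case (Suc m)
  have "(4::real) / 4 ^ (k + m) - 3 / 4 ^ (k + m) = 4 / 4 ^ (k + Suc m)" by (simp add: field_simps)
  with Suc approx_step[of i z "k+m"] show ?case by simp
qed simp

lemma approx_LIMSEQ: "approx G i z \<longlonglongrightarrow> extend G i z"
proof -
  have "Cauchy (approx G i z)"
  proof (rule metric_CauchyI)
    fix e :: real assume "e > 0"
    then obtain N where N: "8 / e < 4 ^ N" using real_arch_pow[of 4 "8 / e"] by auto
    hence N: "8 / 4 ^ N < e" using \<open>e > 0\<close> by (simp add: field_simps)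
    have *: "\<bar>approx G i z m - approx G i z N\<bar> \<le> 4 / 4 ^ N" if m: "m \<ge> N" for m
    proof -
      have "(0::real) \<le> 4 / 4 ^ m" by simp
      moreover have "\<bar>approx G i z m - approx G i z N\<bar> \<le> 4 / 4 ^ N - 4 / 4 ^ m"
        using approx_tail[of i z N "m - N"] m by simp
      ultimately show ?thesis by linarith
    qed
    show "\<exists>M. \<forall>m\<ge>M. \<forall>n\<ge>M. dist (approx G i z m) (approx G i z n) < e"
    proof (intro exI[of _ N] allI impI)
      fix m n assume "m \<ge> N" "n \<ge> N"
      from *[OF this(1)] *[OF this(2)] N show "dist (approx G i z m) (approx G i z n) < e"
        by (simp add: dist_real_def)
    qed
  qed
  thus ?thesis unfolding extend_def using Cauchy_convergent_iff convergent_LIMSEQ_iff by blast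
qed

lemma extend_approx: "\<bar>extend G i z - approx G i z k\<bar> \<le> 4 / 4 ^ k"
proof (rule LIMSEQ_le_const2)
  show "(\<lambda>m. \<bar>approx G i z m - approx G i z k\<bar>) \<longlonglongrightarrow> \<bar>extend G i z - approx G i z k\<bar>"
    by (intro tendsto_intros approx_LIMSEQ)
  have "\<bar>approx G i z m - approx G i z k\<bar> \<le> 4 / 4 ^ k" if "m \<ge> k" for m
  proof -
    have "(0::real) \<le> 4 / 4 ^ m" by simp
    moreover have "\<bar>approx G i z m - approx G i z k\<bar> \<le> 4 / 4 ^ k - 4 / 4 ^ m"
      using approx_tail[of i z k "m - k"] that by simp
    ultimately show ?thesis by linarith
  qed
  thus "\<exists>N. \<forall>m\<ge>N. \<bar>approx G i z m - approx G i z k\<bar> \<le> 4 / 4 ^ k" by blast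
qed

lemma extend_range: "0 \<le> extend G i z" "extend G i z \<le> 1"
proof -
  have r: "0 \<le> approx G i z k" "approx G i z k \<le> 1" for k
    using refines_range[of G, OF G] by (simp_all add: approx_def)
  show "0 \<le> extend G i z" by (rule LIMSEQ_le_const[OF approx_LIMSEQ]) (use r in blast)
  show "extend G i z \<le> 1" by (rule LIMSEQ_le_const2[OF approx_LIMSEQ]) (use r in blast)
qed

lemma floor_in_cell:
  assumes "(c::real) > 0" "of_int a / c \<le> x" "x \<le> (of_int a + 1) / c"
  shows "\<lfloor>x * c\<rfloor> = a \<or> \<lfloor>x * c\<rfloor> = a + 1"
proof -
  have "of_int a \<le> x * c" "x * c \<le> of_int a + 1" using assms by (simp_all add: pos_divide_le_eq pos_le_divide_eq)
  thus ?thesis by linarith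
qed

text \<open>A point on the upper or right edge of the closed cell has a neighbouring index under
  \<open>fl\<close>. One vertical and one horizontal step lead back to \<open>(a, b)\<close>, at the
  cost \<open>1 + 2 = 3\<close>.\<close>

lemma approx_in_cell:
  assumes "z \<in> cell L (int (i + k)) a b"
  shows "\<bar>approx G i z k - refines G k a b\<bar> \<le> 3 / 4 ^ k"
proof -
  have "fst (fl (i + k) z) = a \<or> fst (fl (i + k) z) = a + 1" "snd (fl (i + k) z) = b \<or> snd (fl (i + k) z) = b + 1"
    using assms floor_in_cell[of "4 ^ (i + k)" a "fst z"] floor_in_cell[of "M ^ (i + k)" b "snd z"]
    unfolding fl_def cell_nat by (cases z; auto simp del: of_nat_add)+
  moreover have "(0::real) \<le> 1 / 4 ^ k" "(2::real) / 4 ^ k = 2 * (1 / 4 ^ k)" "(3::real) / 4 ^ k = 3 * (1 / 4 ^ k)"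
    by simp_all
  ultimately show ?thesis
    using refines_osc'(1)[of k a b] refines_osc'(1)[of k "a+1" b] refines_osc'(2)[of k a b] refines_osc'(2)[of k a "b+1"]
    unfolding approx_def by (elim disjE; simp only:; linarith)
qed

text \<open>Each of the two points pays \<open>4 / 4 ^ k\<close> for the limit and
  \<open>3 / 4 ^ k\<close> for moving to the corner: \<open>14 = 2 * (4 + 3)\<close>. For cells
  coarser than level \<open>i\<close> the range between 0 and 1 suffices. This is the origin of the
  14 in the later estimates.\<close>

lemma extend_osc:
  assumes "z \<in> cell L j a b" "w \<in> cell L j a b"
  shows "\<bar>extend G i z - extend G i w\<bar> \<le> 14 * 4 ^ i * 4 powi (- j)"
proof (cases "j \<ge> int i")
  case True
  define k where "k = nat (j - int i)"
  have j: "j = int (i + k)" using True by (simp add: k_def)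
  have "\<bar>extend G i z - extend G i w\<bar> \<le> 14 / 4 ^ k"
    using approx_in_cell[of z i k a b] approx_in_cell[of w i k a b] assms
      extend_approx[of i z k] extend_approx[of i w k] unfolding j by linarith
  also have "14 / 4 ^ k = 14 * 4 ^ i * (4::real) powi (- j)" unfolding j powi_nat by (simp add: power_add)
  finally show ?thesis .
next
  case False
  have "\<bar>extend G i z - extend G i w\<bar> \<le> 1" using extend_range[of i z] extend_range[of i w] by auto
  also have "1 \<le> (4::real) powi (int i - j)" using False by (intro one_le_power_int) auto
  also have "(4::real) powi (int i - j) = 4 ^ i * 4 powi (- j)" by (simp add: power_int_diff power_int_minus divide_simps)
  also have "\<dots> \<le> 14 * (4 ^ i * 4 powi (- j))" by simp
  finally show ?thesis by simp
qed

text \<open>The line through \<open>x\<close> belongs to the grid of level \<open>i + k\<close>,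
  hence to all finer grids, so the agreement at level \<open>i + k\<close> persists through all
  refinements and in the limit.\<close>

lemma extend_shift:
  assumes x: "x = of_int a / 4 ^ (i + k)"
    and y: "of_int lo / M ^ (i + k) \<le> y" "y \<le> of_int hi / M ^ (i + k)"
    and per: "\<And>b. lo \<le> b \<Longrightarrow> b \<le> hi \<Longrightarrow> refines G k a b = refines G k a (b + S)"
  shows "extend G i (x, y) = extend G i (x, y + of_int S / M ^ (i + k))"
proof -
  have "approx G i (x, y) (k + m) = approx G i (x, y + of_int S / M ^ (i + k)) (k + m)" for m
  proof -
    define B where "B = \<lfloor>y * M ^ (i + (k + m))\<rfloor>"
    have e: "M ^ (i + (k + m)) = of_int (Mi ^ m) * M ^ (i + k)" by (simp add: power_add M_eq)
    have Mm: "real_of_int (Mi ^ m) > 0" using Mi_pos by simp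
    have "\<lfloor>x * 4 ^ (i + (k + m))\<rfloor> = \<lfloor>real_of_int (4 ^ m * a)\<rfloor>"
      unfolding x by (intro arg_cong[where f = floor]) (simp add: power_add)
    hence A: "\<lfloor>x * 4 ^ (i + (k + m))\<rfloor> = 4 ^ m * a" by (simp only: floor_of_int)
    have "of_int lo \<le> y * M ^ (i + k)" "y * M ^ (i + k) \<le> of_int hi"
      using y by (simp_all add: pos_divide_le_eq pos_le_divide_eq)
    hence "of_int (Mi ^ m) * of_int lo \<le> of_int (Mi ^ m) * (y * M ^ (i + k))" 
       "of_int (Mi ^ m) * (y * M ^ (i + k)) \<le> of_int (Mi ^ m) * of_int hi"
      using Mm by (simp_all only: mult_le_cancel_left_pos)
    hence "real_of_int (Mi ^ m * lo) \<le> y * M ^ (i + (k + m))" "y * M ^ (i + (k + m)) \<le> real_of_int (Mi ^ m * hi)"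
      unfolding e of_int_mult by (simp_all only: mult_ac)
    hence B: "Mi ^ m * lo \<le> B" "B \<le> Mi ^ m * hi" unfolding B_def
      by (simp_all only: le_floor_iff) (metis floor_mono floor_of_int)
    have "(y + of_int S / M ^ (i + k)) * M ^ (i + (k + m)) = y * M ^ (i + (k + m)) + real_of_int (Mi ^ m * S)"
      unfolding e by (simp add: field_simps)
    hence "\<lfloor>(y + of_int S / M ^ (i + k)) * M ^ (i + (k + m))\<rfloor> = B + Mi ^ m * S"
      unfolding B_def by (simp only: floor_add_int)
    thus ?thesis
      using refines_periodic[of lo hi G k a S m B, OF per B] A by (simp add: approx_def fl_def B_def)
  qed
  hence "(\<lambda>m. approx G i (x, y) (m + k)) = (\<lambda>m. approx G i (x, y + of_int S / M ^ (i + k)) (m + k))"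
    by (simp add: add.commute)
  thus ?thesis
    using LIMSEQ_ignore_initial_segment[OF approx_LIMSEQ, where k = k] LIMSEQ_unique by metis
qed

end

definition vertex :: "nat \<Rightarrow> int \<Rightarrow> int \<Rightarrow> real \<times> real" where
  "vertex i a b = (of_int a / 4 ^ i, of_int b / M ^ i)"

text \<open>Gluings of level at most \<open>i\<close> translate whole rows of the grid of level
  \<open>i\<close>; they are respected because \<open>G\<close> respects them at the vertices. Finer
  gluings are built in by \<open>refine_glued\<close> when their level is reached.\<close>

lemma extend_invariant:
  assumes G: "\<And>a b. 0 \<le> G a b \<and> G a b \<le> 1"
    and compat: "\<And>a b b'. (vertex i a b, vertex i a b') \<in> Rinf L \<Longrightarrow> G a b = G a b'"
    and "(p, q) \<in> Rinf L"
  shows "extend G i p = extend G i q"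
  using assms(3)
proof (rule Rinf_least)
  fix p q assume gl: "glue p q"
  then obtain n N t where N: "N mod 4 \<noteq> 0" "t mod 3 = N mod 4 - 1"
     "fst p = of_int N * 4 powi (- n)" "fst q = fst p"
     "of_int t * M powi (- n) \<le> snd p" "snd p \<le> of_int (t + 1) * M powi (- n)"
     "snd q = snd p + M powi (- n)" unfolding glue_def by blast
  show "extend G i p = extend G i q"
  proof (cases "n \<le> int i")
    case True
    define e where "e = nat (int i - n)"
    have n: "- n = int e - int i" using True by (simp add: e_def)
    have pw: "(4::real) powi (- n) = 4 ^ e / 4 ^ i" "M powi (- n) = of_int (Mi ^ e) / M ^ i"
      unfolding n by (simp_all add: power_int_diff flip: M_eq)
    have "extend G i (fst p, snd p) = extend G i (fst p, snd p + of_int (Mi ^ e) / M ^ (i + 0))"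
    proof (rule extend_shift[OF G])
      show "fst p = of_int (N * 4 ^ e) / 4 ^ (i + 0)" using N(3) pw by simp
      show "of_int (t * Mi ^ e) / M ^ (i + 0) \<le> snd p" "snd p \<le> of_int ((t + 1) * Mi ^ e) / M ^ (i + 0)" 
        using N(5,6) unfolding pw by simp_all
      fix b assume b: "t * Mi ^ e \<le> b" "b \<le> (t + 1) * Mi ^ e"
      have "real_of_int (t * Mi ^ e) \<le> real_of_int b" "real_of_int b \<le> real_of_int ((t + 1) * Mi ^ e)"
        using b by (simp_all only: of_int_le_iff)
      hence b': "real_of_int (t * Mi ^ e) / M ^ i \<le> real_of_int b / M ^ i" 
         "real_of_int b / M ^ i \<le> real_of_int ((t + 1) * Mi ^ e) / M ^ i"
        by (auto intro!: divide_right_mono zero_le_power less_imp_le[OF M_pos(1)] simp del: of_int_mult)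
      have "glue (vertex i (N * 4 ^ e) b) (vertex i (N * 4 ^ e) (b + Mi ^ e))"
        unfolding glue_def
        using N(1,2) b' by (intro exI[of _ n] exI[of _ N] exI[of _ t]) (simp add: vertex_def pw add_divide_distrib)
      thus "refines G 0 (N * 4 ^ e) b = refines G 0 (N * 4 ^ e) (b + Mi ^ e)"
        using compat glue_in_Rinf by simp
    qed
    moreover have "p = (fst p, snd p)" "q = (fst p, snd p + of_int (Mi ^ e) / M ^ (i + 0))"
      using N(4,7) pw by (auto simp: prod_eq_iff)
    ultimately show ?thesis by metis
  next
    case False
    define k where "k = nat (n - int i)"
    have n: "n = int (i + k)" and "k > 0" using False by (auto simp: k_def)
    then obtain k' where k': "k = Suc k'" by (cases k) auto
    have pw: "(4::real) powi (- n) = 1 / 4 ^ (i + k)" "M powi (- n) = 1 / M ^ (i + k)"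
      unfolding n powi_nat by auto
    have "extend G i (fst p, snd p) = extend G i (fst p, snd p + of_int 1 / M ^ (i + k))"
    proof (rule extend_shift[OF G])
      show "fst p = of_int N / 4 ^ (i + k)" using N(3) pw by simp
      show "of_int t / M ^ (i + k) \<le> snd p" "snd p \<le> of_int (t + 1) / M ^ (i + k)" 
        using N(5,6) unfolding pw by simp_all
      fix b assume "t \<le> b" "b \<le> t + 1"
      hence "b = t \<or> b = t + 1" by auto
      thus "refines G k N b = refines G k N (b + 1)"
        using refine_glued[of N t "refines G k'"] N(1,2) unfolding k' by (auto simp: add.assoc)
    qed
    moreover have "p = (fst p, snd p)" "q = (fst p, snd p + of_int 1 / M ^ (i + k))"
      using N(4,7) pw by (auto simp: prod_eq_iff)
    ultimately show ?thesis by metis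
  qed
qed auto

lemma floor_mult_bounds:
  fixes u :: real assumes "(c::int) > 0"
  shows "\<lfloor>u * of_int c\<rfloor> \<in> {c * \<lfloor>u\<rfloor>..c * (\<lfloor>u\<rfloor> + 1)}"
proof -
  have "of_int \<lfloor>u\<rfloor> * real_of_int c \<le> u * of_int c" "u * of_int c \<le> (of_int \<lfloor>u\<rfloor> + 1) * real_of_int c"
    using assms by (auto intro!: mult_right_mono)
  hence "real_of_int (c * \<lfloor>u\<rfloor>) \<le> u * of_int c" "u * of_int c \<le> real_of_int (c * (\<lfloor>u\<rfloor> + 1))"
    by (simp_all add: mult.commute)
  thus ?thesis unfolding atLeastAtMost_iff le_floor_iff by (metis floor_mono floor_of_int)
qed

lemma fl_add_bounds:
  "fst (fl (i + k) z) \<in> {4 ^ k * fst (fl i z)..4 ^ k * (fst (fl i z) + 1)}"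
  "snd (fl (i + k) z) \<in> {Mi ^ k * snd (fl i z)..Mi ^ k * (snd (fl i z) + 1)}"
proof -
  have "fst z * 4 ^ (i + k) = fst z * 4 ^ i * of_int (4 ^ k)" "snd z * M ^ (i + k) = snd z * M ^ i * of_int (Mi ^ k)"
    by (simp_all add: power_add M_eq)
  note e = this
  show "fst (fl (i + k) z) \<in> {4 ^ k * fst (fl i z)..4 ^ k * (fst (fl i z) + 1)}"
    "snd (fl (i + k) z) \<in> {Mi ^ k * snd (fl i z)..Mi ^ k * (snd (fl i z) + 1)}"
    using floor_mult_bounds[of "4 ^ k" "fst z * 4 ^ i"] floor_mult_bounds[of "Mi ^ k" "snd z * M ^ i"] Mi_pos
    unfolding fl_def fst_conv snd_conv e by simp_all
qed

definition corner :: "nat \<Rightarrow> real \<times> real \<Rightarrow> real \<times> real \<Rightarrow> bool" where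
  "corner i p v \<longleftrightarrow> (\<exists>a\<in>{fst (fl i p)..fst (fl i p) + 1}. \<exists>b\<in>{snd (fl i p)..snd (fl i p) + 1}. v = vertex i a b)"

text \<open>Apply this to the function that is 0 at the grid points equivalent to a corner of the cell of \<open>p\<close>
  and 1 at all others.\<close>

lemma dinf_small_imp_common_corner:
  assumes "14 * 4 ^ i * dpi p q < 1"
  shows "\<exists>v w. corner i p v \<and> corner i q w \<and> (v, w) \<in> Rinf L"
proof (rule ccontr)
  assume no: "\<not> ?thesis"
  define G where "G = (\<lambda>a b. if \<exists>v. corner i p v \<and> (v, vertex i a b) \<in> Rinf L then 0 else (1::real))"
  have G: "0 \<le> G a b \<and> G a b \<le> 1" for a b by (simp add: G_def)
  have "\<bar>extend G i p - extend G i q\<bar> \<le> 14 * 4 ^ i * dpi p q"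
  proof (rule dinf_lower_bound)
    fix p q assume pq: "(p, q) \<in> Rinf L"
    show "extend G i p = extend G i q"
    proof (rule extend_invariant[OF G _ pq])
      fix a b b' assume "(vertex i a b, vertex i a b') \<in> Rinf L"
      hence "(v, vertex i a b) \<in> Rinf L \<longleftrightarrow> (v, vertex i a b') \<in> Rinf L" for v
        using Rinf_trans Rinf_sym by blast
      thus "G a b = G a b'" by (simp add: G_def)
    qed
  qed (use extend_osc[of G, OF G] in auto)
  moreover have lim: "extend G i z = \<kappa>"
    if "\<And>a b. a \<in> {fst (fl i z)..fst (fl i z) + 1} \<Longrightarrow> b \<in> {snd (fl i z)..snd (fl i z) + 1} \<Longrightarrow> G a b = \<kappa>" for z \<kappa>
  proof -
    have "approx G i z k = \<kappa>" for k
      unfolding approx_def using fl_add_bounds[of i k z] that by (intro refines_const) auto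
    hence "approx G i z = (\<lambda>_. \<kappa>)" by auto
    thus ?thesis using approx_LIMSEQ[of G i z, OF G] LIMSEQ_const_iff by metis
  qed
  moreover have "extend G i p = 0"
  proof (rule lim)
    fix a b assume "a \<in> {fst (fl i p)..fst (fl i p) + 1}" "b \<in> {snd (fl i p)..snd (fl i p) + 1}"
    hence "corner i p (vertex i a b)" unfolding corner_def by blast
    hence "\<exists>v. corner i p v \<and> (v, vertex i a b) \<in> Rinf L" using Rinf_refl by blast
    thus "G a b = 0" by (simp add: G_def)
  qed
  moreover have "extend G i q = 1"
  proof (rule lim)
    fix a b assume "a \<in> {fst (fl i q)..fst (fl i q) + 1}" "b \<in> {snd (fl i q)..snd (fl i q) + 1}"
    hence "corner i q (vertex i a b)" unfolding corner_def by blast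
    hence "\<not> (\<exists>v. corner i p v \<and> (v, vertex i a b) \<in> Rinf L)" using no by blast
    thus "G a b = 1" by (simp add: G_def)
  qed
  ultimately show False using assms by simp
qed

section \<open>Lebesgue density along neighbouring cells\<close>

text \<open>Half-open, so that the tiles of one level partition the plane and tiles of different
  levels are nested or disjoint.\<close>

definition tile :: "nat \<Rightarrow> int \<times> int \<Rightarrow> (real \<times> real) set" where
  "tile n c = {z. fl n z = c}"

abbreviation ccell :: "nat \<Rightarrow> int \<times> int \<Rightarrow> (real \<times> real) set" where
  "ccell n c \<equiv> cell L (int n) (fst c) (snd c)"

lemma floor_eq_iff_interval:
  assumes "(u::real) > 0"
  shows "\<lfloor>x * u\<rfloor> = a \<longleftrightarrow> of_int a / u \<le> x \<and> x < (of_int a + 1) / u"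
  using assms by (simp add: floor_eq_iff pos_divide_le_eq pos_less_divide_eq)

lemma tile_eq: "tile n (a, b) = {of_int a / 4 ^ n ..< (of_int a + 1) / 4 ^ n} \<times> {of_int b / M ^ n ..< (of_int b + 1) / M ^ n}"
  unfolding tile_def fl_def
  using floor_eq_iff_interval[of "4 ^ n"] floor_eq_iff_interval[of "M ^ n"] by auto

lemma tile_subset_ccell: "tile n c \<subseteq> ccell n c"
  using in_cell_floor by (auto simp: tile_def fl_def)

lemma tile_sets [measurable, simp]: "tile n c \<in> sets borel"
  by (cases c) (auto simp: tile_eq borel_prod[symmetric])

lemma emeasure_tile: "emeasure lborel (tile n c) = ennreal (1 / (4 ^ n * M ^ n))"
proof -
  obtain a b where c: "c = (a, b)" by (cases c)
  have "emeasure lborel (tile n c) = emeasure lborel {of_int a / 4 ^ n ..< (of_int a + 1) / (4::real) ^ n} *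
     emeasure lborel {of_int b / M ^ n ..< (of_int b + 1) / M ^ n}"
    unfolding c tile_eq lborel_prod[symmetric] by (rule lborel.emeasure_pair_measure_Times) auto
  also have "emeasure lborel {of_int a / 4 ^ n ..< (of_int a + 1) / (4::real) ^ n} = ennreal (1 / 4 ^ n)"
    by (subst emeasure_lborel_Ico) (auto simp: divide_right_mono add_divide_distrib)
  also have "emeasure lborel {of_int b / M ^ n ..< (of_int b + 1) / M ^ n} = ennreal (1 / M ^ n)"
    by (subst emeasure_lborel_Ico) (auto simp: add_divide_distrib intro!: divide_right_mono zero_le_power less_imp_le[OF M_pos(1)])
  also have "ennreal (1 / 4 ^ n) * ennreal (1 / M ^ n) = ennreal (1 / (4 ^ n * M ^ n))"
    by (subst ennreal_mult[symmetric]) (auto intro!: divide_nonneg_nonneg zero_le_power less_imp_le[OF M_pos(1)])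
  finally show ?thesis .
qed

lemma vertex_in_tile: "vertex n (fst c) (snd c) \<in> tile n c"
  by (cases c) (simp add: tile_def fl_def vertex_def)

lemma fl_mono:
  assumes "m \<le> n" "fl n z = fl n w" shows "fl m z = fl m w"
  using assms(1)
proof (induction rule: inc_induct)
  case (step k)
  thus ?case using fl_Suc[of k z] fl_Suc[of k w] by (simp add: prod_eq_iff)
qed (use assms in auto)

lemma cell_Suc_subset:
  "cell L (int (Suc n)) a b \<subseteq> cell L (int n) (a div 4) (b div Mi)"
proof -
  have aux: "of_int (a div c) / u \<le> of_int a / (of_int c * u)"
       "(of_int a + 1) / (of_int c * u) \<le> (of_int (a div c) + 1) / u"
     if "c > 0" "u > 0" for a c :: int and u :: real
  proof -
    have "c * (a div c) = a - a mod c" by (simp add: minus_mod_eq_mult_div)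
    hence "c * (a div c) \<le> a" "a + 1 \<le> c * (a div c + 1)"
      using pos_mod_sign[OF that(1), of a] pos_mod_bound[OF that(1), of a] unfolding distrib_left by linarith+
    hence "real_of_int (c * (a div c)) \<le> real_of_int a" "real_of_int (a + 1) \<le> real_of_int (c * (a div c + 1))"
      by (simp_all only: of_int_le_iff)
    hence "real_of_int (c * (a div c)) / (of_int c * u) \<le> real_of_int a / (of_int c * u)"
      "real_of_int (a + 1) / (of_int c * u) \<le> real_of_int (c * (a div c + 1)) / (of_int c * u)"
      using that by (intro divide_right_mono; simp)+
    thus "of_int (a div c) / u \<le> of_int a / (of_int c * u)"
       "(of_int a + 1) / (of_int c * u) \<le> (of_int (a div c) + 1) / u"
      using that by simp_all
  qed
  show ?thesis
    using aux[of 4 "4 ^ n" a] aux[of Mi "M ^ n" b] Mi_pos unfolding cell_nat power_Suc M_eq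
    by (auto simp flip: M_eq)
qed

lemma ccell_mono:
  assumes "m \<le> n" shows "ccell n (fl n z) \<subseteq> ccell m (fl m z)"
  using assms
proof (induction rule: inc_induct)
  case (step k)
  have "ccell (Suc k) (fl (Suc k) z) \<subseteq> ccell k (fl k z)"
    using cell_Suc_subset[of k "fst (fl (Suc k) z)" "snd (fl (Suc k) z)"] fl_Suc[of k z] by simp
  thus ?case using step by blast
qed auto

text \<open>Adjacency in the quotient, not in the plane: cells far apart in the plane may be adjacent. Because it
  is defined by intersection of images, it passes from cells to the coarser cells containing them, and
  this replaces a Vitali covering argument in the maximal inequality.\<close>

definition adj :: "nat \<Rightarrow> int \<times> int \<Rightarrow> int \<times> int \<Rightarrow> bool" where
  "adj n c c' \<longleftrightarrow> (\<exists>z\<in>ccell n c. \<exists>z'\<in>ccell n c'. (z, z') \<in> Rinf L)"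

lemma adj_sym: "adj n c c' \<Longrightarrow> adj n c' c"
  unfolding adj_def using Rinf_sym by blast

lemma adj_mono: "m \<le> n \<Longrightarrow> adj n (fl n z) (fl n w) \<Longrightarrow> adj m (fl m z) (fl m w)"
  unfolding adj_def using ccell_mono by blast

lemma adj_refl: "adj n c c"
  unfolding adj_def using vertex_in_tile[of n c] tile_subset_ccell Rinf_refl by blast

lemma window_diff:
  assumes "window p q n N t"
  shows "\<bar>snd q - snd p\<bar> \<le> 2 * M powi (- n)"
    "\<exists>c::int. c \<in> {-2..2} \<and> snd q = snd p + of_int c * M powi (- n)"
proof -
  have u: "M powi (- n) > 0" by simp
  have b: "of_int t * M powi (- n) \<le> snd p" "snd p \<le> of_int t * M powi (- n) + 2 * M powi (- n)"
     "of_int t * M powi (- n) \<le> snd q" "snd q \<le> of_int t * M powi (- n) + 2 * M powi (- n)"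
    using assms by (simp_all add: window_def distrib_right)
  thus d: "\<bar>snd q - snd p\<bar> \<le> 2 * M powi (- n)" by linarith
  obtain c :: int where c: "snd q = snd p + of_int c * M powi (- n)" using assms by (auto simp: window_def)
  have "\<bar>of_int c\<bar> * M powi (- n) \<le> 2 * M powi (- n)" using d u c by (simp add: abs_mult)
  hence "\<bar>real_of_int c\<bar> \<le> 2" using u by (simp only: mult_le_cancel_right_pos)
  hence "c \<in> {-2..2}" by auto
  with c show "\<exists>c::int. c \<in> {-2..2} \<and> snd q = snd p + of_int c * M powi (- n)" by blast
qed

lemma powi_le_nat: "int n \<le> m \<Longrightarrow> M powi (- m) \<le> 1 / M ^ n"
  using power_int_increasing[of "- m" "- int n" M] M_ge unfolding powi_nat by simp

text \<open>The index difference is within 1 of \<open>e\<close>, and \<open>e\<close> is within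
  less than 1 of \<open>k\<close>; an integer of absolute value below 2 is at most 1.\<close>

lemma int_close:
  assumes "(u::real) > 0" "of_int a / u \<le> x" "x \<le> (of_int a + 1) / u"
    "of_int a' / u \<le> x'" "x' \<le> (of_int a' + 1) / u" "x' = x + e / u" "\<bar>e - of_int k\<bar> < 1"
  shows "\<bar>a' - a - k\<bar> \<le> 1"
proof -
  have "of_int a \<le> x * u" "x * u \<le> of_int a + 1" "of_int a' \<le> x' * u" "x' * u \<le> of_int a' + 1"
    using assms by (simp_all add: pos_divide_le_eq pos_le_divide_eq)
  moreover have "x' * u = x * u + e" using assms by (simp add: distrib_right)
  ultimately show ?thesis using assms(7) by linarith
qed

text \<open>A gluing of level at most \<open>n\<close> that meets the cell lies on one of its two
  vertical sides. The side determines the level and with it the height of the jump, so the row is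
  known up to a multiplier \<open>e\<close> and a small offset \<open>d\<close>; finer gluings move
  a point by less than one row. Column, side, \<open>e\<close> and \<open>d\<close> give
  \<open>3 * 2 * 5 * 5 = 150\<close>.\<close>

lemma card_adj: "finite {c'. adj n c c'} \<and> card {c'. adj n c c'} \<le> 150"
proof -
  obtain a b where c: "c = (a, b)" by (cases c)
  \<comment> \<open>Well defined by \<open>level_unique\<close>. For \<open>s = 0\<close> the value
    is arbitrary, but that line carries no gluing.\<close>
  define lev where "lev s = (SOME m. \<exists>N. N mod 4 \<noteq> 0 \<and> of_int s / 4 ^ n = of_int N * (4::real) powi (- m))" for s :: int
  define g where "g s = Mi ^ nat (int n - lev s)" for s
  define h where "h = (\<lambda>(a' :: int, s, e, d). (a', b + d + e * g s))"
  define S where "S = {a - 1..a + 1} \<times> {a..a + 1} \<times> {-2..2::int} \<times> {-2..2::int}"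
  have S: "finite S" "card S = 150" unfolding S_def by (auto simp: card_cartesian_product)
  have "c' \<in> h ` S" if "adj n c c'" for c'
  proof -
    obtain a' b' where c': "c' = (a', b')" by (cases c')
    obtain z z' where z: "z \<in> cell L (int n) a b" "z' \<in> cell L (int n) a' b'" "(z, z') \<in> Rinf L"
      using \<open>adj n c c'\<close> unfolding adj_def c c' by auto
    have x: "of_int a / 4 ^ n \<le> fst z" "fst z \<le> (of_int a + 1) / 4 ^ n"
      "of_int a' / 4 ^ n \<le> fst z'" "fst z' \<le> (of_int a' + 1) / 4 ^ n"
      and y: "of_int b / M ^ n \<le> snd z" "snd z \<le> (of_int b + 1) / M ^ n"
      "of_int b' / M ^ n \<le> snd z'" "snd z' \<le> (of_int b' + 1) / M ^ n"
      using z unfolding cell_nat by (cases z; cases z'; auto)+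
    have "fst z' = fst z" using Rinf_fst[OF z(3)] by simp
    hence a': "\<bar>a' - a\<bar> \<le> 1" using int_close[of "4 ^ n" a "fst z" a' "fst z'" 0 0] x by simp
    have "\<exists>s\<in>{a..a + 1}. \<exists>e\<in>{-2..2}. \<bar>b' - b - e * g s\<bar> \<le> 1"
    proof (cases "\<exists>m N t. window z z' m N t \<and> m \<le> int n")
      case no_window: False
      have "\<bar>snd z' - snd z\<bar> * M ^ n < 1"
      proof (cases "z = z'")
        case False
        with no_window obtain m N t where w: "window z z' m N t" "int (Suc n) \<le> m"
          using Rinf_window[OF z(3)] by fastforce
        have "\<bar>snd z' - snd z\<bar> \<le> 2 * (1 / M ^ Suc n)"
          using window_diff(1)[OF w(1)] powi_le_nat[OF w(2)] by linarith
        hence "\<bar>snd z' - snd z\<bar> * M ^ n \<le> 2 * (1 / M ^ Suc n) * M ^ n"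
          by (intro mult_right_mono) (auto intro: zero_le_power less_imp_le[OF M_pos(1)])
        also have "\<dots> = 2 / M" by simp
        also have "\<dots> < 1" using M_ge by (simp add: divide_simps)
        finally show ?thesis .
      qed simp
      hence "\<bar>(snd z' - snd z) * M ^ n - of_int 0\<bar> < 1" by (simp add: abs_mult power_abs abs_of_pos[OF M_pos(1)])
      moreover have "snd z' = snd z + (snd z' - snd z) * M ^ n / M ^ n" by simp
      ultimately have "\<bar>b' - b - 0\<bar> \<le> 1" using int_close[OF _ y] by (metis M_pos(1) zero_less_power)
      hence "\<bar>b' - b - 0 * g a\<bar> \<le> 1" by simp
      thus ?thesis by (intro bexI[of _ a] bexI[of _ 0]) auto
    next
      case True
      then obtain m N t where w: "window z z' m N t" "m \<le> int n" by blast
      define k where "k = nat (int n - m)"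
      have m: "- m = int k - int n" using w(2) by (simp add: k_def)
      have pw: "(4::real) powi (- m) = 4 ^ k / 4 ^ n" "M powi (- m) = of_int (Mi ^ k) / M ^ n"
        unfolding m by (simp_all add: power_int_diff flip: M_eq)
      have xs: "fst z = of_int (N * 4 ^ k) / 4 ^ n" "N mod 4 \<noteq> 0" using w(1) pw by (simp_all add: window_def)
      have "N * 4 ^ k \<in> {a..a + 1}"
      proof -
        have "of_int a \<le> real_of_int (N * 4 ^ k)" "real_of_int (N * 4 ^ k) \<le> of_int (a + 1)"
          using x(1,2) unfolding xs(1) by (simp_all add: divide_simps)
        thus ?thesis unfolding of_int_le_iff by auto
      qed
      have "lev (N * 4 ^ k) = m"
        unfolding lev_def
      proof (rule some_equality)
        show "\<exists>N'. N' mod 4 \<noteq> 0 \<and> of_int (N * 4 ^ k) / 4 ^ n = of_int N' * (4::real) powi (- m)"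
          using xs(2) unfolding pw by (intro exI[of _ N]) simp
      next
        fix m' assume "\<exists>N'. N' mod 4 \<noteq> 0 \<and> of_int (N * 4 ^ k) / 4 ^ n = of_int N' * (4::real) powi (- m')"
        then obtain N' where "N' mod 4 \<noteq> 0" "of_int (N * 4 ^ k) / 4 ^ n = of_int N' * (4::real) powi (- m')" by blast
        moreover have "of_int (N * 4 ^ k) / 4 ^ n = of_int N * (4::real) powi (- m)" unfolding pw by simp
        ultimately show "m' = m" using level_unique[of N' m' N m] xs(2) by simp
      qed
      hence g: "g (N * 4 ^ k) = Mi ^ k" by (simp add: g_def k_def)
      obtain e where e: "e \<in> {-2..2}" "snd z' = snd z + of_int e * M powi (- m)" using window_diff(2)[OF w(1)] by blast
      have "\<bar>b' - b - e * Mi ^ k\<bar> \<le> 1"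
      proof (rule int_close[OF _ y])
        show "snd z' = snd z + of_int (e * Mi ^ k) / M ^ n" unfolding e(2) pw by simp
      qed simp_all
      hence "\<bar>b' - b - e * g (N * 4 ^ k)\<bar> \<le> 1" by (simp only: g)
      with \<open>N * 4 ^ k \<in> {a..a + 1}\<close> e(1) show ?thesis by blast
    qed
    then obtain s e where se: "s \<in> {a..a + 1}" "e \<in> {-2..2}" "\<bar>b' - b - e * g s\<bar> \<le> 1" by blast
    have "c' = h (a', s, e, b' - b - e * g s)" by (simp add: h_def c')
    moreover have "(a', s, e, b' - b - e * g s) \<in> S" using se a' unfolding S_def by auto
    ultimately show ?thesis by blast
  qed
  hence sub: "{c'. adj n c c'} \<subseteq> h ` S" by blast
  have "card {c'. adj n c c'} \<le> card (h ` S)" by (rule card_mono) (use S sub in auto)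
  also have "\<dots> \<le> 150" using card_image_le[OF S(1), of h] S(2) by simp
  finally show ?thesis using sub S(1) finite_subset by blast
qed

lemma finite_adj: "finite {c'. adj n c c'}" and card_adj_le: "card {c'. adj n c c'} \<le> 150"
  using card_adj[of n c] by blast+

section \<open>The 4-adic vertical lines\<close>

definition adic :: "real \<Rightarrow> bool" where
  "adic x \<longleftrightarrow> (\<exists>n::nat. \<exists>a::int. x = of_int a / 4 ^ n)"

lemma adic_level: "adic (of_int N * 4 powi (- m))"
proof (cases "m \<ge> 0")
  case True
  thus ?thesis unfolding adic_def using powi_nat(1)[of "nat m"] by (intro exI[of _ "nat m"] exI[of _ N]) simp
next
  case False
  have "(4::real) powi (- m) = of_int (4 ^ nat (- m))" using False by (simp add: power_int_def)
  thus ?thesis unfolding adic_def by (intro exI[of _ 0] exI[of _ "N * 4 ^ nat (- m)"]) simp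
qed

lemma Rinf_non_adic: "(p, q) \<in> Rinf L \<Longrightarrow> \<not> adic (fst p) \<Longrightarrow> p = q"
  using Rinf_window[of p q] adic_level by (auto simp: window_def)

text \<open>Off the 4-adic lines, \<open>z\<close> has a positive distance \<open>\<theta>\<close>
  from all lines of level at most \<open>n1\<close>. Cells thinner than \<open>\<theta>\<close> do
  not reach them, so only finer gluings act, and these move a point by at most
  \<open>2 / M ^ n1\<close>.\<close>

lemma adj_shrinks:
  assumes z: "\<not> adic (fst z)" and e: "e > 0"
  shows "\<exists>n0. \<forall>n\<ge>n0. \<forall>c w. adj n (fl n z) c \<longrightarrow> w \<in> ccell n c \<longrightarrow> \<bar>fst w - fst z\<bar> < e \<and> \<bar>snd w - snd z\<bar> < e"
proof -
  obtain n1 where "4 / e < 4 ^ n1" using real_arch_pow[of 4 "4 / e"] by auto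
  hence n1: "4 / 4 ^ n1 < e" using e by (simp add: field_simps)
  define s where "s = \<lfloor>fst z * 4 ^ n1\<rfloor>"
  have s: "of_int s / 4 ^ n1 < fst z" "fst z < (of_int s + 1) / 4 ^ n1"
  proof -
    have "fst z \<noteq> of_int s / 4 ^ n1" using z unfolding adic_def by blast
    moreover have "of_int s / 4 ^ n1 \<le> fst z" "fst z < (of_int s + 1) / 4 ^ n1"
      unfolding s_def by (rule floor_bounds; simp)+
    ultimately show "of_int s / 4 ^ n1 < fst z" "fst z < (of_int s + 1) / 4 ^ n1" by simp_all
  qed
  define \<theta> where "\<theta> = min (fst z - of_int s / 4 ^ n1) ((of_int s + 1) / 4 ^ n1 - fst z)"
  have \<theta>: "\<theta> > 0" using s by (simp add: \<theta>_def)
  obtain n2 where "1 / \<theta> < 4 ^ n2" using real_arch_pow[of 4 "1 / \<theta>"] by auto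
  hence n2: "1 / 4 ^ n2 < \<theta>" using \<theta> by (simp add: field_simps)
  show ?thesis
  proof (intro exI[of _ "max n1 n2"] allI impI)
    fix n c w assume n: "n \<ge> max n1 n2" and "adj n (fl n z) c" and w: "w \<in> ccell n c"
    then obtain z1 z2 where z12: "z1 \<in> ccell n (fl n z)" "z2 \<in> ccell n c" "(z1, z2) \<in> Rinf L"
      unfolding adj_def by blast
    have p1: "1 / 4 ^ n \<le> (1::real) / 4 ^ n1" "1 / 4 ^ n \<le> (1::real) / 4 ^ n2"
      using n by (auto intro!: divide_left_mono power_increasing)
    have MM: "1 / M ^ k \<le> 1 / 4 ^ k" for k
      using M_ge by (intro divide_left_mono power_mono) auto
    have zc: "z \<in> ccell n (fl n z)" using tile_subset_ccell[of n "fl n z"] by (auto simp: tile_def)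
    have diam: "\<bar>fst u - fst v\<bar> \<le> 1 / 4 ^ n \<and> \<bar>snd u - snd v\<bar> \<le> 1 / M ^ n" if "u \<in> ccell n c" "v \<in> ccell n c" for u v c
      using that unfolding cell_nat by (cases u; cases v) (auto simp: add_divide_distrib)
    have f: "\<bar>fst z1 - fst z\<bar> \<le> 1 / 4 ^ n" "\<bar>snd z1 - snd z\<bar> \<le> 1 / M ^ n"
      "\<bar>fst w - fst z2\<bar> \<le> 1 / 4 ^ n" "\<bar>snd w - snd z2\<bar> \<le> 1 / M ^ n"
      using diam[OF z12(1) zc] diam[OF w z12(2)] by auto
    have "fst z1 = fst z2" using Rinf_fst[OF z12(3)] .
    have v: "\<bar>snd z2 - snd z1\<bar> \<le> 2 / 4 ^ n1"
    proof (cases "z1 = z2")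
      case False
      then obtain m N t where w: "window z1 z2 m N t" using Rinf_window[OF z12(3)] by blast
      have "\<not> m \<le> int n1"
      proof
        assume "m \<le> int n1"
        define k where "k = nat (int n1 - m)"
        have m: "- m = int k - int n1" using \<open>m \<le> int n1\<close> by (simp add: k_def)
        have "fst z1 = of_int (N * 4 ^ k) / 4 ^ n1"
          using w unfolding window_def m by (simp add: power_int_diff)
        moreover have "N * 4 ^ k \<le> s \<or> s + 1 \<le> N * 4 ^ k" by linarith
        hence "real_of_int (N * 4 ^ k) \<le> of_int s \<or> of_int s + 1 \<le> real_of_int (N * 4 ^ k)" by linarith
        hence "real_of_int (N * 4 ^ k) / 4 ^ n1 \<le> of_int s / 4 ^ n1 \<or> (of_int s + 1) / 4 ^ n1 \<le> real_of_int (N * 4 ^ k) / 4 ^ n1"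
          by (auto intro: divide_right_mono)
        ultimately show False using f(1) n2 p1 unfolding \<theta>_def by linarith
      qed
      hence "M powi (- m) \<le> 1 / M ^ n1" using powi_le_nat[of n1 m] by simp
      thus ?thesis using window_diff(1)[OF w] MM[of n1] by linarith
    qed simp
    have "1 / M ^ n \<le> 1 / 4 ^ n1" using MM[of n] p1 by linarith
    hence "\<bar>snd w - snd z\<bar> \<le> 4 * (1 / 4 ^ n1)" using f v by linarith
    moreover have "\<bar>fst w - fst z\<bar> \<le> 2 * (1 / 4 ^ n1)" using f p1 \<open>fst z1 = fst z2\<close> by linarith
    ultimately show "\<bar>fst w - fst z\<bar> < e \<and> \<bar>snd w - snd z\<bar> < e" using n1 by auto
  qed
qed

text \<open>Levels are bounded below by 0, so every heavy tile has a topmost heavy ancestor, and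
  topmost tiles are disjoint. A point adjacent to a heavy tile is in a tile adjacent to that
  ancestor; covering all tiles adjacent to topmost ones costs the factor 150.\<close>

lemma weak_type_maximal:
  assumes D: "D \<in> sets borel" and lam: "\<eta> > 0"
  shows "\<exists>T\<in>sets borel. emeasure lborel T \<le> ennreal (150 / \<eta>) * emeasure lborel D \<and>
    {z. \<exists>n c. adj n (fl n z) c \<and> ennreal (\<eta> / (4 ^ n * M ^ n)) < emeasure lborel (D \<inter> tile n c)} \<subseteq> T"
proof -
  define heavy where "heavy n c \<longleftrightarrow> ennreal (\<eta> / (4 ^ n * M ^ n)) < emeasure lborel (D \<inter> tile n c)" for n c
  define topmost where "topmost n c \<longleftrightarrow> heavy n c \<and> (\<forall>m<n. \<forall>z\<in>tile n c. \<not> heavy m (fl m z))" for n c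
  define lv where "lv k = fst (from_nat k :: nat \<times> int \<times> int)" for k
  define ix where "ix k = snd (from_nat k :: nat \<times> int \<times> int)" for k
  \<comment> \<open>Tiles are enumerated by natural numbers; keeping only the canonical codes
    prevents one tile from being counted twice.\<close>
  define I where "I = {k. to_nat (from_nat k :: nat \<times> int \<times> int) = k \<and> topmost (lv k) (ix k)}"
  define A where "A k = (if k \<in> I then \<Union>c\<in>{c. adj (lv k) (ix k) c}. tile (lv k) c else {})" for k
  define B where "B k = (if k \<in> I then D \<inter> tile (lv k) (ix k) else {})" for k
  have topI: "topmost (lv k) (ix k)" if "k \<in> I" for k using that by (simp add: I_def)
  have A_sets: "A k \<in> sets borel" for k
    unfolding A_def by (cases "k \<in> I"; simp only: if_True if_False) (rule sets.finite_UN[OF finite_adj tile_sets], rule sets.empty_sets)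
  have B_sets: "B k \<in> sets borel" for k using D by (auto simp: B_def)
  have AB: "emeasure lborel (A k) \<le> ennreal (150 / \<eta>) * emeasure lborel (B k)" for k
  proof (cases "k \<in> I")
    case True
    let ?S = "{c. adj (lv k) (ix k) c}"
    have "emeasure lborel (A k) \<le> (\<Sum>c\<in>?S. emeasure lborel (tile (lv k) c))"
      unfolding A_def if_P[OF True] by (rule emeasure_subadditive_finite[OF finite_adj]) auto
    also have "\<dots> = of_nat (card ?S) * ennreal (1 / (4 ^ lv k * M ^ lv k))" by (simp add: emeasure_tile)
    also have "\<dots> \<le> of_nat 150 * ennreal (1 / (4 ^ lv k * M ^ lv k))"
      using card_adj_le by (intro mult_right_mono of_nat_mono) auto
    also have "\<dots> = ennreal 150 * ennreal (1 / (4 ^ lv k * M ^ lv k))" by simp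
    also have "\<dots> = ennreal (150 * (1 / (4 ^ lv k * M ^ lv k)))"
      by (rule ennreal_mult[symmetric]) (auto intro!: mult_nonneg_nonneg zero_le_power less_imp_le[OF M_pos(1)])
    also have "150 * (1 / (4 ^ lv k * M ^ lv k)) = (150 / \<eta>) * (\<eta> / (4 ^ lv k * M ^ lv k))" using lam by simp
    also have "ennreal \<dots> = ennreal (150 / \<eta>) * ennreal (\<eta> / (4 ^ lv k * M ^ lv k))"
      using lam by (intro ennreal_mult) (auto intro!: divide_nonneg_nonneg mult_nonneg_nonneg zero_le_power less_imp_le[OF M_pos(1)])
    also have "\<dots> \<le> ennreal (150 / \<eta>) * emeasure lborel (B k)"
      using topI[OF True] True unfolding topmost_def heavy_def B_def by (intro mult_left_mono) auto
    finally show ?thesis .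
  qed (simp add: A_def)
  have disj: "disjoint_family B"
    unfolding disjoint_family_on_def
  proof (intro ballI impI)
    fix j k :: nat assume "j \<noteq> k"
    show "B j \<inter> B k = {}"
    proof (rule ccontr)
      assume "B j \<inter> B k \<noteq> {}"
      then obtain z where z: "z \<in> tile (lv j) (ix j)" "z \<in> tile (lv k) (ix k)" and jk: "j \<in> I" "k \<in> I"
        by (auto simp: B_def split: if_splits)
      have f: "fl (lv j) z = ix j" "fl (lv k) z = ix k" using z by (auto simp: tile_def)
      have "\<not> lv j < lv k" if "topmost (lv j) (ix j)" "topmost (lv k) (ix k)" "z \<in> tile (lv k) (ix k)" "fl (lv j) z = ix j" for j k
      proof
        assume "lv j < lv k"
        hence "\<not> heavy (lv j) (fl (lv j) z)" using that(2,3) unfolding topmost_def by blast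
        thus False using that(1,4) unfolding topmost_def by simp
      qed
      from this[of j k] this[of k j] have lv: "lv j = lv k"
        using topI[OF jk(1)] topI[OF jk(2)] z f by simp
      hence "ix j = ix k" using f by simp
      with lv have "(from_nat j :: nat \<times> int \<times> int) = from_nat k"
        unfolding lv_def ix_def by (rule prod_eqI)
      hence "to_nat (from_nat j :: nat \<times> int \<times> int) = to_nat (from_nat k :: nat \<times> int \<times> int)" by simp
      moreover have "to_nat (from_nat j :: nat \<times> int \<times> int) = j" "to_nat (from_nat k :: nat \<times> int \<times> int) = k"
        using jk by (simp_all add: I_def)
      ultimately show False using \<open>j \<noteq> k\<close> by simp
    qed
  qed
  have sumA: "emeasure lborel (\<Union>k. A k) \<le> (\<Sum>k. emeasure lborel (A k))"
    using A_sets by (intro emeasure_subadditive_countably) auto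
  also have "\<dots> \<le> (\<Sum>k. ennreal (150 / \<eta>) * emeasure lborel (B k))" by (intro suminf_le AB) auto
  also have "\<dots> = ennreal (150 / \<eta>) * (\<Sum>k. emeasure lborel (B k))" by simp
  also have "(\<Sum>k. emeasure lborel (B k)) = emeasure lborel (\<Union>k. B k)"
    using B_sets disj by (intro suminf_emeasure) auto
  also have "\<dots> \<le> emeasure lborel D" using D by (intro emeasure_mono) (auto simp: B_def)
  finally have le: "emeasure lborel (\<Union>k. A k) \<le> ennreal (150 / \<eta>) * emeasure lborel D"
    by (simp add: mult_left_mono)
  have cover: "z \<in> (\<Union>k. A k)" if "adj n (fl n z) c" "heavy n c" for z n c
  proof -
    \<comment> \<open>A point of the tile stands for it, so that its ancestors are the
      \<open>fl m w\<close>.\<close>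
    define w where "w = vertex n (fst c) (snd c)"
    have w: "fl n w = c" using vertex_in_tile[of n c] by (simp add: w_def tile_def)
    define m where "m = (LEAST m. heavy m (fl m w))"
    have hm: "heavy m (fl m w)" 
      unfolding m_def by (rule LeastI[where P = "\<lambda>m. heavy m (fl m w)" and k = n]) (simp add: w that(2))
    have mn: "m \<le> n" 
      unfolding m_def by (rule Least_le[where P = "\<lambda>m. heavy m (fl m w)"]) (simp add: w that(2))
    have "topmost m (fl m w)"
      unfolding topmost_def
    proof (intro conjI hm allI impI ballI)
      fix m' v assume "m' < m" "v \<in> tile m (fl m w)"
      hence "fl m' v = fl m' w" using fl_mono[of m' m v w] by (simp add: tile_def)
      moreover have "\<not> heavy m' (fl m' w)"
        using not_less_Least[of m' "\<lambda>m. heavy m (fl m w)"] \<open>m' < m\<close> unfolding m_def .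
      ultimately show "\<not> heavy m' (fl m' v)" by simp
    qed
    hence k: "to_nat (m, fl m w) \<in> I" "lv (to_nat (m, fl m w)) = m" "ix (to_nat (m, fl m w)) = fl m w"
      by (auto simp: I_def lv_def ix_def)
    have "adj m (fl m w) (fl m z)" using adj_mono[OF mn, of z w] that(1) w adj_sym by auto
    hence "z \<in> A (to_nat (m, fl m w))" unfolding A_def using k by (auto simp: tile_def)
    thus ?thesis by blast
  qed
  show ?thesis
    using le cover A_sets unfolding heavy_def by (intro bexI[of _ "\<Union>k. A k"]) blast+
qed

lemma null_line: "{z. fst z = c} \<in> null_sets (lborel :: (real \<times> real) measure)"
proof -
  have "{z. fst z = c} = {c} \<times> (UNIV :: real set)" by auto
  moreover have "emeasure lborel ({c} \<times> (UNIV :: real set)) = emeasure lborel {c} * emeasure lborel (UNIV :: real set)"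
    unfolding lborel_prod[symmetric] by (rule lborel.emeasure_pair_measure_Times) auto
  moreover have "{c} \<times> (UNIV :: real set) \<in> sets lborel" unfolding lborel_prod[symmetric] by auto
  ultimately show ?thesis by auto
qed

lemma countable_adic: "countable {x. adic x}"
proof -
  have "{x. adic x} = (\<lambda>(n, a). of_int a / 4 ^ n) ` (UNIV :: (nat \<times> int) set)" by (auto simp: adic_def)
  thus ?thesis by simp
qed

lemma null_adic: "{z. adic (fst z)} \<in> null_sets (lborel :: (real \<times> real) measure)"
proof -
  have "{z :: real \<times> real. adic (fst z)} = (\<Union>c\<in>{x. adic x}. {z. fst z = c})" by auto
  thus ?thesis using countable_adic null_line by (auto intro!: null_sets_UN')
qed

text \<open>The maximal inequality is applied to the excess of an open \<open>U\<close> over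
  \<open>E\<close>. Adjacent cells shrink to \<open>z\<close>, hence eventually lie in
  \<open>U\<close>, where the complement of \<open>E\<close> is this excess. The measure
  \<open>e * \<epsilon> / 150\<close> cancels the factor \<open>150 / \<epsilon>\<close>.\<close>

lemma density_eps:
  assumes E: "E \<in> sets borel" and eps: "\<epsilon> > 0"
  shows "AE z in lborel. z \<in> E \<longrightarrow> (\<exists>n0. \<forall>n\<ge>n0. \<forall>c. adj n (fl n z) c \<longrightarrow>
     emeasure lborel (tile n c - E) \<le> ennreal (\<epsilon> / (4 ^ n * M ^ n)))"
proof -
  have "AE z in lborel. adic (fst z) \<or> (z \<in> E \<longrightarrow> (\<exists>n0. \<forall>n\<ge>n0. \<forall>c. adj n (fl n z) c \<longrightarrow>
     emeasure lborel (tile n c - E) \<le> ennreal (\<epsilon> / (4 ^ n * M ^ n))))"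
  proof (rule AE_if_small_covers)
    fix e :: real assume e: "e > 0"
    define e' where "e' = e * \<epsilon> / 150"
    have e': "e' > 0" using e eps by (simp add: e'_def)
    obtain U where U: "open U" "E \<subseteq> U" "emeasure lborel (U - E) < ennreal e'"
      using outer_regular_lborel[OF E e'] by blast
    have D: "U - E \<in> sets borel" using U E by auto
    obtain T where T: "T \<in> sets borel" "emeasure lborel T \<le> ennreal (150 / \<epsilon>) * emeasure lborel (U - E)"
      "{z. \<exists>n c. adj n (fl n z) c \<and> ennreal (\<epsilon> / (4 ^ n * M ^ n)) < emeasure lborel ((U - E) \<inter> tile n c)} \<subseteq> T"
      using weak_type_maximal[OF D eps] by blast
    have "ennreal (150 / \<epsilon>) * emeasure lborel (U - E) \<le> ennreal (150 / \<epsilon>) * ennreal e'"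
      using U(3) by (intro mult_left_mono) auto
    also have "\<dots> = ennreal e" using eps e e' by (simp add: ennreal_mult[symmetric] e'_def)
    finally have "emeasure lborel T \<le> ennreal e" using T(2) by order
    moreover have "z \<in> T" if z: "\<not> adic (fst z)" "z \<in> E"
      and bad: "\<And>n0. \<exists>n\<ge>n0. \<exists>c. adj n (fl n z) c \<and> \<not> emeasure lborel (tile n c - E) \<le> ennreal (\<epsilon> / (4 ^ n * M ^ n))" for z
    proof -
      obtain r where r: "r > 0" "\<And>w. dist w z < r \<Longrightarrow> w \<in> U" using U z(2) unfolding open_dist by blast
      obtain n0 where n0: "\<And>n c w. n \<ge> n0 \<Longrightarrow> adj n (fl n z) c \<Longrightarrow> w \<in> ccell n c \<Longrightarrow> \<bar>fst w - fst z\<bar> < r / 2 \<and> \<bar>snd w - snd z\<bar> < r / 2"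
        using adj_shrinks[OF z(1) half_gt_zero[OF r(1)]] by blast
      obtain n c where n: "n \<ge> n0" "adj n (fl n z) c" "\<not> emeasure lborel (tile n c - E) \<le> ennreal (\<epsilon> / (4 ^ n * M ^ n))"
        using bad by blast
      have "tile n c \<subseteq> U"
      proof
        fix w assume "w \<in> tile n c"
        hence "\<bar>fst w - fst z\<bar> < r / 2" "\<bar>snd w - snd z\<bar> < r / 2" using n0[OF n(1,2)] tile_subset_ccell by blast+
        moreover have "dist w z \<le> \<bar>fst w - fst z\<bar> + \<bar>snd w - snd z\<bar>"
          unfolding dist_prod_def dist_real_def by (rule order_trans[OF sqrt_sum_squares_le_sum_abs]) simp
        ultimately show "w \<in> U" by (intro r(2)) linarith
      qed
      hence "tile n c - E = (U - E) \<inter> tile n c" by blast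
      hence "\<exists>n c. adj n (fl n z) c \<and> ennreal (\<epsilon> / (4 ^ n * M ^ n)) < emeasure lborel ((U - E) \<inter> tile n c)"
        using n by (metis not_le)
      thus ?thesis using T(3) by blast
    qed
    ultimately show "\<exists>T\<in>sets borel. emeasure lborel T \<le> ennreal e \<and>
      {z. \<not> (adic (fst z) \<or> (z \<in> E \<longrightarrow> (\<exists>n0. \<forall>n\<ge>n0. \<forall>c. adj n (fl n z) c \<longrightarrow>
       emeasure lborel (tile n c - E) \<le> ennreal (\<epsilon> / (4 ^ n * M ^ n)))))} \<subseteq> T"
      using T(1) by (intro bexI[of _ T]) blast+
  qed
  moreover have "AE z in lborel. \<not> adic (fst (z :: real \<times> real))" using null_adic by (rule AE_I') auto
  ultimately show ?thesis by eventually_elim blast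
qed

section \<open>Oscillation on a cell and differentiability\<close>

lemma in_ccell_fl: "z \<in> ccell n (fl n z)"
  using in_cell_floor by (simp add: fl_def)

definition tile_var :: "(real \<times> real \<Rightarrow> real) \<Rightarrow> real \<Rightarrow> nat \<Rightarrow> int \<times> int \<Rightarrow> ennreal" where
  "tile_var h a n c = (\<integral>\<^sup>+ z. ennreal \<bar>h z - a\<bar> * indicator (tile n c) z \<partial>lborel)"

lemma Mpow: "M ^ n > 0" "real (nat (Mi ^ n)) = M ^ n"
  using Mi_pos by (simp_all add: M_eq of_nat_nat)

definition mesh_ok :: "real set \<Rightarrow> (real \<times> real \<Rightarrow> real) \<Rightarrow> (real \<times> real \<Rightarrow> real) \<Rightarrow> real \<Rightarrow> bool" where
  "mesh_ok Q F h y \<longleftrightarrow> (\<forall>s\<in>Q. \<forall>t\<in>Q. s < t \<longrightarrow> (\<forall>a. ennreal \<bar>F (t, y) - F (s, y) - a * (t - s)\<bar>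
        \<le> (\<integral>\<^sup>+ u. ennreal \<bar>h (u, y) - a\<bar> * indicator {s<..<t} u \<partial>lborel)))"

text \<open>By averaging there is a height such that its translates by all multiples of \<open>1 / M ^ (n + k)\<close> in the cell
  are simultaneously good. Bad heights are excluded by giving them infinite weight.\<close>

lemma good_height:
  assumes h[measurable]: "h \<in> borel_measurable borel"
    and ok: "AE y in lborel. mesh_ok Q F h y"
    and var: "tile_var h a n (A, B) \<le> ennreal (\<delta> / (4 ^ n * M ^ n))" and \<delta>: "\<delta> > 0"
  shows "\<exists>y w. 0 \<le> y \<and> y < 1 / M ^ (n + k) \<and> (\<Sum>j<nat (Mi ^ k). w j) \<le> 2 * \<delta> * M ^ k / 4 ^ n \<and>
     (\<forall>j<nat (Mi ^ k). 0 \<le> w j \<and> (\<forall>s\<in>Q. \<forall>t\<in>Q. of_int A / 4 ^ n \<le> s \<longrightarrow> s < t \<longrightarrow> t \<le> (of_int A + 1) / 4 ^ n \<longrightarrow>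
        \<bar>F (t, of_int B / M ^ n + real j / M ^ (n + k) + y) - F (s, of_int B / M ^ n + real j / M ^ (n + k) + y) - a * (t - s)\<bar> \<le> w j))"
proof -
  define K where "K = nat (Mi ^ k)"
  have K: "real K = M ^ k" unfolding K_def by (rule Mpow)
  have Kp: "K > 0" using K Mpow(1)[of k] by (metis of_nat_0_less_iff)
  define \<rho> where "\<rho> = 1 / M ^ (n + k)"
  have \<rho>: "\<rho> > 0" unfolding \<rho>_def using Mpow(1) by simp
  have K\<rho>: "real K * \<rho> = 1 / M ^ n" unfolding K \<rho>_def by (simp add: power_add)
  define x0 where "x0 = of_int A / (4::real) ^ n"
  define x1 where "x1 = (of_int A + 1) / (4::real) ^ n"
  define y0 where "y0 = of_int B / M ^ n"
  obtain N where N: "\<And>y. y \<in> space lborel - N \<Longrightarrow> mesh_ok Q F h y" "N \<in> null_sets lborel"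
    by (rule AE_E3[OF ok]) blast
  have [measurable]: "N \<in> sets borel" using N(2) by auto
  define V where "V y = (\<integral>\<^sup>+ u. ennreal \<bar>h (u, y) - a\<bar> * indicator {x0<..<x1} u \<partial>lborel)" for y
  have V_meas [measurable]: "V \<in> borel_measurable borel"
  proof -
    have "(\<lambda>(y, u). ennreal \<bar>h (u, y) - a\<bar> * indicator {x0<..<x1} u) \<in> borel_measurable (borel \<Otimes>\<^sub>M lborel)"
      by (simp add: borel_prod split_beta' cong: measurable_cong_sets)
    from lborel.borel_measurable_nn_integral[OF this] show ?thesis by (simp add: V_def[abs_def])
  qed
  define W where "W y = V y + \<infinity> * indicator N y" for y
  have W_meas [measurable]: "W \<in> borel_measurable borel" unfolding W_def by measurable
  define J where "J j = {y0 + real j * \<rho> ..< y0 + real j * \<rho> + \<rho>}" for j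
  have shift: "(\<integral>\<^sup>+ y. W (y0 + real j * \<rho> + y) * indicator {0..<\<rho>} y \<partial>lborel) = (\<integral>\<^sup>+ y. W y * indicator (J j) y \<partial>lborel)" for j
  proof -
    have JS: "J j \<in> sets borel" by (simp add: J_def)
    have "(\<integral>\<^sup>+ y. W y * indicator (J j) y \<partial>lborel) = ennreal \<bar>1\<bar> * (\<integral>\<^sup>+ y. W ((y0 + real j * \<rho>) + 1 * y) * indicator (J j) ((y0 + real j * \<rho>) + 1 * y) \<partial>lborel)"
      by (rule nn_integral_real_affine[OF borel_measurable_times_ennreal[OF W_meas borel_measurable_indicator[OF JS]]]) simp
    also have "\<dots> = (\<integral>\<^sup>+ y. W (y0 + real j * \<rho> + y) * indicator {0..<\<rho>} y \<partial>lborel)"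
      by (auto intro!: nn_integral_cong simp: J_def split: split_indicator)
    finally show ?thesis ..
  qed
  have disj: "disjoint_family_on J {..<K}"
    unfolding disjoint_family_on_def
  proof (intro ballI impI)
    fix i j :: nat assume "i \<noteq> j"
    show "J i \<inter> J j = {}"
    proof (rule ccontr)
      assume "J i \<inter> J j \<noteq> {}"
      then obtain y where "y \<in> J i" "y \<in> J j" by blast
      hence "real i * \<rho> < (real j + 1) * \<rho>" "real j * \<rho> < (real i + 1) * \<rho>"
        by (auto simp: J_def distrib_right)
      hence "real i < real j + 1" "real j < real i + 1" using \<rho> by (simp_all only: mult_less_cancel_right_pos)
      thus False using \<open>i \<noteq> j\<close> by linarith
    qed
  qed
  have JU: "(\<Union>j<K. J j) \<subseteq> {y0..<y0 + 1 / M ^ n}"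
  proof
    fix y assume "y \<in> (\<Union>j<K. J j)"
    then obtain j where j: "j < K" "y \<in> J j" by blast
    have "0 \<le> real j * \<rho>" using \<rho> by simp
    moreover have "(real j + 1) * \<rho> \<le> real K * \<rho>" using j(1) \<rho> by (intro mult_right_mono) auto
    moreover have "y0 + real j * \<rho> \<le> y" "y < y0 + real j * \<rho> + \<rho>" using j(2) by (simp_all add: J_def)
    moreover have "(real j + 1) * \<rho> = real j * \<rho> + \<rho>" by (simp add: distrib_right)
    ultimately show "y \<in> {y0..<y0 + 1 / M ^ n}" unfolding K\<rho>[symmetric] atLeastLessThan_iff by linarith
  qed
  have "(\<integral>\<^sup>+ y. (\<Sum>j<K. W (y0 + real j * \<rho> + y)) * indicator {0..<\<rho>} y \<partial>lborel)
      = (\<Sum>j<K. \<integral>\<^sup>+ y. W (y0 + real j * \<rho> + y) * indicator {0..<\<rho>} y \<partial>lborel)"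
    unfolding sum_distrib_right by (rule nn_integral_sum) measurable
  also have "\<dots> = (\<Sum>j<K. \<integral>\<^sup>+ y. W y * indicator (J j) y \<partial>lborel)" unfolding shift ..
  also have "\<dots> = (\<integral>\<^sup>+ y. (\<Sum>j<K. W y * indicator (J j) y) \<partial>lborel)"
    by (rule nn_integral_sum[symmetric]) (simp add: J_def)
  also have "\<dots> = (\<integral>\<^sup>+ y. W y * indicator (\<Union>j<K. J j) y \<partial>lborel)"
    unfolding sum_distrib_left[symmetric] by (simp add: indicator_UN_disjoint[OF finite_lessThan disj])
  also have "\<dots> \<le> (\<integral>\<^sup>+ y. W y * indicator {y0..<y0 + 1 / M ^ n} y \<partial>lborel)"
    using JU by (intro nn_integral_mono mult_left_mono) (auto split: split_indicator)
  also have "\<dots> = (\<integral>\<^sup>+ y. V y * indicator {y0..<y0 + 1 / M ^ n} y \<partial>lborel)"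
    using AE_not_in[OF N(2)] by (intro nn_integral_cong_AE) (auto simp: W_def elim!: eventually_mono)
  also have "\<dots> \<le> (\<integral>\<^sup>+ y. (\<integral>\<^sup>+ u. ennreal \<bar>h (u, y) - a\<bar> * indicator (tile n (A, B)) (u, y) \<partial>lborel) \<partial>lborel)"
  proof (rule nn_integral_mono)
    fix y
    have [measurable]: "(\<lambda>u. h (u, y)) \<in> borel_measurable borel"
      by (rule measurable_compose[OF _ h]) (simp add: borel_prod[symmetric])
    have "V y * indicator {y0..<y0 + 1 / M ^ n} y = (\<integral>\<^sup>+ u. ennreal \<bar>h (u, y) - a\<bar> * indicator {x0<..<x1} u * indicator {y0..<y0 + 1 / M ^ n} y \<partial>lborel)"
      unfolding V_def
      by (rule nn_integral_multc[symmetric]) measurable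
    also have "\<dots> \<le> (\<integral>\<^sup>+ u. ennreal \<bar>h (u, y) - a\<bar> * indicator (tile n (A, B)) (u, y) \<partial>lborel)"
      by (intro nn_integral_mono) (auto simp: tile_eq x0_def x1_def y0_def add_divide_distrib split: split_indicator)
    finally show "V y * indicator {y0..<y0 + 1 / M ^ n} y \<le> (\<integral>\<^sup>+ u. ennreal \<bar>h (u, y) - a\<bar> * indicator (tile n (A, B)) (u, y) \<partial>lborel)" .
  qed
  also have "\<dots> = tile_var h a n (A, B)"
  proof -
    have "(\<lambda>z. ennreal \<bar>h z - a\<bar> * indicator (tile n (A, B)) z) \<in> borel_measurable (lborel \<Otimes>\<^sub>M lborel)"
      unfolding lborel_prod by measurable
    from lborel_pair.nn_integral_snd[OF this] show ?thesis unfolding tile_var_def lborel_prod by simp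
  qed
  also note var
  finally have total: "(\<integral>\<^sup>+ y. (\<Sum>j<K. W (y0 + real j * \<rho> + y)) * indicator {0..<\<rho>} y \<partial>lborel) \<le> ennreal (\<delta> / (4 ^ n * M ^ n))" .
  \<comment> \<open>Twice the bound on the mean over \<open>{0..<\<rho>}\<close>; if every height
    exceeded it, the integral would be too large.\<close>
  define c where "c = 2 * \<delta> * M ^ k / 4 ^ n"
  have c: "c > 0" unfolding c_def using \<delta> Mpow(1)[of k] by simp
  have "\<exists>y. 0 \<le> y \<and> y < \<rho> \<and> (\<Sum>j<K. W (y0 + real j * \<rho> + y)) \<le> ennreal c"
  proof (rule ccontr)
    assume "\<not> ?thesis"
    hence no: "ennreal c \<le> (\<Sum>j<K. W (y0 + real j * \<rho> + y))" if "0 \<le> y" "y < \<rho>" for y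
      using that by (meson less_imp_le not_le)
    have "ennreal (c * \<rho>) = (\<integral>\<^sup>+ y. ennreal c * indicator {0..<\<rho>} y \<partial>lborel)"
      using c \<rho> by (simp add: nn_integral_cmult_indicator ennreal_mult)
    also have "\<dots> \<le> (\<integral>\<^sup>+ y. (\<Sum>j<K. W (y0 + real j * \<rho> + y)) * indicator {0..<\<rho>} y \<partial>lborel)"
      using no by (intro nn_integral_mono) (auto split: split_indicator)
    also note total
    finally have "c * \<rho> \<le> \<delta> / (4 ^ n * M ^ n)" using \<delta> Mpow(1)[of n] by (simp add: ennreal_le_iff)
    moreover have "c * \<rho> = 2 * (\<delta> / (4 ^ n * M ^ n))" unfolding c_def \<rho>_def by (simp add: power_add)
    moreover have "\<delta> / (4 ^ n * M ^ n) > 0" using \<delta> Mpow(1)[of n] by simp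
    ultimately show False by linarith
  qed
  then obtain y where y: "0 \<le> y" "y < \<rho>" "(\<Sum>j<K. W (y0 + real j * \<rho> + y)) \<le> ennreal c" by blast
  define w where "w j = enn2real (W (y0 + real j * \<rho> + y))" for j
  have fin: "W (y0 + real j * \<rho> + y) = ennreal (w j)" if "j < K" for j
  proof -
    have "W (y0 + real j * \<rho> + y) \<le> (\<Sum>j<K. W (y0 + real j * \<rho> + y))"
      using that by (intro member_le_sum) auto
    also note y(3)
    finally have "W (y0 + real j * \<rho> + y) < top" using ennreal_less_top by (rule le_less_trans)
    thus ?thesis by (simp add: w_def)
  qed
  have "(\<Sum>j<K. W (y0 + real j * \<rho> + y)) = (\<Sum>j<K. ennreal (w j))"
    by (rule sum.cong[OF refl]) (simp only: lessThan_iff fin)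
  also have "\<dots> = ennreal (\<Sum>j<K. w j)" by (rule sum_ennreal) (simp add: w_def)
  finally have "ennreal (\<Sum>j<K. w j) \<le> ennreal c" using y(3) by simp
  hence sum: "(\<Sum>j<K. w j) \<le> c" using c by (simp add: ennreal_le_iff)
  show ?thesis
  proof (intro exI[of _ y] exI[of _ w] conjI allI impI ballI)
    show "0 \<le> y" "y < 1 / M ^ (n + k)" using y by (simp_all add: \<rho>_def)
    show "(\<Sum>j<nat (Mi ^ k). w j) \<le> 2 * \<delta> * M ^ k / 4 ^ n" using sum by (simp add: K_def c_def)
    fix j assume j: "j < nat (Mi ^ k)"
    hence jK: "j < K" by (simp add: K_def)
    show "0 \<le> w j" by (simp add: w_def)
    fix s t assume st: "s \<in> Q" "t \<in> Q" "of_int A / 4 ^ n \<le> s" "s < t" "t \<le> (of_int A + 1) / 4 ^ n"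
    define v where "v = y0 + real j * \<rho> + y"
    have Wv: "W v = ennreal (w j)" using fin[OF jK] by (simp add: v_def)
    hence vN: "v \<notin> N" by (auto simp: W_def)
    hence "mesh_ok Q F h v" using N(1) by simp
    hence "ennreal \<bar>F (t, v) - F (s, v) - a * (t - s)\<bar> \<le> (\<integral>\<^sup>+ u. ennreal \<bar>h (u, v) - a\<bar> * indicator {s<..<t} u \<partial>lborel)"
      unfolding mesh_ok_def using st by blast
    also have "\<dots> \<le> V v" unfolding V_def
      using st by (intro nn_integral_mono mult_left_mono) (auto simp: x0_def x1_def split: split_indicator)
    also have "V v = ennreal (w j)" using Wv vN by (simp add: W_def)
    finally have "\<bar>F (t, v) - F (s, v) - a * (t - s)\<bar> \<le> w j" by (simp add: ennreal_le_iff w_def)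
    moreover have "v = of_int B / M ^ n + real j / M ^ (n + k) + y" by (simp add: v_def y0_def \<rho>_def)
    ultimately show "\<bar>F (t, of_int B / M ^ n + real j / M ^ (n + k) + y) - F (s, of_int B / M ^ n + real j / M ^ (n + k) + y) - a * (t - s)\<bar> \<le> w j"
      by simp
  qed
qed

lemma adic_frac: "adic (of_int a / 4 ^ n)"
  unfolding adic_def by blast

text \<open>Along the good heights \<open>F - a x\<close> is almost constant, and a vertical line glues each of them to the
  next one for free. Every point of the cell is within one cell of level \<open>n + k\<close> of a good height.\<close>

lemma cell_oscillation:
  assumes h: "h \<in> borel_measurable borel"
    and ok: "AE y in lborel. mesh_ok {x. adic x} F h y"
    and inv: "\<And>p q. (p, q) \<in> Rinf L \<Longrightarrow> F p = F q"
    and osc: "\<And>n a b z w. z \<in> cell L (int n) a b \<Longrightarrow> w \<in> cell L (int n) a b \<Longrightarrow> \<bar>F z - F w\<bar> \<le> C / 4 ^ n"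
    and var: "tile_var h a n (A, B) \<le> ennreal (\<delta> / (4 ^ n * M ^ n))" and \<delta>: "\<delta> > 0" and k: "k \<ge> 1"
    and z: "z \<in> cell L (int n) A B" and w: "w \<in> cell L (int n) A B"
  shows "\<bar>F z - F w - a * (fst z - fst w)\<bar> \<le> (2 * (C + \<bar>a\<bar>) / 4 ^ k + 12 * \<delta> * M ^ k) / 4 ^ n"
proof -
  define K where "K = nat (Mi ^ k)"
  have K: "real K = M ^ k" unfolding K_def by (rule Mpow)
  have Kp: "K \<ge> 1" using K Mpow(1)[of k] by (metis of_nat_0_less_iff Suc_leI One_nat_def)
  obtain y e where y: "0 \<le> y" "y < 1 / M ^ (n + k)" and sum: "(\<Sum>j<K. e j) \<le> 2 * \<delta> * M ^ k / 4 ^ n"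
    and e0: "\<And>j. j < K \<Longrightarrow> 0 \<le> e j"
    and e: "\<And>j s t. j < K \<Longrightarrow> adic s \<Longrightarrow> adic t \<Longrightarrow> of_int A / 4 ^ n \<le> s \<Longrightarrow> s < t \<Longrightarrow> t \<le> (of_int A + 1) / 4 ^ n \<Longrightarrow>
        \<bar>F (t, of_int B / M ^ n + real j / M ^ (n + k) + y) - F (s, of_int B / M ^ n + real j / M ^ (n + k) + y) - a * (t - s)\<bar> \<le> e j"
    using good_height[OF h ok var \<delta>, of k] unfolding K_def mem_Collect_eq by blast
  define c where "c = 2 * \<delta> * M ^ k / 4 ^ n"
  define v where "v j = of_int B / M ^ n + real j / M ^ (n + k) + y" for j
  define G where "G p = F p - a * fst p" for p
  define x0 where "x0 = of_int A / (4::real) ^ n"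
  have hor: "\<bar>G (s, v j) - G (x0, v j)\<bar> \<le> e j"
    if "j < K" "adic s" "x0 \<le> s" "s \<le> (of_int A + 1) / 4 ^ n" for s j
  proof (cases "s = x0")
    case False
    thus ?thesis using e[OF that(1) _ that(2), of x0] that adic_frac unfolding x0_def[symmetric]
      by (auto simp: G_def v_def algebra_simps x0_def)
  qed (use e0 that in auto)
  have v_in: "of_int (B * Mi ^ k + int j) / M ^ (n + k) \<le> v j" "v j \<le> (of_int (B * Mi ^ k + int j) + 1) / M ^ (n + k)" for j
  proof -
    have "of_int (B * Mi ^ k + int j) / M ^ (n + k) = of_int B / M ^ n + real j / M ^ (n + k)"
      by (simp add: add_divide_distrib power_add flip: M_eq)
    thus "of_int (B * Mi ^ k + int j) / M ^ (n + k) \<le> v j" "v j \<le> (of_int (B * Mi ^ k + int j) + 1) / M ^ (n + k)"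
      using y unfolding v_def add_divide_distrib[of _ 1] by linarith+
  qed
  have step: "\<bar>G (x0, v (Suc j)) - G (x0, v j)\<bar> \<le> e j + e (Suc j)" if "Suc j < K" for j
  proof -
    define t where "t = B * Mi ^ k + int j"
    \<comment> \<open>The residue of the lines on which strip \<open>t\<close> is glued to the next.
      The first such line to the right of the left side lies within the cell because
      \<open>k \<ge> 1\<close> gives at least 4 columns.\<close>
    define r where "r = t mod 3 + 1"
    have r: "1 \<le> r" "r \<le> 3" unfolding r_def by presburger+
    define N where "N = A * 4 ^ k + r"
    obtain k' where k': "k = Suc k'" using k by (cases k) auto
    have "N = 4 * (A * 4 ^ k') + r" unfolding N_def k' by simp
    moreover have "(4 * q + r) mod 4 = r" for q using r by presburger
    ultimately have "N mod 4 = r" by simp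
    define s where "s = of_int N / (4::real) ^ (n + k)"
    have "(4::real) ^ 1 \<le> 4 ^ k" using k by (intro power_increasing) auto
    hence k4: "(4::real) \<le> 4 ^ k" by simp
    have s_eq: "s = x0 + of_int r / 4 ^ (n + k)"
      unfolding s_def N_def x0_def by (simp add: add_divide_distrib power_add)
    have "real_of_int r \<le> 4 ^ k" using r(2) k4 by linarith
    hence "of_int r / (4::real) ^ (n + k) \<le> 4 ^ k / 4 ^ (n + k)" by (rule divide_right_mono) simp
    moreover have "(4::real) ^ k / 4 ^ (n + k) = 1 / 4 ^ n" by (simp add: power_add)
    ultimately have "s \<le> (of_int A + 1) / 4 ^ n" unfolding s_eq x0_def add_divide_distrib by linarith
    moreover have "x0 \<le> s" using r(1) by (simp add: s_eq)
    moreover have "adic s" unfolding s_def by (rule adic_frac)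
    ultimately have s: "adic s" "x0 \<le> s" "s \<le> (of_int A + 1) / 4 ^ n" by blast+
    have "glue (s, v j) (s, v (Suc j))"
      unfolding glue_def
    proof (intro exI conjI)
      show "N mod 4 \<noteq> 0" using \<open>N mod 4 = r\<close> r by simp
      show "t mod 3 = N mod 4 - 1" unfolding \<open>N mod 4 = r\<close> r_def by simp
      show "fst (s, v j) = of_int N * 4 powi (- int (n + k))" unfolding powi_nat s_def by simp
      show "of_int t * M powi (- int (n + k)) \<le> snd (s, v j)" "snd (s, v j) \<le> of_int (t + 1) * M powi (- int (n + k))"
        using v_in[of j] unfolding powi_nat t_def by simp_all
      show "snd (s, v (Suc j)) = snd (s, v j) + M powi (- int (n + k))"
        unfolding powi_nat v_def by (simp add: add_divide_distrib)
    qed simp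
    hence "G (s, v j) = G (s, v (Suc j))" using inv[OF glue_in_Rinf] by (simp add: G_def)
    thus ?thesis using hor[of j s] hor[of "Suc j" s] that s by linarith
  qed
  \<comment> \<open>Each step runs out along one height to the gluing line and back along the next,
    so intermediate heights count twice and the last one once.\<close>
  have chain: "\<bar>G (x0, v j) - G (x0, v 0)\<bar> \<le> 2 * (\<Sum>i<Suc j. e i) - e j" if "j < K" for j
    using that
  proof (induction j)
    case 0 thus ?case using e0[of 0] by simp
  next
    case (Suc j)
    thus ?case using step[of j] by simp
  qed
  have chain': "\<bar>G (x0, v j) - G (x0, v 0)\<bar> \<le> 2 * c" if "j < K" for j
  proof -
    have "(\<Sum>i<Suc j. e i) \<le> (\<Sum>i<K. e i)" using that e0 by (intro sum_mono2) auto
    thus ?thesis using chain[OF that] e0[OF that] sum unfolding c_def by linarith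
  qed
  have ec: "e j \<le> c" if "j < K" for j
    using member_le_sum[of j "{..<K}" e] that e0 sum unfolding c_def by force
  \<comment> \<open>The chain costs \<open>2 * c\<close> and the horizontal stretch at its end one
    more \<open>c\<close>. For two points this makes \<open>6 * c\<close>, hence the constant
    12.\<close>
  have near: "\<bar>G z - G (x0, v 0)\<bar> \<le> (C + \<bar>a\<bar>) / 4 ^ (n + k) + 3 * c" if z: "z \<in> cell L (int n) A B" for z
  proof -
    have zb: "of_int A / 4 ^ n \<le> fst z" "fst z \<le> (of_int A + 1) / 4 ^ n" "of_int B / M ^ n \<le> snd z" "snd z \<le> (of_int B + 1) / M ^ n"
      using z unfolding cell_nat by (cases z; auto)+
    have "of_int A * 4 ^ k \<le> fst z * 4 ^ (n + k)" "fst z * 4 ^ (n + k) \<le> (of_int A + 1) * 4 ^ k"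
      using zb by (simp_all add: power_add pos_divide_le_eq pos_le_divide_eq)
    hence "of_int (A * 4 ^ k) \<le> fst z * 4 ^ (n + k)" "fst z * 4 ^ (n + k) \<le> of_int (A * 4 ^ k) + real (4 ^ k)"
      by (simp_all add: distrib_right)
    from unit_subinterval[OF this] obtain i where i: "i < 4 ^ k" "of_int (A * 4 ^ k) + real i \<le> fst z * 4 ^ (n + k)"
        "fst z * 4 ^ (n + k) \<le> of_int (A * 4 ^ k) + real i + 1" by auto
    have "of_int B \<le> snd z * M ^ n" "snd z * M ^ n \<le> of_int B + 1"
      using zb Mpow(1)[of n] by (simp_all add: pos_divide_le_eq pos_le_divide_eq)
    hence "of_int B * M ^ k \<le> snd z * M ^ n * M ^ k" "snd z * M ^ n * M ^ k \<le> (of_int B + 1) * M ^ k"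
      using Mpow(1)[of k] by (auto intro: mult_right_mono)
    hence "of_int (B * Mi ^ k) \<le> snd z * M ^ (n + k)" "snd z * M ^ (n + k) \<le> of_int (B * Mi ^ k) + real K"
      unfolding K by (simp_all add: power_add distrib_right mult.assoc flip: M_eq)
    from unit_subinterval[OF this Kp] obtain j where j: "j < K" "of_int (B * Mi ^ k) + real j \<le> snd z * M ^ (n + k)"
        "snd z * M ^ (n + k) \<le> of_int (B * Mi ^ k) + real j + 1" by auto
    define \<alpha> where "\<alpha> = A * 4 ^ k + int i"
    define \<beta> where "\<beta> = B * Mi ^ k + int j"
    define s where "s = of_int \<alpha> / (4::real) ^ (n + k)"
    have zx: "s \<le> fst z" "fst z \<le> s + 1 / 4 ^ (n + k)"
      using i unfolding s_def \<alpha>_def add_divide_distrib[symmetric] by (simp_all add: pos_divide_le_eq pos_le_divide_eq)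
    have zy: "of_int \<beta> / M ^ (n + k) \<le> snd z" "snd z \<le> (of_int \<beta> + 1) / M ^ (n + k)"
      using j Mpow(1)[of "n + k"] unfolding \<beta>_def by (simp_all add: pos_divide_le_eq pos_le_divide_eq)
    have zc: "z \<in> cell L (int (n + k)) \<alpha> \<beta>"
      using zx zy unfolding cell_nat s_def by (cases z) (auto simp: add_divide_distrib)
    have sc: "(s, v j) \<in> cell L (int (n + k)) \<alpha> \<beta>"
      using v_in[of j] unfolding cell_nat s_def \<beta>_def by (auto simp: divide_right_mono)
    have "\<bar>F z - F (s, v j)\<bar> \<le> C / 4 ^ (n + k)" by (rule osc[OF zc sc])
    moreover have "\<bar>a * (fst z - s)\<bar> \<le> \<bar>a\<bar> * (1 / 4 ^ (n + k))"
      unfolding abs_mult using zx by (intro mult_left_mono) auto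
    ultimately have 1: "\<bar>G z - G (s, v j)\<bar> \<le> (C + \<bar>a\<bar>) / 4 ^ (n + k)"
      unfolding G_def add_divide_distrib by (simp add: right_diff_distrib)
    have s_eq: "s = x0 + real i / 4 ^ (n + k)"
      unfolding s_def \<alpha>_def x0_def by (simp add: add_divide_distrib power_add)
    have "real i \<le> real (4 ^ k)" using i(1) by (simp only: of_nat_le_iff less_imp_le)
    hence "real i \<le> 4 ^ k" by simp
    hence "real i / (4::real) ^ (n + k) \<le> 4 ^ k / 4 ^ (n + k)" by (rule divide_right_mono) simp
    moreover have "(4::real) ^ k / 4 ^ (n + k) = 1 / 4 ^ n" by (simp add: power_add)
    ultimately have "s \<le> (of_int A + 1) / 4 ^ n" unfolding s_eq x0_def add_divide_distrib by linarith
    moreover have "x0 \<le> s" by (simp add: s_eq)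
    ultimately have "\<bar>G (s, v j) - G (x0, v j)\<bar> \<le> e j" using hor[OF j(1)] adic_frac unfolding s_def by blast
    thus ?thesis using 1 ec[OF j(1)] chain'[OF j(1)] by linarith
  qed
  have "\<bar>G z - G w\<bar> \<le> 2 * ((C + \<bar>a\<bar>) / 4 ^ (n + k)) + 6 * c" using near[OF z] near[OF w] by linarith
  also have "\<dots> = (2 * (C + \<bar>a\<bar>) / 4 ^ k + 12 * \<delta> * M ^ k) / 4 ^ n"
    unfolding c_def by (simp add: add_divide_distrib power_add mult_ac)
  also have "G z - G w = F z - F w - a * (fst z - fst w)" by (simp add: G_def algebra_simps)
  finally show ?thesis .
qed

text \<open>Countably many bands \<open>E r s\<close> between rational values produce one null set.
  At a remaining point a narrow band around \<open>h z\<close> has density 1 along adjacent cells: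
  inside it the deviation is small, outside it is at most \<open>2 * C\<close> on a negligible share
  of the tile.\<close>

lemma lebesgue_point:
  assumes h[measurable]: "h \<in> borel_measurable borel" and bd: "\<And>z. \<bar>h z\<bar> \<le> (C::real)"
  shows "AE z in lborel. \<forall>\<delta>>0. \<exists>n0. \<forall>n\<ge>n0. \<forall>c. adj n (fl n z) c \<longrightarrow> tile_var h (h z) n c \<le> ennreal (\<delta> / (4 ^ n * M ^ n))"
proof -
  define E where "E r s = {z. of_rat r < h z \<and> h z < (of_rat s :: real)}" for r s
  have E: "E r s \<in> sets borel" for r s unfolding E_def by measurable
  have "AE z in lborel. \<forall>r s. \<forall>m. z \<in> E r s \<longrightarrow> (\<exists>n0. \<forall>n\<ge>n0. \<forall>c. adj n (fl n z) c \<longrightarrow>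
     emeasure lborel (tile n c - E r s) \<le> ennreal ((1 / real (Suc m)) / (4 ^ n * M ^ n)))"
    unfolding AE_all_countable by (intro allI density_eps E) simp
  thus ?thesis
  proof (rule eventually_mono, intro allI impI)
    fix z and \<delta> :: real
    assume dens: "\<forall>r s. \<forall>m. z \<in> E r s \<longrightarrow> (\<exists>n0. \<forall>n\<ge>n0. \<forall>c. adj n (fl n z) c \<longrightarrow>
     emeasure lborel (tile n c - E r s) \<le> ennreal ((1 / real (Suc m)) / (4 ^ n * M ^ n)))" and \<delta>: "\<delta> > 0"
    have C: "C \<ge> 0" using bd[of z] by linarith
    obtain r where r: "h z - \<delta> / 4 < of_rat r" "of_rat r < h z" using of_rat_dense[of "h z - \<delta> / 4" "h z"] \<delta> by auto
    obtain s where s: "h z < of_rat s" "of_rat s < h z + \<delta> / 4" using of_rat_dense[of "h z" "h z + \<delta> / 4"] \<delta> by auto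
    have "\<delta> / (4 * C + 1) > 0" using \<delta> C by simp
    then obtain m where m: "1 / real (Suc m) < \<delta> / (4 * C + 1)" by (rule nat_approx_posE)
    have "(4 * C + 1) * (1 / real (Suc m)) < \<delta>" using m C by (simp add: pos_less_divide_eq mult.commute)
    moreover have "0 \<le> 1 / real (Suc m)" by simp
    moreover have "(4 * C + 1) * (1 / real (Suc m)) = 2 * (2 * C * (1 / real (Suc m))) + 1 / real (Suc m)"
      unfolding distrib_right by simp
    ultimately have m': "2 * C * (1 / real (Suc m)) \<le> \<delta> / 2" by linarith
    have "z \<in> E r s" using r s by (simp add: E_def)
    then obtain n0 where n0: "\<And>n c. n \<ge> n0 \<Longrightarrow> adj n (fl n z) c \<Longrightarrow>
       emeasure lborel (tile n c - E r s) \<le> ennreal ((1 / real (Suc m)) / (4 ^ n * M ^ n))" using dens by blast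
    show "\<exists>n0. \<forall>n\<ge>n0. \<forall>c. adj n (fl n z) c \<longrightarrow> tile_var h (h z) n c \<le> ennreal (\<delta> / (4 ^ n * M ^ n))"
    proof (intro exI[of _ n0] allI impI)
      fix n c assume n: "n \<ge> n0" "adj n (fl n z) c"
      define T where "T = 4 ^ n * M ^ n"
      have T: "T > 0" unfolding T_def using Mpow(1)[of n] by simp
      have [measurable]: "tile n c \<in> sets borel" "E r s \<in> sets borel" using E by auto
      have "tile_var h (h z) n c \<le> (\<integral>\<^sup>+ u. ennreal (\<delta> / 2) * indicator (tile n c) u + ennreal (2 * C) * indicator (tile n c - E r s) u \<partial>lborel)"
        unfolding tile_var_def
      proof (rule nn_integral_mono)
        fix u
        have "\<bar>h u - h z\<bar> \<le> 2 * C" using bd[of u] bd[of z] by linarith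
        moreover have "u \<in> E r s \<Longrightarrow> \<bar>h u - h z\<bar> \<le> \<delta> / 2" using r s \<delta> unfolding E_def mem_Collect_eq by linarith
        ultimately show "ennreal \<bar>h u - h z\<bar> * indicator (tile n c) u
          \<le> ennreal (\<delta> / 2) * indicator (tile n c) u + ennreal (2 * C) * indicator (tile n c - E r s) u"
          using \<delta> C by (cases "u \<in> tile n c"; cases "u \<in> E r s")
            (auto simp: ennreal_leI intro: order_trans[OF ennreal_leI[of _ "2 * C"]])
      qed
      also have "\<dots> = ennreal (\<delta> / 2) * emeasure lborel (tile n c) + ennreal (2 * C) * emeasure lborel (tile n c - E r s)"
        by (subst nn_integral_add) (auto simp: nn_integral_cmult_indicator)
      also have "\<dots> \<le> ennreal (\<delta> / 2) * ennreal (1 / T) + ennreal (2 * C) * ennreal ((1 / real (Suc m)) / T)"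
        unfolding T_def emeasure_tile using n0[OF n] by (intro add_mono mult_left_mono) auto
      also have "\<dots> = ennreal ((\<delta> / 2) * (1 / T) + (2 * C) * ((1 / real (Suc m)) / T))"
        using \<delta> C T by (simp add: ennreal_mult[symmetric] ennreal_plus[symmetric] del: ennreal_plus)
      also have "\<dots> \<le> ennreal (\<delta> / T)"
      proof (rule ennreal_leI)
        have "(\<delta> / 2) * (1 / T) + (2 * C) * ((1 / real (Suc m)) / T) = (\<delta> / 2 + 2 * C * (1 / real (Suc m))) / T"
          by (simp add: add_divide_distrib)
        also have "\<dots> \<le> \<delta> / T" using m' T by (intro divide_right_mono) auto
        finally show "(\<delta> / 2) * (1 / T) + (2 * C) * ((1 / real (Suc m)) / T) \<le> \<delta> / T" .
      qed
      finally show "tile_var h (h z) n c \<le> ennreal (\<delta> / (4 ^ n * M ^ n))" by (simp add: T_def)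
    qed
  qed
qed

lemma corner_in_ccell: "corner n p v \<Longrightarrow> v \<in> ccell n (fl n p)"
  unfolding corner_def vertex_def cell_nat
  by (auto intro!: divide_right_mono zero_le_power less_imp_le[OF M_pos(1)])

abbreviation differential :: "((real \<times> real) set \<Rightarrow> real) \<Rightarrow> (nat \<Rightarrow> real) \<Rightarrow> (real \<times> real) set \<Rightarrow> bool" where
  "differential f \<equiv> has_differential_at (Xinf L) (dinf L) (\<lambda>q _. x_inf q) 1 f"

text \<open>A distance below \<open>1 / (14 * 4 ^ n)\<close> forces equivalent corners, so the error
  is bounded by the oscillations on two adjacent cells of level \<open>n\<close>; comparing the
  distance with these thresholds chooses \<open>n\<close>.\<close>

lemma has_differential_at_lebesgue_point:
  assumes F: "\<And>z. F z = f (pi_inf L z)"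
    and h: "h \<in> borel_measurable borel"
    and ok: "AE y in lborel. mesh_ok {x. adic x} F h y"
    and osc: "\<And>n a b z w. z \<in> cell L (int n) a b \<Longrightarrow> w \<in> cell L (int n) a b \<Longrightarrow> \<bar>F z - F w\<bar> \<le> C / 4 ^ n"
    and C: "C \<ge> 0"
    and leb: "\<And>\<delta>. \<delta> > 0 \<Longrightarrow> \<exists>n0. \<forall>n\<ge>n0. \<forall>c. adj n (fl n z) c \<longrightarrow> tile_var h a n c \<le> ennreal (\<delta> / (4 ^ n * M ^ n))"
  shows "differential f (\<lambda>_. a) (pi_inf L z)"
  unfolding has_differential_at_def
proof (intro allI impI)
  fix \<epsilon> :: real assume \<epsilon>: "\<epsilon> > 0"
  have inv: "F p = F q" if "(p, q) \<in> Rinf L" for p q using that by (simp add: F pi_inf_eq_iff[symmetric])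
  \<comment> \<open>\<open>112 = 2 * 14 * 4\<close>: two cells, the 14 of the separation threshold,
    and the ratio 4 between consecutive levels.\<close>
  define e where "e = \<epsilon> / 112"
  have e: "e > 0" using \<epsilon> by (simp add: e_def)
  obtain k0 where k0: "4 * (C + \<bar>a\<bar>) / e < 4 ^ k0" using real_arch_pow[of 4 "4 * (C + \<bar>a\<bar>) / e"] by auto
  define k where "k = Suc k0"
  have "(4::real) ^ k0 \<le> 4 ^ k" unfolding k_def by simp
  with k0 have "4 * (C + \<bar>a\<bar>) / e < 4 ^ k" by linarith
  hence k: "2 * (C + \<bar>a\<bar>) / 4 ^ k \<le> e / 2" using e by (simp add: field_simps)
  define \<delta> where "\<delta> = e / (24 * M ^ k)"
  have \<delta>: "\<delta> > 0" "12 * \<delta> * M ^ k = e / 2" using e Mpow(1)[of k] by (simp_all add: \<delta>_def)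
  obtain n0 where n0: "\<And>n c. n \<ge> n0 \<Longrightarrow> adj n (fl n z) c \<Longrightarrow> tile_var h a n c \<le> ennreal (\<delta> / (4 ^ n * M ^ n))"
    using leb[OF \<delta>(1)] by blast
  have cellosc: "\<bar>F u - F v - a * (fst u - fst v)\<bar> \<le> e / 4 ^ n"
    if "n \<ge> n0" "adj n (fl n z) c" "u \<in> ccell n c" "v \<in> ccell n c" for n c u v
  proof -
    have "tile_var h a n (fst c, snd c) \<le> ennreal (\<delta> / (4 ^ n * M ^ n))" using n0[OF that(1,2)] by simp
    from cell_oscillation[OF h ok inv osc this \<delta>(1) _ that(3,4), where k = k]
    have "\<bar>F u - F v - a * (fst u - fst v)\<bar> \<le> (2 * (C + \<bar>a\<bar>) / 4 ^ k + 12 * \<delta> * M ^ k) / 4 ^ n"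
      by (simp add: k_def)
    also have "\<dots> \<le> e / 4 ^ n"
    proof (rule divide_right_mono)
      show "2 * (C + \<bar>a\<bar>) / 4 ^ k + 12 * \<delta> * M ^ k \<le> e" using k \<delta>(2) by linarith
    qed simp
    finally show ?thesis .
  qed
  have main: "\<bar>F w - F z - a * (fst w - fst z)\<bar> \<le> 2 * e / 4 ^ n"
    if n: "n \<ge> n0" and d: "dpi z w < 1 / (14 * 4 ^ n)" for n w
  proof -
    have "14 * 4 ^ n * dpi z w < 1" using d by (simp add: pos_less_divide_eq mult.commute)
    then obtain v v' where v: "corner n z v" "corner n w v'" "(v, v') \<in> Rinf L"
      using dinf_small_imp_common_corner by blast
    have vc: "v \<in> ccell n (fl n z)" "v' \<in> ccell n (fl n w)" using v corner_in_ccell by blast+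
    have zc: "z \<in> ccell n (fl n z)" "w \<in> ccell n (fl n w)"
      by (rule in_ccell_fl)+
    have "adj n (fl n z) (fl n w)" unfolding adj_def using vc v(3) by blast
    hence 1: "\<bar>F w - F v' - a * (fst w - fst v')\<bar> \<le> e / 4 ^ n" using cellosc[OF n] zc vc by blast
    have "F v = F v'" "fst v = fst v'" using inv[OF v(3)] Rinf_fst[OF v(3)] by auto
    moreover have "\<bar>F v - F z - a * (fst v - fst z)\<bar> \<le> e / 4 ^ n" using cellosc[OF n adj_refl] zc vc by blast
    ultimately have 2: "\<bar>F v' - F z - a * (fst v' - fst z)\<bar> \<le> e / 4 ^ n" by simp
    have "F w - F z - a * (fst w - fst z) = (F w - F v' - a * (fst w - fst v')) + (F v' - F z - a * (fst v' - fst z))"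
      by (simp add: algebra_simps)
    also have "\<bar>\<dots>\<bar> \<le> e / 4 ^ n + e / 4 ^ n" by (rule order_trans[OF abs_triangle_ineq add_mono[OF 1 2]])
    finally show ?thesis by simp
  qed
  show "\<exists>\<delta>>0. \<forall>q\<in>Xinf L. dinf L (pi_inf L z) q < \<delta> \<longrightarrow>
     \<bar>f q - f (pi_inf L z) - (\<Sum>i<(1::nat). a * (x_inf q - x_inf (pi_inf L z)))\<bar> \<le> \<epsilon> * dinf L (pi_inf L z) q"
  proof (intro exI[of _ "1 / (14 * 4 ^ n0)"] conjI ballI impI)
    fix q assume "q \<in> Xinf L" and d: "dinf L (pi_inf L z) q < 1 / (14 * 4 ^ n0)"
    then obtain w where w: "q = pi_inf L w" by (metis Xinf_cases)
    define D where "D = dpi z w"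
    define R where "R = \<bar>F w - F z - a * (fst w - fst z)\<bar>"
    have D0: "D \<ge> 0" unfolding D_def by (intro dinf_nonneg) auto
    have R: "R \<le> 2 * e / 4 ^ n" if "n \<ge> n0" "D < 1 / (14 * 4 ^ n)" for n
      using main that unfolding R_def D_def by blast
    have "R \<le> \<epsilon> * D"
    \<comment> \<open>As \<open>dinf\<close> is handled as a pseudodistance, \<open>D = 0\<close> is
      a case of its own: the estimate holds at every level and forces the error to vanish.\<close>
    proof (cases "D = 0")
      case True
      have "R \<le> 0"
      proof (rule field_le_epsilon)
        fix \<eta> :: real assume "\<eta> > 0"
        obtain n where "2 * e / \<eta> < 4 ^ n" using real_arch_pow[of 4 "2 * e / \<eta>"] by auto
        moreover have "(4::real) ^ n \<le> 4 ^ max n n0" by (intro power_increasing) auto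
        ultimately have "2 * e / \<eta> < 4 ^ max n n0" by linarith
        hence "2 * e / 4 ^ max n n0 \<le> \<eta>" using \<open>\<eta> > 0\<close> by (simp add: field_simps)
        thus "R \<le> 0 + \<eta>" using R[of "max n n0"] True by simp
      qed
      thus ?thesis using True by simp
    next
      case False
      hence Dp: "D > 0" using D0 by simp
      obtain m where "1 / (14 * D) < 4 ^ m" using real_arch_pow[of 4 "1 / (14 * D)"] by auto
      hence m: "\<not> D < 1 / (14 * 4 ^ m)" using Dp by (simp add: field_simps)
      \<comment> \<open>The first level whose threshold does not exceed \<open>D\<close>. The level
        before it still satisfies the estimate, and its threshold is only 4 times larger.\<close>
      define n where "n = (LEAST n. n \<ge> n0 \<and> \<not> D < 1 / (14 * 4 ^ n))"
      have ex: "max m n0 \<ge> n0 \<and> \<not> D < 1 / (14 * 4 ^ max m n0)"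
      proof -
        have "1 / (14 * 4 ^ max m n0) \<le> (1::real) / (14 * 4 ^ m)"
          by (intro divide_left_mono mult_left_mono power_increasing) auto
        thus ?thesis using m by auto
      qed
      have n: "n \<ge> n0" "\<not> D < 1 / (14 * 4 ^ n)" using LeastI[of "\<lambda>n. n \<ge> n0 \<and> \<not> D < 1 / (14 * 4 ^ n)", OF ex] unfolding n_def by blast+
      have "n \<noteq> n0" using n(2) d unfolding D_def w by blast
      then obtain n' where n': "n = Suc n'" "n' \<ge> n0" using n(1) by (metis Suc_diff_Suc diff_Suc_1 le_neq_implies_less less_Suc_eq_le old.nat.exhaust not_less0)
      have "D < 1 / (14 * 4 ^ n')"
        using not_less_Least[of n' "\<lambda>n. n \<ge> n0 \<and> \<not> D < 1 / (14 * 4 ^ n)"] n' unfolding n_def by simp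
      hence "R \<le> 2 * e / 4 ^ n'" by (rule R[OF n'(2)])
      also have "2 * e / 4 ^ n' = \<epsilon> * (1 / (14 * 4 ^ n))" unfolding n' e_def by simp
      also have "\<dots> \<le> \<epsilon> * D" using n(2) \<epsilon> by (intro mult_left_mono) auto
      finally show ?thesis .
    qed
    thus "\<bar>f q - f (pi_inf L z) - (\<Sum>i<(1::nat). a * (x_inf q - x_inf (pi_inf L z)))\<bar> \<le> \<epsilon> * dinf L (pi_inf L z) q"
      by (simp add: R_def D_def w F)
  qed simp
qed

section \<open>Transfer from the plane to the quotient\<close>

lemma x_inf_measurable: "x_inf \<in> borel_measurable (borel_Xinf L)"
proof (rule borel_measurableI)
  fix S :: "real set" assume S: "open S"
  have "d_open L (x_inf -` S \<inter> Xinf L)"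
    unfolding d_open_def
  proof (intro conjI ballI)
    fix P assume P: "P \<in> x_inf -` S \<inter> Xinf L"
    then obtain e where e: "e > 0" "\<And>y. dist y (x_inf P) < e \<Longrightarrow> y \<in> S" using S unfolding open_dist by blast
    show "\<exists>e>0. \<forall>Q\<in>Xinf L. dinf L P Q < e \<longrightarrow> Q \<in> x_inf -` S \<inter> Xinf L"
    proof (intro exI[of _ e] conjI ballI impI e(1))
      fix Q assume Q: "Q \<in> Xinf L" "dinf L P Q < e"
      obtain p q where pq: "P = pi_inf L p" "Q = pi_inf L q" using P Q by (metis IntD2 Xinf_cases)
      have "dist (x_inf Q) (x_inf P) < e"
        using dinf_ge_fst[of p q] Q(2) unfolding pq by (simp add: dist_real_def abs_minus_commute)
      thus "Q \<in> x_inf -` S \<inter> Xinf L" using e(2) Q(1) by blast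
    qed
  qed blast
  thus "x_inf -` S \<inter> space (borel_Xinf L) \<in> sets (borel_Xinf L)" using d_open_sets by simp
qed

lemma adic_classes_sets: "{P \<in> Xinf L. adic (x_inf P)} \<in> sets (borel_Xinf L)"
proof -
  have "{x. adic x} \<in> sets borel" using countable_adic by (rule sets.countable[rotated]) auto
  from measurable_sets[OF x_inf_measurable this] show ?thesis
    by (simp add: vimage_def Int_def conj_commute)
qed

text \<open>A small quotient ball contains only points of cells adjacent to that of
  \<open>p\<close>, and off the 4-adic lines these shrink to \<open>p\<close> in the plane.\<close>

lemma pi_inf_open_at_non_adic:
  assumes U: "open U" "p \<in> U" and p: "\<not> adic (fst p)"
  shows "\<exists>e>0. \<forall>q. dpi p q < e \<longrightarrow> q \<in> U"
proof -
  obtain r where r: "r > 0" "\<And>w. dist w p < r \<Longrightarrow> w \<in> U" using U unfolding open_dist by blast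
  obtain n where n: "\<And>c w. adj n (fl n p) c \<Longrightarrow> w \<in> ccell n c \<Longrightarrow> \<bar>fst w - fst p\<bar> < r / 2 \<and> \<bar>snd w - snd p\<bar> < r / 2"
    using adj_shrinks[OF p half_gt_zero[OF r(1)]] by blast
  show ?thesis
  proof (intro exI[of _ "1 / (14 * 4 ^ n)"] conjI allI impI)
    fix q assume "dpi p q < 1 / (14 * 4 ^ n)"
    hence "14 * 4 ^ n * dpi p q < 1" by (simp add: pos_less_divide_eq mult.commute)
    then obtain v v' where v: "corner n p v" "corner n q v'" "(v, v') \<in> Rinf L"
      using dinf_small_imp_common_corner by blast
    hence "adj n (fl n p) (fl n q)" unfolding adj_def using corner_in_ccell by blast
    moreover have "q \<in> ccell n (fl n q)" by (rule in_ccell_fl)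
    ultimately have "\<bar>fst q - fst p\<bar> < r / 2 \<and> \<bar>snd q - snd p\<bar> < r / 2" by (rule n)
    moreover have "dist q p \<le> \<bar>fst q - fst p\<bar> + \<bar>snd q - snd p\<bar>"
      unfolding dist_prod_def dist_real_def by (rule order_trans[OF sqrt_sum_squares_le_sum_abs]) simp
    ultimately show "q \<in> U" by (intro r(2)) linarith
  qed simp
qed

lemma pi_inf_eq_non_adic: "pi_inf L p = pi_inf L q \<Longrightarrow> \<not> adic (fst p) \<Longrightarrow> p = q"
  using Rinf_non_adic by (simp add: pi_inf_eq_iff)

text \<open>Induction over the Borel sets. The classes on the 4-adic lines are removed, so that
  images of open sets are open up to a fixed Borel set and images commute with complements.\<close>

lemma pi_inf_image_sets:
  assumes "A \<in> sets borel"
  shows "pi_inf L ` (A - {z. adic (fst z)}) \<in> sets (borel_Xinf L)"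
proof -
  let ?Z = "{z :: real \<times> real. adic (fst z)}"
  let ?XZ = "{P \<in> Xinf L. adic (x_inf P)}"
  have "A \<in> sigma_sets UNIV {S. open S}" using assms by (simp add: borel_def)
  thus ?thesis
  proof induction
    case (Basic U)
    hence U: "open U" by simp
    \<comment> \<open>The union of the quotient balls around points off the 4-adic lines whose
      preimage stays in \<open>U\<close>.\<close>
    define W where "W = {P \<in> Xinf L. \<exists>p e. \<not> adic (fst p) \<and> (\<forall>q. dpi p q < e \<longrightarrow> q \<in> U) \<and> dinf L (pi_inf L p) P < e}"
    have "d_open L W"
      unfolding d_open_def
    proof (intro conjI ballI)
      fix P assume "P \<in> W"
      then obtain p e where pe: "P \<in> Xinf L" "\<not> adic (fst p)" "\<And>q. dpi p q < e \<Longrightarrow> q \<in> U"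
        "dinf L (pi_inf L p) P < e" unfolding W_def by blast
      show "\<exists>e>0. \<forall>Q\<in>Xinf L. dinf L P Q < e \<longrightarrow> Q \<in> W"
      proof (intro exI[of _ "e - dinf L (pi_inf L p) P"] conjI ballI impI)
        fix Q assume Q: "Q \<in> Xinf L" "dinf L P Q < e - dinf L (pi_inf L p) P"
        hence "dinf L (pi_inf L p) Q < e" using dinf_triangle[of "pi_inf L p" P Q] pe(1) by simp
        thus "Q \<in> W" unfolding W_def using pe Q(1) by blast
      qed (use pe in simp)
    qed (auto simp: W_def)
    hence "W - ?XZ \<in> sets (borel_Xinf L)" using d_open_sets adic_classes_sets by (intro sets.Diff)
    moreover have "pi_inf L ` (U - ?Z) = W - ?XZ"
    proof (intro equalityI subsetI)
      fix P assume "P \<in> pi_inf L ` (U - ?Z)"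
      then obtain p where p: "P = pi_inf L p" "p \<in> U" "\<not> adic (fst p)" by auto
      obtain e where "e > 0" "\<And>q. dpi p q < e \<Longrightarrow> q \<in> U"
        using pi_inf_open_at_non_adic[OF U p(2,3)] by blast
      moreover have "dinf L (pi_inf L p) P = 0" unfolding p by (simp add: dinf_self)
      ultimately have "P \<in> W"
        unfolding W_def using p(1,3) by (intro CollectI conjI exI[of _ p] exI[of _ e]) auto
      thus "P \<in> W - ?XZ" using p by simp
    next
      fix P assume P: "P \<in> W - ?XZ"
      then obtain q where q: "P = pi_inf L q" unfolding W_def by (metis (no_types, lifting) DiffD1 Xinf_cases mem_Collect_eq)
      have "\<exists>p e. (\<forall>q. dpi p q < e \<longrightarrow> q \<in> U) \<and> dinf L (pi_inf L p) P < e"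
        using P unfolding W_def by blast
      hence "q \<in> U" unfolding q by blast
      moreover have "\<not> adic (fst q)" using P unfolding q by simp
      ultimately show "P \<in> pi_inf L ` (U - ?Z)" unfolding q by blast
    qed
    ultimately show ?case by simp
  next
    case Empty show ?case by simp
  next
    case (Compl A)
    \<comment> \<open>This is where injectivity off the 4-adic lines enters.\<close>
    have "pi_inf L ` (UNIV - A - ?Z) = Xinf L - ?XZ - pi_inf L ` (A - ?Z)"
    proof (intro equalityI subsetI)
      fix P assume "P \<in> pi_inf L ` (UNIV - A - ?Z)"
      then obtain p where p: "P = pi_inf L p" "p \<notin> A" "\<not> adic (fst p)" by auto
      have "P \<notin> pi_inf L ` (A - ?Z)"
      proof
        assume "P \<in> pi_inf L ` (A - ?Z)"
        then obtain q where "q \<in> A" "pi_inf L p = pi_inf L q" unfolding p(1) by blast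
        thus False using pi_inf_eq_non_adic[of p q] p by blast
      qed
      thus "P \<in> Xinf L - ?XZ - pi_inf L ` (A - ?Z)" using p by simp
    next
      fix P assume P: "P \<in> Xinf L - ?XZ - pi_inf L ` (A - ?Z)"
      then obtain q where q: "P = pi_inf L q" by (metis DiffD1 Xinf_cases)
      thus "P \<in> pi_inf L ` (UNIV - A - ?Z)" using P by auto
    qed
    moreover have "Xinf L \<in> sets (borel_Xinf L)" using sets.top[of "borel_Xinf L"] by simp
    ultimately show ?case using Compl adic_classes_sets by (auto intro!: sets.Diff)
  next
    case (Union A)
    have "pi_inf L ` ((\<Union>i. A i) - ?Z) = (\<Union>i. pi_inf L ` (A i - ?Z))" by blast
    thus ?case using Union by (auto intro!: sets.countable_UN)
  qed
qed

lemma sets_mu [simp]: "sets (mu_inf L) = sets (borel_Xinf L)"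
  and space_mu [simp]: "space (mu_inf L) = Xinf L"
  by (simp_all add: mu_inf_def)

lemma emeasure_mu: "A \<in> sets (borel_Xinf L) \<Longrightarrow> emeasure (mu_inf L) A = emeasure lborel (pi_inf L -` A)"
  unfolding mu_inf_def by (subst emeasure_distr) auto

text \<open>The image of a null set need not be Borel, but \<open>pi_inf L\<close> is a homeomorphism onto its image off the
  4-adic vertical lines.\<close>

lemma AE_mu_inf:
  assumes "AE z in lborel. P (pi_inf L z)"
  shows "AE p in mu_inf L. P p"
proof -
  let ?Z = "{z :: real \<times> real. adic (fst z)}"
  obtain N where N: "\<And>z. z \<in> space lborel - N \<Longrightarrow> P (pi_inf L z)" "N \<in> null_sets lborel"
    by (rule AE_E3[OF assms]) blast
  have "- N \<in> sets borel" using N(2) by (auto simp: null_sets_def)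
  hence S: "pi_inf L ` (- N - ?Z) \<in> sets (borel_Xinf L)" by (rule pi_inf_image_sets)
  define B where "B = Xinf L - pi_inf L ` (- N - ?Z)"
  have B: "B \<in> sets (borel_Xinf L)" unfolding B_def using S sets.top[of "borel_Xinf L"] by (intro sets.Diff) simp_all
  have "emeasure (mu_inf L) B = emeasure lborel (pi_inf L -` B)" by (rule emeasure_mu[OF B])
  also have "\<dots> \<le> emeasure lborel (N \<union> ?Z)"
    by (rule emeasure_mono[OF _ null_setsD2[OF null_sets.Un[OF N(2) null_adic]]]) (auto simp: B_def)
  also have "\<dots> = 0" using null_sets.Un[OF N(2) null_adic] by (rule null_setsD1)
  finally have "B \<in> null_sets (mu_inf L)" using B by (simp add: null_sets_def)
  thus ?thesis
  proof (rule AE_I')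
    show "{p \<in> space (mu_inf L). \<not> P p} \<subseteq> B" unfolding B_def using N(1) by auto
  qed
qed

text \<open>Off the 4-adic lines a class is a single point and the choice is forced; on them, a null
  set, a constant keeps the function Borel.\<close>

definition descend :: "(real \<times> real \<Rightarrow> real) \<Rightarrow> (real \<times> real) set \<Rightarrow> real" where
  "descend h P = (if adic (x_inf P) then 0 else h (SOME z. z \<in> P))"

lemma descend_pi: "\<not> adic (fst z) \<Longrightarrow> descend h (pi_inf L z) = h z"
  using Rinf_non_adic[OF Some_pi_inf[of z]] by (simp add: descend_def)

lemma descend_measurable:
  assumes h: "h \<in> borel_measurable borel"
  shows "descend h \<in> borel_measurable (borel_Xinf L)"
proof (rule measurableI)
  fix B :: "real set" assume B: "B \<in> sets borel"
  let ?Z = "{z :: real \<times> real. adic (fst z)}"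
  have "descend h -` B \<inter> Xinf L = pi_inf L ` (h -` B - ?Z) \<union> (if 0 \<in> B then {P \<in> Xinf L. adic (x_inf P)} else {})"
  proof (intro equalityI subsetI)
    fix P assume P: "P \<in> descend h -` B \<inter> Xinf L"
    then obtain z where z: "P = pi_inf L z" by (metis IntD2 Xinf_cases)
    show "P \<in> pi_inf L ` (h -` B - ?Z) \<union> (if 0 \<in> B then {P \<in> Xinf L. adic (x_inf P)} else {})"
    proof (cases "adic (fst z)")
      case True
      thus ?thesis using P by (auto simp: z descend_def)
    next
      case False
      thus ?thesis using P by (auto simp: z descend_pi)
    qed
  next
    fix P assume "P \<in> pi_inf L ` (h -` B - ?Z) \<union> (if 0 \<in> B then {P \<in> Xinf L. adic (x_inf P)} else {})"
    then consider z where "P = pi_inf L z" "h z \<in> B" "\<not> adic (fst z)" | "0 \<in> B" "P \<in> Xinf L" "adic (x_inf P)"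
      by (auto split: if_splits)
    thus "P \<in> descend h -` B \<inter> Xinf L"
    proof cases
      case 1 thus ?thesis by (simp add: descend_pi)
    next
      case 2 thus ?thesis by (simp add: descend_def)
    qed
  qed
  moreover have "h -` B \<in> sets borel" using measurable_sets[OF h B] by simp
  ultimately show "descend h -` B \<inter> space (borel_Xinf L) \<in> sets (borel_Xinf L)"
    using pi_inf_image_sets adic_classes_sets by auto
qed simp

lemma lipschitz_differential:
  assumes f: "lipschitz_X (Xinf L) (dinf L) f"
  obtains h B where "h \<in> borel_measurable borel" "\<forall>z. \<bar>h z\<bar> \<le> B"
    "AE z in lborel. \<not> adic (fst z) \<and> differential f (\<lambda>_. h z) (pi_inf L z)"
proof -
  obtain C0 where C0: "\<And>P Q. P \<in> Xinf L \<Longrightarrow> Q \<in> Xinf L \<Longrightarrow> \<bar>f P - f Q\<bar> \<le> C0 * dinf L P Q"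
    using f unfolding lipschitz_X_def by blast
  \<comment> \<open>A Lipschitz constant in the sense of \<open>lipschitz_X\<close> need not be
    positive, but the shear requires \<open>C > 0\<close>.\<close>
  define C where "C = \<bar>C0\<bar> + 1"
  have C: "C > 0" by (simp add: C_def)
  have lip: "\<bar>f P - f Q\<bar> \<le> C * dinf L P Q" if "P \<in> Xinf L" "Q \<in> Xinf L" for P Q
  proof -
    have "C0 * dinf L P Q \<le> C * dinf L P Q" using dinf_nonneg[OF that] by (intro mult_right_mono) (auto simp: C_def)
    thus ?thesis using C0[OF that] by linarith
  qed
  define F where "F z = f (pi_inf L z)" for z
  have "sheared F C"
  proof
    show "continuous_on UNIV F" unfolding F_def using lipschitz_continuous[OF f] .
    show "\<bar>F (s, y) - F (t, y)\<bar> \<le> C * \<bar>s - t\<bar>" for s y t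
      using lip[of "pi_inf L (s, y)" "pi_inf L (t, y)"] by (simp add: F_def dinf_horizontal)
  qed (rule C)
  then obtain h where h: "h \<in> borel_measurable borel" "\<And>z. \<bar>h z\<bar> \<le> 2 * C" "AE y in lborel. mesh_ok {x. adic x} F h y"
    using horizontal_density[OF _ countable_adic, of F C] unfolding mesh_ok_def by blast
  have osc: "\<bar>F z - F w\<bar> \<le> C / 4 ^ n" if "z \<in> cell L (int n) a b" "w \<in> cell L (int n) a b" for n a b z w
  proof -
    have "C * dpi z w \<le> C * (1 / 4 ^ n)"
      using dinf_cell[OF that] C unfolding powi_nat by (intro mult_left_mono) auto
    thus ?thesis using lip[of "pi_inf L z" "pi_inf L w"] by (simp add: F_def)
  qed
  have "AE z in lborel. differential f (\<lambda>_. h z) (pi_inf L z)"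
    using lebesgue_point[OF h(1,2)]
  proof (rule eventually_mono)
    fix z assume leb: "\<forall>\<delta>>0. \<exists>n0. \<forall>n\<ge>n0. \<forall>c. adj n (fl n z) c \<longrightarrow> tile_var h (h z) n c \<le> ennreal (\<delta> / (4 ^ n * M ^ n))"
    show "differential f (\<lambda>_. h z) (pi_inf L z)"
      by (rule has_differential_at_lebesgue_point[OF F_def h(1,3) osc less_imp_le[OF C]]) (use leb in blast)+
  qed
  moreover have "AE z in lborel. \<not> adic (fst (z :: real \<times> real))" using null_adic by (rule AE_I') auto
  ultimately have "AE z in lborel. \<not> adic (fst z) \<and> differential f (\<lambda>_. h z) (pi_inf L z)"
    by eventually_elim blast
  with h that show ?thesis by blast
qed

lemma has_differential_at_iff:
  "differential f df (pi_inf L z) \<longleftrightarrow>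
    (\<forall>\<epsilon>>0. \<exists>\<delta>>0. \<forall>w. dpi z w < \<delta> \<longrightarrow>
       \<bar>f (pi_inf L w) - f (pi_inf L z) - df 0 * (fst w - fst z)\<bar> \<le> \<epsilon> * dpi z w)"
proof -
  have "(\<forall>q\<in>Xinf L. R q) \<longleftrightarrow> (\<forall>w. R (pi_inf L w))" for R by (metis Xinf_cases pi_inf_in)
  thus ?thesis unfolding has_differential_at_def by simp
qed

text \<open>Horizontal lines are isometric, so an error \<open>o(d)\<close> becomes the usual
  one-variable error. Uniqueness of the coefficient in the chart and its agreement with
  \<open>dx_lift\<close> both come from here.\<close>

lemma has_differential_imp_DERIV:
  assumes "differential f df (pi_inf L z)"
  shows "((\<lambda>t. f (pi_inf L (t, snd z))) has_real_derivative df 0) (at (fst z))"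
  unfolding has_field_derivative_def has_derivative_at_alt
proof (intro conjI allI impI)
  show "bounded_linear ((*) (df 0))" by (rule bounded_linear_mult_right)
  fix e :: real assume "e > 0"
  then obtain d where d: "d > 0" "\<And>w. dpi z w < d \<Longrightarrow>
       \<bar>f (pi_inf L w) - f (pi_inf L z) - df 0 * (fst w - fst z)\<bar> \<le> e * dpi z w"
    using assms unfolding has_differential_at_iff by blast
  have dd: "dpi z (t, snd z) = \<bar>t - fst z\<bar>" for t
    using dinf_horizontal[of "fst z" "snd z" t] by (simp add: abs_minus_commute)
  show "\<exists>d>0. \<forall>y. norm (y - fst z) < d \<longrightarrow>
      norm (f (pi_inf L (y, snd z)) - f (pi_inf L (fst z, snd z)) - df 0 * (y - fst z)) \<le> e * norm (y - fst z)"
    using d dd by (intro exI[of _ d]) (metis fst_conv prod.collapse real_norm_def)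
qed

section \<open>The chart and the horizontal lines\<close>

text \<open>From above, \<open>x_inf\<close> is 1-Lipschitz. From below, the horizontal line through
  \<open>z\<close> has a point at distance exactly \<open>r\<close> where the first coordinate has
  moved by \<open>r\<close>. Hence the quotients even converge.\<close>

lemma lip_at_eq:
  assumes "differential f df (pi_inf L z)"
  shows "lip_at (Xinf L) (dinf L) f (pi_inf L z) = \<bar>df 0\<bar>"
proof -
  define a where "a = df 0"
  define p where "p = pi_inf L z"
  define S where "S r = (SUP q\<in>{q\<in>Xinf L. dinf L p q \<le> r}. \<bar>f q - f p\<bar>)" for r
  have "((\<lambda>r. S r / r) \<longlongrightarrow> \<bar>a\<bar>) (at_right 0)"
    unfolding tendsto_iff
  proof (intro allI impI)
    fix e :: real assume "e > 0"
    then obtain d where d: "d > 0" "\<And>w. dinf L p (pi_inf L w) < d \<Longrightarrow>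
       \<bar>f (pi_inf L w) - f p - a * (fst w - fst z)\<bar> \<le> (e / 2) * dinf L p (pi_inf L w)"
      using assms unfolding has_differential_at_iff a_def p_def by (meson half_gt_zero)
    have "dist (S r / r) \<bar>a\<bar> < e" if r: "0 < r" "r < d" for r
    proof -
      let ?Q = "{q\<in>Xinf L. dinf L p q \<le> r}"
      have up: "\<bar>f q - f p\<bar> \<le> (\<bar>a\<bar> + e / 2) * r" if "q \<in> ?Q" for q
      proof -
        obtain w where w: "q = pi_inf L w" using \<open>q \<in> ?Q\<close> by (metis (no_types, lifting) Xinf_cases mem_Collect_eq)
        have le: "dinf L p (pi_inf L w) \<le> r" using \<open>q \<in> ?Q\<close> w by simp
        have "\<bar>fst w - fst z\<bar> \<le> r" using dinf_ge_fst[of z w] le unfolding p_def by linarith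
        hence "\<bar>a * (fst w - fst z)\<bar> \<le> \<bar>a\<bar> * r" unfolding abs_mult by (intro mult_left_mono) auto
        moreover have "(e / 2) * dinf L p (pi_inf L w) \<le> (e / 2) * r" using le \<open>e > 0\<close> by (intro mult_left_mono) auto
        moreover have "\<bar>f (pi_inf L w) - f p - a * (fst w - fst z)\<bar> \<le> (e / 2) * dinf L p (pi_inf L w)"
          using d(2)[of w] le r by linarith
        ultimately show ?thesis unfolding w distrib_right by linarith
      qed
      have "p \<in> ?Q" using r by (simp add: p_def dinf_self)
      hence "?Q \<noteq> {}" by blast
      hence S_up: "S r \<le> (\<bar>a\<bar> + e / 2) * r" unfolding S_def using up by (intro cSUP_least)
      define w where "w = (fst z + r, snd z)"
      have dw: "dinf L p (pi_inf L w) = r"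
        using dinf_horizontal[of "fst z" "snd z" "fst z + r"] r by (simp add: w_def p_def)
      have "\<bar>f (pi_inf L w) - f p\<bar> \<le> S r"
        unfolding S_def
      proof (rule cSUP_upper)
        show "pi_inf L w \<in> ?Q" using dw by simp
        show "bdd_above ((\<lambda>q. \<bar>f q - f p\<bar>) ` ?Q)" using up by (auto intro!: bdd_aboveI2)
      qed
      moreover have "\<bar>f (pi_inf L w) - f p - a * r\<bar> \<le> (e / 2) * r"
        using d(2)[of w] dw r by (simp add: w_def)
      moreover have "\<bar>a * r\<bar> = \<bar>a\<bar> * r" using r by (simp add: abs_mult)
      ultimately have "\<bar>a\<bar> * r - (e / 2) * r \<le> S r" by linarith
      hence "(\<bar>a\<bar> - e / 2) \<le> S r / r" using r by (simp add: pos_le_divide_eq left_diff_distrib)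
      moreover have "S r / r \<le> \<bar>a\<bar> + e / 2" using S_up r by (simp add: pos_divide_le_eq)
      ultimately show ?thesis using \<open>e > 0\<close> unfolding dist_real_def by linarith
    qed
    thus "eventually (\<lambda>r. dist (S r / r) \<bar>a\<bar> < e) (at_right 0)"
      using d(1) unfolding eventually_at_right_field by (intro exI[of _ d]) auto
  qed
  hence "((\<lambda>r. ereal (S r / r)) \<longlongrightarrow> ereal \<bar>a\<bar>) (at_right 0)" by (rule tendsto_ereal)
  hence "Limsup (at_right 0) (\<lambda>r. ereal (S r / r)) = ereal \<bar>a\<bar>"
    by (intro lim_imp_Limsup) (simp_all add: trivial_limit_at_right_real)
  thus ?thesis unfolding lip_at_def S_def a_def p_def by simp
qed

lemma pi_line_measurable: "(\<lambda>t. pi_inf L (t, y)) \<in> borel \<rightarrow>\<^sub>M borel_Xinf L"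
  by (rule measurable_compose[OF _ pi_inf_measurable]) (simp add: borel_prod[symmetric])

lemma chart: "cheeger_chart (Xinf L) (dinf L) (mu_inf L) (Xinf L) (\<lambda>p _. x_inf p) 1"
  unfolding cheeger_chart_def
proof (intro conjI allI impI)
  have X: "Xinf L \<in> sets (borel_Xinf L)" using sets.top[of "borel_Xinf L"] by simp
  thus "Xinf L \<in> sets (mu_inf L)" by simp
  have "pi_inf L -` Xinf L = UNIV" by auto
  thus "emeasure (mu_inf L) (Xinf L) > 0" using emeasure_mu[OF X] by simp
  show "lipschitz_X (Xinf L) (dinf L) x_inf"
    unfolding lipschitz_X_def using dinf_ge_fst by (intro exI[of _ 1] ballI) (metis Xinf_cases mult_1 x_inf_pi)
  fix f assume "lipschitz_X (Xinf L) (dinf L) f"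
  then obtain h B where h: "AE z in lborel. \<not> adic (fst z) \<and> differential f (\<lambda>_. h z) (pi_inf L z)"
    by (rule lipschitz_differential)
  show "AE p in mu_inf L. p \<in> Xinf L \<longrightarrow>
           (\<exists>df. differential f df p \<and>
              (\<forall>df'. differential f df' p \<longrightarrow> (\<forall>i<1. df' i = df i)))"
  proof (rule AE_mu_inf, rule eventually_mono[OF h], intro impI)
    fix z assume z: "\<not> adic (fst z) \<and> differential f (\<lambda>_. h z) (pi_inf L z)"
    show "\<exists>df. differential f df (pi_inf L z) \<and>
              (\<forall>df'. differential f df' (pi_inf L z) \<longrightarrow> (\<forall>i<1. df' i = df i))"
    proof (intro exI[of _ "\<lambda>_. h z"] conjI allI impI)
      show "differential f (\<lambda>_. h z) (pi_inf L z)" using z by blast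
      fix df' and i :: nat
      assume "differential f df' (pi_inf L z)" "i < 1"
      thus "df' i = h z"
        using DERIV_unique[OF has_differential_imp_DERIV[of f df' z] has_differential_imp_DERIV[of f "\<lambda>_. h z" z]] z
        by simp
    qed
  qed
qed

text \<open>The witness is \<open>descend h\<close>. It agrees almost everywhere with
  \<open>dx_lift\<close> because a differential determines the horizontal derivative; measurability
  of \<open>dx_lift\<close> is needed to exchange the two under the integral.\<close>

lemma differential_D_inf:
  assumes f: "lipschitz_X (Xinf L) (dinf L) f"
  shows "\<exists>a. a \<in> borel_measurable (mu_inf L) \<and> (\<exists>B. \<forall>p\<in>Xinf L. \<bar>a p\<bar> \<le> B) \<and> is_D_inf L f a \<and>
     (AE p in mu_inf L. differential f (\<lambda>_. a p) p)"
proof -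
  obtain h B where h: "h \<in> borel_measurable borel" "\<forall>z. \<bar>h z\<bar> \<le> B"
    and ae: "AE z in lborel. \<not> adic (fst z) \<and> differential f (\<lambda>_. h z) (pi_inf L z)"
    by (rule lipschitz_differential[OF f])
  have meas: "descend h \<in> borel_measurable (borel_Xinf L)" by (rule descend_measurable[OF h(1)])
  have dx_meas: "dx_lift L f \<in> borel_measurable borel"
    using deriv_fst_measurable[OF lipschitz_continuous[OF f]] unfolding dx_lift_def[abs_def] .
  have eq: "AE z in lborel. descend h (pi_inf L z) = dx_lift L f z"
    using ae
  proof (rule eventually_mono)
    fix z assume z: "\<not> adic (fst z) \<and> differential f (\<lambda>_. h z) (pi_inf L z)"
    thus "descend h (pi_inf L z) = dx_lift L f z"
      using DERIV_imp_deriv[OF has_differential_imp_DERIV] by (auto simp: descend_pi dx_lift_def)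
  qed
  have "is_D_inf L f (descend h)"
    unfolding is_D_inf_def
  proof (intro allI impI)
    fix g :: "(real \<times> real) set \<Rightarrow> real" assume g: "integrable (mu_inf L) g"
    hence gm: "g \<in> borel_measurable (borel_Xinf L)" using borel_measurable_integrable[OF g] by (simp cong: measurable_cong_sets)
    have "(\<integral>p. g p * descend h p \<partial>mu_inf L) = (\<integral>z. g (pi_inf L z) * descend h (pi_inf L z) \<partial>lborel)"
      unfolding mu_inf_def using gm meas by (subst integral_distr) auto
    also have "\<dots> = (\<integral>z. g (pi_inf L z) * dx_lift L f z \<partial>lborel)"
    proof (rule integral_cong_AE)
      have gp: "(\<lambda>z. g (pi_inf L z)) \<in> borel_measurable borel" "(\<lambda>z. descend h (pi_inf L z)) \<in> borel_measurable borel"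
        using measurable_compose[OF pi_inf_measurable gm] measurable_compose[OF pi_inf_measurable meas] .
      show "(\<lambda>z. g (pi_inf L z) * descend h (pi_inf L z)) \<in> borel_measurable lborel"
        "(\<lambda>z. g (pi_inf L z) * dx_lift L f z) \<in> borel_measurable lborel"
        using gp dx_meas by auto
      show "AE z in lborel. g (pi_inf L z) * descend h (pi_inf L z) = g (pi_inf L z) * dx_lift L f z"
        using eq by eventually_elim simp
    qed
    finally show "(\<integral>p. g p * descend h p \<partial>mu_inf L) = (\<integral>z. g (pi_inf L z) * dx_lift L f z \<partial>lborel)" .
  qed
  moreover have "AE p in mu_inf L. differential f (\<lambda>_. descend h p) p"
    by (rule AE_mu_inf, rule eventually_mono[OF ae]) (auto simp: descend_pi)
  moreover have "descend h \<in> borel_measurable (mu_inf L)" using meas by (simp cong: measurable_cong_sets)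
  moreover have "\<bar>descend h p\<bar> \<le> B" for p 
  proof -
    have "\<bar>h z\<bar> \<le> B" for z using h(2) by blast
    moreover have "0 \<le> B" using order_trans[OF abs_ge_zero h(2)[rule_format]] .
    ultimately show ?thesis by (simp add: descend_def)
  qed
  ultimately show ?thesis by blast
qed

text \<open>Fubini is the disintegration, and isometry gives the bi-Lipschitz constant 1 and the
  speed 1. Universality then says that the absolute horizontal derivative is the pointwise Lipschitz
  constant, which holds wherever \<open>f\<close> has a differential.\<close>

lemma horizontal_lines_universal:
  "universal_alberti_rep_lines (Xinf L) (dinf L) (mu_inf L) (\<lambda>y t. pi_inf L (t, y))"
  unfolding universal_alberti_rep_lines_def
proof (intro conjI)
  have lm: "(\<lambda>t. pi_inf L (t, y)) \<in> lborel \<rightarrow>\<^sub>M mu_inf L" for y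
    using pi_line_measurable by (simp cong: measurable_cong_sets)
  thus "\<forall>y. (\<lambda>t. pi_inf L (t, y)) \<in> lborel \<rightarrow>\<^sub>M mu_inf L" by blast
  show "\<forall>y. \<exists>C\<ge>1. \<forall>s t. pi_inf L (s, y) \<in> Xinf L \<and> \<bar>s - t\<bar> / C \<le> dpi (s, y) (t, y) \<and>
         dpi (s, y) (t, y) \<le> C * \<bar>s - t\<bar>"
    by (intro allI exI[of _ 1]) (simp add: dinf_horizontal)
  show "\<forall>A\<in>sets (mu_inf L). (\<lambda>y. emeasure (distr lborel (mu_inf L) (\<lambda>t. pi_inf L (t, y))) A) \<in> borel_measurable lborel \<and>
      emeasure (mu_inf L) A = (\<integral>\<^sup>+ y. emeasure (distr lborel (mu_inf L) (\<lambda>t. pi_inf L (t, y))) A \<partial>lborel)"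
  proof
    fix A assume A: "A \<in> sets (mu_inf L)"
    define B where "B = pi_inf L -` A"
    have "B \<in> sets borel" unfolding B_def using measurable_sets[OF pi_inf_measurable, of A] A by simp
    hence B: "B \<in> sets (lborel \<Otimes>\<^sub>M lborel)" unfolding lborel_prod by simp
    have em: "emeasure (distr lborel (mu_inf L) (\<lambda>t. pi_inf L (t, y))) A = emeasure lborel ((\<lambda>t. (t, y)) -` B)" for y
      by (subst emeasure_distr[OF lm A]) (simp add: B_def vimage_def)
    have "emeasure (mu_inf L) A = emeasure lborel B" using emeasure_mu[of A] A by (simp add: B_def)
    thus "(\<lambda>y. emeasure (distr lborel (mu_inf L) (\<lambda>t. pi_inf L (t, y))) A) \<in> borel_measurable lborel \<and>
      emeasure (mu_inf L) A = (\<integral>\<^sup>+ y. emeasure (distr lborel (mu_inf L) (\<lambda>t. pi_inf L (t, y))) A \<partial>lborel)"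
      using lborel_pair.measurable_emeasure_Pair2[OF B] lborel_pair.emeasure_pair_measure_alt2[OF B]
      unfolding em lborel_prod by simp
  qed
  show "\<forall>f. lipschitz_X (Xinf L) (dinf L) f \<longrightarrow> (AE y in lborel. AE t in lborel. \<exists>D v. ((\<lambda>s. f (pi_inf L (s, y))) has_real_derivative D) (at t) \<and>
            has_metric_speed (dinf L) (\<lambda>t. pi_inf L (t, y)) t v \<and> \<bar>D\<bar> = lip_at (Xinf L) (dinf L) f (pi_inf L (t, y)) * v)"
  proof (intro allI impI)
  fix f assume "lipschitz_X (Xinf L) (dinf L) f"
  then obtain h B where "AE z in lborel. \<not> adic (fst z) \<and> differential f (\<lambda>_. h z) (pi_inf L z)"
    by (rule lipschitz_differential)
  hence ae: "AE y in lborel. AE t in lborel. \<not> adic (fst (t, y)) \<and> differential f (\<lambda>_. h (t, y)) (pi_inf L (t, y))"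
    by (rule AE_lborel_horizontal)
  have wit: "\<exists>D v. ((\<lambda>s. f (pi_inf L (s, y))) has_real_derivative D) (at t) \<and>
            has_metric_speed (dinf L) (\<lambda>t. pi_inf L (t, y)) t v \<and> \<bar>D\<bar> = lip_at (Xinf L) (dinf L) f (pi_inf L (t, y)) * v"
    if d: "differential f (\<lambda>_. h (t, y)) (pi_inf L (t, y))" for y t
  proof (rule exI[of _ "h (t, y)"], rule exI[of _ 1], intro conjI)
    show "((\<lambda>s. f (pi_inf L (s, y))) has_real_derivative h (t, y)) (at t)"
      using has_differential_imp_DERIV[OF d] by simp
    show "\<bar>h (t, y)\<bar> = lip_at (Xinf L) (dinf L) f (pi_inf L (t, y)) * 1" using lip_at_eq[OF d] by simp
    have "eventually (\<lambda>r. dpi (t + r, y) (t, y) / \<bar>r\<bar> = 1) (at 0)"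
      unfolding dinf_horizontal eventually_at by (intro exI[of _ 1]) auto
    thus "has_metric_speed (dinf L) (\<lambda>t. pi_inf L (t, y)) t 1"
      unfolding has_metric_speed_def by (rule tendsto_eventually)
  qed
  show "AE y in lborel. AE t in lborel. \<exists>D v. ((\<lambda>s. f (pi_inf L (s, y))) has_real_derivative D) (at t) \<and>
            has_metric_speed (dinf L) (\<lambda>t. pi_inf L (t, y)) t v \<and> \<bar>D\<bar> = lip_at (Xinf L) (dinf L) f (pi_inf L (t, y)) * v"
    using ae by (rule eventually_mono) (erule eventually_mono, rule wit, blast)
  qed
qed

end

theorem mainTheorem18:
  fixes L :: nat
  assumes "L \<ge> 100"
  shows "analytic_dimension (Xinf L) (dinf L) (mu_inf L) 1
     \<and> cheeger_chart (Xinf L) (dinf L) (mu_inf L) (Xinf L) (\<lambda>p _. x_inf p) 1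
     \<and> (\<forall>f. lipschitz_X (Xinf L) (dinf L) f \<longrightarrow>
          (\<exists>a. a \<in> borel_measurable (mu_inf L) \<and> (\<exists>B. \<forall>p\<in>Xinf L. \<bar>a p\<bar> \<le> B) \<and>
               is_D_inf L f a \<and>
               (AE p in mu_inf L. has_differential_at (Xinf L) (dinf L) (\<lambda>q _. x_inf q) 1 f (\<lambda>_. a p) p)))
     \<and> universal_alberti_rep_lines (Xinf L) (dinf L) (mu_inf L) (\<lambda>y t. pi_inf L (t, y))"
proof -
  interpret slit_plane L by unfold_locales (rule assms)
  have "AE p in mu_inf L. p \<in> Xinf L" using AE_space[of "mu_inf L"] by simp
  hence "analytic_dimension (Xinf L) (dinf L) (mu_inf L) 1"
    unfolding analytic_dimension_def using chart
    by (intro exI[of _ "{0}"] exI[of _ "\<lambda>_. Xinf L"] exI[of _ "\<lambda>_ p _. x_inf p"] exI[of _ "\<lambda>_. 1"]) simp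
  thus ?thesis using chart differential_D_inf horizontal_lines_universal by blast
qed

end
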